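(* Let $N\ge 1$ and $0<\theta\le 2$. For a nonnegative measurable function $\phi$ on $\mathbb{R}^N$ consider the Cauchy problem $$\partial_t u+(-\Delta)^{\theta/2}u=e^u\ \text{ in } \mathbb{R}^N\times(0,T),\qquad u(x,0)=\phi(x)\ \text{ in }\mathbb{R}^N. \qquad (P)$$ Then the following hold. (i) Assume that $r>N/\theta$. If $\phi\ge 0$ and $e^{r\phi}\in L^1_{\mathrm{ul},\rho}(\mathbb{R}^N)$, then (P) has a local-in-time (integral) solution. (ii) Let $r:=N/\theta$. If $\phi\ge0$ and $e^{r\phi}\in\mathcal{L}^1_{\mathrm{ul},\rho}(\mathbb{R}^N)$, then (P) has a local-in-time (integral) solution. (iii) For any $r\in(0,N/\theta)$ there is $\phi\ge 0$ such that $e^{r\phi}\in L^1_{\mathrm{ul},\rho}(\mathbb{R}^N)$ and (P) has no local-in-time nonnegative (integral) solution.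
   Context: Uniformly local spaces: for a fixed $\rho>0$, $L^1_{\mathrm{ul},\rho}(\mathbb{R}^N)$ is the set of $u\in L^1_{\mathrm{loc}}(\mathbb{R}^N)$ with $\|u\|_{L^1_{\mathrm{ul},\rho}}=\sup_{y\in\mathbb{R}^N}\int_{B_y(\rho)}|u(x)|\,dx<\infty$, where $B_y(\rho)=\{x:|x-y|<\rho\}$. $\mathcal{L}^1_{\mathrm{ul},\rho}(\mathbb{R}^N)$ is the closure of the space $BUC(\mathbb{R}^N)$ of bounded uniformly continuous functions in $L^1_{\mathrm{ul},\rho}(\mathbb{R}^N)$. Semigroup: $G(x,t)=(2\pi)^{-N}\int_{\mathbb{R}^N}e^{ix\cdot\xi-t|\xi|^\theta}d\xi$ is the fundamental solution of $\partial_tu+(-\Delta)^{\theta/2}u=0$ (a positive function with $\int_{\mathbb{R}^N} G(x,t)dx=1$), and $S(t)[\psi](x)=\int_{\mathbb{R}^N}G(x-y,t)\psi(y)\,dy$; for nonnegative measurable $\psi$ this takes values in $[0,\infty]$. Integral solution: a nonnegative measurable function $u$ on $\mathbb{R}^N\times(0,T)$ is a solution of (P) on $(0,T)$ if $$\infty>u(t)=S(t)\phi+\int_0^tS(t-s)[e^{u(s)}]\,ds\quad\text{a.e. } x\in\mathbb{R}^N,\ 0<t<T.$$ (P) has a local-in-time solution if such a $u$ exists for some $T>0$. *)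

theory Defs
  imports "HOL-Analysis.Analysis"
begin

definition L1_loc :: "('a::euclidean_space \<Rightarrow> real) set" where
  "L1_loc = {u. \<forall>K. compact K \<longrightarrow> u absolutely_integrable_on K}"

definition ul_norm :: "real \<Rightarrow> ('a::euclidean_space \<Rightarrow> real) \<Rightarrow> ennreal" where
  "ul_norm \<rho> u = (SUP y. \<integral>\<^sup>+x\<in>ball y \<rho>. ennreal \<bar>u x\<bar> \<partial>lebesgue)"

definition L1_ul :: "real \<Rightarrow> ('a::euclidean_space \<Rightarrow> real) set" where
  "L1_ul \<rho> = {u \<in> L1_loc. ul_norm \<rho> u < \<infinity>}"

definition BUC :: "('a::euclidean_space \<Rightarrow> real) set" where
  "BUC = {v. bounded (range v) \<and> uniformly_continuous_on UNIV v}"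

text \<open>Closure of \<open>BUC\<close> in \<open>L1_ul\<close>. Elements are functions rather than classes modulo null sets,
  so \<open>ul_norm\<close> is only a seminorm and the closure is spelled out.\<close>

definition L1_ul_closure_BUC :: "real \<Rightarrow> ('a::euclidean_space \<Rightarrow> real) set" where
  "L1_ul_closure_BUC \<rho> =
     {u \<in> L1_ul \<rho>. \<forall>\<epsilon>>0. \<exists>v\<in>BUC. ul_norm \<rho> (\<lambda>x. u x - v x) < ennreal \<epsilon>}"

text \<open>The integral below is real for \<open>t > 0\<close> (its integrand is Hermitian in \<open>\<xi>\<close>), so \<open>Re\<close> only
  adjusts the type.\<close>

definition fund_sol :: "real \<Rightarrow> 'a::euclidean_space \<Rightarrow> real \<Rightarrow> real" where
  "fund_sol \<theta> x t =
     Re ((\<integral>\<xi>. exp (\<i> * complex_of_real (x \<bullet> \<xi>) - complex_of_real (t * norm \<xi> powr \<theta>)) \<partial>lborel)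
         / complex_of_real ((2 * pi) ^ DIM('a)))"

text \<open>For \<open>0 < \<theta> \<le> 2\<close> and \<open>t > 0\<close> the kernel is positive, so \<open>ennreal\<close> truncates nothing.\<close>

definition frac_heat_semigroup ::
    "real \<Rightarrow> real \<Rightarrow> ('a::euclidean_space \<Rightarrow> ennreal) \<Rightarrow> 'a \<Rightarrow> ennreal" where
  "frac_heat_semigroup \<theta> t \<psi> x = (\<integral>\<^sup>+y. ennreal (fund_sol \<theta> (x - y) t) * \<psi> y \<partial>lebesgue)"

text \<open>The equation holds in \<open>[0,\<infinity>]\<close> for every \<open>t\<close> and almost every \<open>x\<close>. Since \<open>u\<close> is real-valued, it
  includes the finiteness of the right-hand side.\<close>

definition integral_solution ::
    "real \<Rightarrow> ('a::euclidean_space \<Rightarrow> real) \<Rightarrow> real \<Rightarrow> ('a \<Rightarrow> real \<Rightarrow> real) \<Rightarrow> bool" where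
  "integral_solution \<theta> \<phi> T u \<longleftrightarrow>
     (\<lambda>(x, t). u x t) \<in> borel_measurable (lebesgue_on (UNIV \<times> {0<..<T})) \<and>
     (\<forall>x. \<forall>t\<in>{0<..<T}. 0 \<le> u x t) \<and>
     (\<forall>t\<in>{0<..<T}. AE x in lebesgue.
        ennreal (u x t) =
          frac_heat_semigroup \<theta> t (\<lambda>y. ennreal (\<phi> y)) x +
          (\<integral>\<^sup>+s\<in>{0<..<t}. frac_heat_semigroup \<theta> (t - s) (\<lambda>y. ennreal (exp (u y s))) x \<partial>lebesgue))"

definition has_local_solution :: "real \<Rightarrow> ('a::euclidean_space \<Rightarrow> real) \<Rightarrow> bool" where
  "has_local_solution \<theta> \<phi> \<longleftrightarrow> (\<exists>T>0. \<exists>u. integral_solution \<theta> \<phi> T u)"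

end

theory Submission
  imports Defs "HOL-Probability.Characteristic_Functions" "HOL-Probability.Sinc_Integral" "HOL-Real_Asymp.Real_Asymp"
begin

text \<open>
  The threshold \<open>N / \<theta>\<close> comes from comparing the smoothing rate \<open>t\<^sup>-\<^sup>N\<^sup>/\<^sup>\<theta>\<close> of the semigroup with
  the size \<open>1 / t\<close> that the ordinary differential equation \<open>u' = e\<^sup>u\<close> tolerates at time \<open>t\<close>: since
  \<open>e\<^sup>u = (e\<^sup>r\<^sup>u)\<^sup>1\<^sup>/\<^sup>r\<close>, a solution with \<open>e\<^sup>r\<^sup>\<phi>\<close> uniformly locally integrable has \<open>e\<^sup>u\<close> of order
  \<open>t\<^sup>-\<^sup>N\<^sup>/\<^sup>(\<^sup>r\<^sup>\<theta>\<^sup>)\<close>.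

  The kernel. What is needed of \<open>G\<close> is positivity, radial monotonicity, mass one and the semigroup law.
  With \<open>\<alpha> = \<theta> / 2 \<le> 1\<close> all Taylor coefficients of \<open>1 - (1 - z)\<^sup>\<alpha>\<close> are nonnegative, so
  \<open>exp (- t |\<xi>|\<^sup>\<theta>)\<close> is a limit of combinations of Gaussians \<open>exp (- s |\<xi>|\<^sup>2)\<close> with
  nonnegative coefficients.  The Fourier transform of a Gaussian is positive and radially decreasing,
  and both properties survive the limit (\<open>unimodal_heat_mult\<close>).  Positivity makes Fourier inversion
  elementary (\<open>fund_sol_fourier\<close>); it gives mass one and the semigroup law.

  Existence.  Let \<open>r = N / \<theta>\<close>.  Because \<open>G\<close> is radially decreasing, it is dominated by its averages
  over balls, whence \<open>S(t) \<psi>\<close> is bounded by \<open>C t\<^sup>-\<^sup>r\<close> times the uniformly local norm of \<open>\<psi>\<close> for \<open>t \<le> 1\<close>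
  (\<open>frac_heat_semigroup_ul_bound\<close>).  In both the supercritical and the critical case
  \<open>e\<^sup>r\<^sup>\<phi>\<close> is at most a constant plus a function of arbitrarily small norm, so \<open>t\<^sup>r sup S(t) e\<^sup>r\<^sup>\<phi>\<close>
  tends to \<open>0\<close>.  Then \<open>V(t) = ln (S(t) e\<^sup>r\<^sup>\<phi>) / r + 1\<close> is a supersolution: its first part dominates
  \<open>S(t) \<phi>\<close> by Jensen's inequality, and the Duhamel integral of \<open>e\<^sup>V\<close> is at most \<open>1\<close> for small
  times (\<open>nonlinear_term_le_1\<close>).  Monotone iteration below \<open>V\<close> yields a solution
  (\<open>solution_from_supersolution\<close>).

  Nonexistence.  Let \<open>u\<close> be a solution and fix \<open>t\<close> and \<open>x\<close>.  By the semigroup law and Jensen's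
  inequality, \<open>W(s) = S(t - s) u(s) (x)\<close> satisfies \<open>W(s) \<ge> A + \<integral>\<^sub>0\<^sup>s e\<^sup>W\<close> with
  \<open>A = S(t) \<phi> (x)\<close>, which forces blow-up before time \<open>t\<close> unless \<open>t e\<^sup>A < 2\<close>
  (\<open>solution_necessary_condition\<close>).  For \<open>\<phi> = a log\<^sup>+ (1 / |x|)\<close> one has \<open>S(t) \<phi> \<approx> (a / \<theta>) log (1 / t)\<close>
  near the origin, which violates this bound as soon as \<open>a > \<theta>\<close>; on the other hand \<open>e\<^sup>r\<^sup>\<phi>\<close> is
  integrable at the origin as long as \<open>a r < N\<close>.  Some \<open>a\<close> meets both demands exactly when \<open>r < N / \<theta>\<close>.
\<close>

section \<open>Gaussian integrals on Euclidean space\<close>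

lemma nn_integral_lborel_affine:
  fixes f :: "'a::euclidean_space \<Rightarrow> ennreal" and c :: real
  assumes [measurable]: "f \<in> borel_measurable borel" and c: "c \<noteq> 0"
  shows "(\<integral>\<^sup>+x. f x \<partial>lborel) = ennreal (\<bar>c\<bar> ^ DIM('a)) * (\<integral>\<^sup>+x. f (t + c *\<^sub>R x) \<partial>lborel)"
proof -
  have "(\<integral>\<^sup>+x. f x \<partial>lborel) = (\<integral>\<^sup>+x. f x \<partial>(density (distr lborel borel (\<lambda>x. t + c *\<^sub>R x)) (\<lambda>_. \<bar>c\<bar>^DIM('a))))"
    using lborel_affine[OF c, of t] by simp
  also have "\<dots> = (\<integral>\<^sup>+x. ennreal (\<bar>c\<bar>^DIM('a)) * f x \<partial>(distr lborel borel (\<lambda>x. t + c *\<^sub>R x)))"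
    by (subst nn_integral_density) auto
  also have "\<dots> = ennreal (\<bar>c\<bar> ^ DIM('a)) * (\<integral>\<^sup>+x. f (t + c *\<^sub>R x) \<partial>lborel)"
    by (subst nn_integral_distr) (auto simp: nn_integral_cmult)
  finally show ?thesis .
qed

lemma integral_lborel_affine:
  fixes f :: "'a::euclidean_space \<Rightarrow> real" and c :: real
  assumes [measurable]: "f \<in> borel_measurable borel" and c: "c \<noteq> 0"
  shows "(\<integral>x. f x \<partial>lborel) = \<bar>c\<bar> ^ DIM('a) * (\<integral>x. f (t + c *\<^sub>R x) \<partial>lborel)"
proof -
  have "(\<integral>x. f x \<partial>lborel) = (\<integral>x. f x \<partial>(density (distr lborel borel (\<lambda>x. t + c *\<^sub>R x)) (\<lambda>_. \<bar>c\<bar>^DIM('a))))"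
    using lborel_affine[OF c, of t] by simp
  also have "\<dots> = (\<integral>x. (\<bar>c\<bar>^DIM('a)) *\<^sub>R f x \<partial>(distr lborel borel (\<lambda>x. t + c *\<^sub>R x)))"
    by (subst integral_density) auto
  also have "\<dots> = \<bar>c\<bar> ^ DIM('a) * (\<integral>x. f (t + c *\<^sub>R x) \<partial>lborel)"
    by (subst integral_distr) auto
  finally show ?thesis .
qed

lemma integral_lborel_odd:
  fixes f :: "'a::euclidean_space \<Rightarrow> real"
  assumes [measurable]: "f \<in> borel_measurable borel" and odd: "\<And>x. f (- x) = - f x"
  shows "(\<integral>x. f x \<partial>lborel) = 0"
  using integral_lborel_affine[of f "-1" 0] by (simp add: odd)

lemma lborel_prod_Basis:
  fixes f :: "'a::euclidean_space \<Rightarrow> real \<Rightarrow> 'b::{real_normed_field,banach,second_countable_topology}"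
  assumes f: "\<And>b. b \<in> Basis \<Longrightarrow> integrable lborel (f b)"
  shows "integrable lborel (\<lambda>x::'a. \<Prod>b\<in>Basis. f b (x \<bullet> b))"
    and "(\<integral>x. (\<Prod>b\<in>Basis. f b (x \<bullet> b)) \<partial>(lborel::'a measure)) = (\<Prod>b\<in>Basis. \<integral>s. f b s \<partial>lborel)"
proof -
  interpret product_sigma_finite "\<lambda>_::'a. lborel :: real measure" ..
  have [measurable]: "f b \<in> borel_measurable borel" if "b \<in> Basis" for b
    using f[OF that] by (auto dest: borel_measurable_integrable)
  have meas[measurable]: "(\<lambda>x::'a. \<Prod>b\<in>Basis. f b (x \<bullet> b)) \<in> borel_measurable borel"
    by (intro borel_measurable_prod) measurable
  have eq: "(\<Prod>b\<in>Basis. f b ((\<Sum>c\<in>Basis. g c *\<^sub>R c) \<bullet> b)) = (\<Prod>b\<in>Basis. f b (g b))" for g :: "'a \<Rightarrow> real"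
    by (intro prod.cong refl) (simp add: inner_sum_left inner_Basis if_distrib cong: if_cong)
  show "integrable lborel (\<lambda>x::'a. \<Prod>b\<in>Basis. f b (x \<bullet> b))"
    by (subst lborel_eq, subst integrable_distr_eq)
       (auto simp: eq intro!: product_integrable_prod f)
  show "(\<integral>x. (\<Prod>b\<in>Basis. f b (x \<bullet> b)) \<partial>(lborel::'a measure)) = (\<Prod>b\<in>Basis. \<integral>s. f b s \<partial>lborel)"
    by (subst lborel_eq, subst integral_distr)
       (auto simp: eq intro!: product_integral_prod f)
qed

lemma gaussian_fourier_1d:
  fixes a \<eta> :: real
  assumes \<eta>: "0 < \<eta>"
  shows "integrable lborel (\<lambda>s. iexp (a * s) * complex_of_real (exp (- \<eta> * s\<^sup>2)))"
    and "(\<integral>s. iexp (a * s) * complex_of_real (exp (- \<eta> * s\<^sup>2)) \<partial>lborel)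
      = complex_of_real (sqrt (pi / \<eta>) * exp (- a\<^sup>2 / (4 * \<eta>)))"
proof -
  \<comment> \<open>The substitution \<open>s \<mapsto> k s\<close> turns the standard normal density into the given Gaussian.\<close>
  define k where "k = sqrt (2 * \<eta>)"
  have k: "k > 0" "k\<^sup>2 = 2 * \<eta>" using \<eta> by (auto simp: k_def)
  let ?h = "\<lambda>s. iexp (a / k * s) * complex_of_real (exp (- (s\<^sup>2) / 2))"
  have int: "integrable lborel (\<lambda>s. complex_of_real (std_normal_density s) * iexp (a/k * s))"
    by (rule Bochner_Integration.integrable_bound[of _ "std_normal_density"])
       (auto simp: integrable_normal_density norm_mult)
  have eq: "(\<integral>s. complex_of_real (std_normal_density s) * iexp (a/k * s) \<partial>lborel)
      = complex_of_real (exp (- ((a/k)\<^sup>2) / 2))"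
    using fun_cong[OF char_std_normal_distribution, of "a/k"]
    unfolding char_def
    by (subst (asm) integral_density) (auto simp: scaleR_conv_of_real)
  have h: "?h s = complex_of_real (sqrt (2 * pi)) * (complex_of_real (std_normal_density s) * iexp (a/k * s))" for s
    by (simp add: std_normal_density_def)
  have inth: "integrable lborel ?h" unfolding h by (intro integrable_mult_right int)
  have eqh: "integral\<^sup>L lborel ?h = complex_of_real (sqrt (2 * pi) * exp (- ((a/k)\<^sup>2) / 2))"
    unfolding h by (simp only: integral_mult_right_zero eq) simp
  have sc: "?h (0 + k * s) = iexp (a * s) * complex_of_real (exp (- \<eta> * s\<^sup>2))" for s
    using k by (simp add: power_mult_distrib)
  show "integrable lborel (\<lambda>s. iexp (a * s) * complex_of_real (exp (- \<eta> * s\<^sup>2)))"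
    using lborel_integrable_real_affine[OF inth, of k 0] k unfolding sc by simp
  have "integral\<^sup>L lborel ?h = k *\<^sub>R (\<integral>s. iexp (a * s) * complex_of_real (exp (- \<eta> * s\<^sup>2)) \<partial>lborel)"
    using lborel_integral_real_affine[of k ?h 0] k unfolding sc by simp
  hence "(\<integral>s. iexp (a * s) * complex_of_real (exp (- \<eta> * s\<^sup>2)) \<partial>lborel)
      = complex_of_real (sqrt (2 * pi) * exp (- ((a/k)\<^sup>2) / 2) / k)"
    using k unfolding eqh by (simp add: scaleR_conv_of_real field_simps)
  also have "sqrt (2 * pi) * exp (- ((a/k)\<^sup>2) / 2) / k = sqrt (pi / \<eta>) * exp (- a\<^sup>2 / (4 * \<eta>))"
    using k \<eta> by (simp add: power_divide k_def real_sqrt_divide real_sqrt_mult)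
  finally show "(\<integral>s. iexp (a * s) * complex_of_real (exp (- \<eta> * s\<^sup>2)) \<partial>lborel)
      = complex_of_real (sqrt (pi / \<eta>) * exp (- a\<^sup>2 / (4 * \<eta>)))" .
qed

lemma norm_sq_eq_sum_Basis: "(norm (x::'a::euclidean_space))\<^sup>2 = (\<Sum>b\<in>Basis. (x \<bullet> b)\<^sup>2)"
  unfolding power2_norm_eq_inner by (subst euclidean_inner) (simp add: power2_eq_square)

text \<open>Both the Gaussian and the character factor over the coordinates, so this is a product of
  one-dimensional transforms.\<close>

lemma gaussian_fourier:
  fixes x :: "'a::euclidean_space" and \<eta> :: real
  assumes \<eta>: "0 < \<eta>"
  shows "integrable lborel (\<lambda>\<xi>::'a. exp (- \<eta> * (norm \<xi>)\<^sup>2))"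
    and "(\<integral>\<xi>. cos (x \<bullet> \<xi>) * exp (- \<eta> * (norm \<xi>)\<^sup>2) \<partial>lborel)
      = sqrt (pi / \<eta>) ^ DIM('a) * exp (- (norm x)\<^sup>2 / (4 * \<eta>))"
proof -
  have eq: "(\<Prod>b\<in>Basis. iexp ((x \<bullet> b) * (\<xi> \<bullet> b)) * complex_of_real (exp (- \<eta> * (\<xi> \<bullet> b)\<^sup>2)))
     = iexp (x \<bullet> \<xi>) * complex_of_real (exp (- \<eta> * (norm \<xi>)\<^sup>2))" for x \<xi> :: 'a
    unfolding norm_sq_eq_sum_Basis euclidean_inner[of x \<xi>] prod.distrib of_real_prod[symmetric]
    by (simp add: exp_sum[symmetric] sum_distrib_left sum_negf)
  have int: "integrable lborel (\<lambda>\<xi>::'a. iexp (x \<bullet> \<xi>) * complex_of_real (exp (- \<eta> * (norm \<xi>)\<^sup>2)))" for x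
    using lborel_prod_Basis(1)[of "\<lambda>b s. iexp ((x \<bullet> b) * s) * complex_of_real (exp (- \<eta> * s\<^sup>2))"]
      gaussian_fourier_1d(1)[OF \<eta>] unfolding eq by blast
  have val: "(\<integral>\<xi>. iexp (x \<bullet> \<xi>) * complex_of_real (exp (- \<eta> * (norm \<xi>)\<^sup>2)) \<partial>lborel)
     = complex_of_real (\<Prod>b\<in>Basis. sqrt (pi / \<eta>) * exp (- (x \<bullet> b)\<^sup>2 / (4 * \<eta>)))"
    using lborel_prod_Basis(2)[of "\<lambda>b s. iexp ((x \<bullet> b) * s) * complex_of_real (exp (- \<eta> * s\<^sup>2))"]
      gaussian_fourier_1d[OF \<eta>] unfolding eq by simp
  show "integrable lborel (\<lambda>\<xi>::'a. exp (- \<eta> * (norm \<xi>)\<^sup>2))"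
    using integrable_norm[OF int[of 0]] by simp
  have "(\<integral>\<xi>. cos (x \<bullet> \<xi>) * exp (- \<eta> * (norm \<xi>)\<^sup>2) \<partial>lborel)
      = Re (\<integral>\<xi>. iexp (x \<bullet> \<xi>) * complex_of_real (exp (- \<eta> * (norm \<xi>)\<^sup>2)) \<partial>lborel)"
    by (subst integral_Re[OF int, symmetric]) (simp add: Re_exp)
  also have "\<dots> = (\<Prod>b\<in>Basis. sqrt (pi / \<eta>) * exp (- (x \<bullet> b)\<^sup>2 / (4 * \<eta>)))"
    by (simp only: val Re_complex_of_real)
  also have "\<dots> = sqrt (pi / \<eta>) ^ DIM('a) * exp (- (norm x)\<^sup>2 / (4 * \<eta>))"
    unfolding norm_sq_eq_sum_Basis by (simp add: prod.distrib exp_sum[symmetric] sum_negf sum_divide_distrib)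
  finally show "(\<integral>\<xi>. cos (x \<bullet> \<xi>) * exp (- \<eta> * (norm \<xi>)\<^sup>2) \<partial>lborel)
      = sqrt (pi / \<eta>) ^ DIM('a) * exp (- (norm x)\<^sup>2 / (4 * \<eta>))" .
qed

section \<open>Multipliers with unimodal Fourier transform\<close>

lemma integrable_inverse_1_plus_square: "integrable lborel (\<lambda>x::real. inverse (1 + x\<^sup>2))"
  using Sinc_Integral.integrable_inverse_1_plus_square unfolding set_integrable_def by (simp add: einterval_def)

definition heat_mult :: "real \<Rightarrow> real \<Rightarrow> 'a::euclidean_space \<Rightarrow> real" where
  "heat_mult \<theta> t \<xi> = exp (- (t * norm \<xi> powr \<theta>))"

lemma heat_mult_measurable[measurable]: "heat_mult \<theta> t \<in> borel_measurable borel"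
  unfolding heat_mult_def by measurable

text \<open>The multiplier decays faster than every power of \<open>|\<xi>|\<close>; the product
  \<open>\<Prod>\<^sub>b (1 + \<xi>\<^sub>b\<^sup>2)\<^sup>-\<^sup>1\<close> is an integrable majorant whose integral factors, which avoids polar
  coordinates.\<close>

lemma integrable_heat_mult:
  assumes t: "0 < t" and \<theta>: "0 < \<theta>"
  shows "integrable lborel (heat_mult \<theta> t :: 'a::euclidean_space \<Rightarrow> real)"
proof -
  let ?N = "DIM('a)"
  \<comment> \<open>The \<open>m\<close>-th term of the series of \<open>exp (t |\<xi>|\<^sup>\<theta>)\<close> alone grows faster than \<open>|\<xi>|\<^sup>2\<^sup>N\<close>.\<close>
  obtain m :: nat where m: "real m > 2 * ?N / \<theta>" using reals_Archimedean2 by blast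
  define C where "C = 2 ^ ?N * max 1 (fact m / t ^ m)"
  have "integrable lborel (\<lambda>\<xi>::'a. C * (\<Prod>b\<in>Basis. inverse (1 + (\<xi> \<bullet> b)\<^sup>2)))"
    by (intro integrable_mult_right lborel_prod_Basis(1) integrable_inverse_1_plus_square)
  moreover have "norm (heat_mult \<theta> t \<xi>) \<le> norm (C * (\<Prod>b\<in>Basis. inverse (1 + (\<xi> \<bullet> b)\<^sup>2)))" for \<xi> :: 'a
  proof -
    let ?s = "norm \<xi>"
    have pos: "(\<Prod>b\<in>Basis. 1 + (\<xi> \<bullet> b)\<^sup>2) > 0" by (intro prod_pos) (auto intro: add_pos_nonneg)
    have "(\<Prod>b\<in>(Basis::'a set). 1 + (\<xi> \<bullet> b)\<^sup>2) \<le> (\<Prod>b\<in>(Basis::'a set). 1 + ?s\<^sup>2)"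
    proof (intro prod_mono conjI)
      fix b :: 'a assume "b \<in> Basis"
      then have "\<bar>\<xi> \<bullet> b\<bar> \<le> ?s" by (rule Basis_le_norm)
      then show "1 + (\<xi> \<bullet> b)\<^sup>2 \<le> 1 + ?s\<^sup>2" using abs_le_square_iff[of "\<xi> \<bullet> b" ?s] by simp
    qed simp
    then have p1: "(\<Prod>b\<in>(Basis::'a set). 1 + (\<xi> \<bullet> b)\<^sup>2) \<le> (1 + ?s\<^sup>2) ^ ?N" by simp
    have "heat_mult \<theta> t \<xi> * (1 + ?s\<^sup>2) ^ ?N \<le> C"
    proof (cases "?s \<le> 1")
      case True
      have "heat_mult \<theta> t \<xi> * (1 + ?s\<^sup>2) ^ ?N \<le> 1 * 2 ^ ?N"
        using t True by (intro mult_mono power_mono) (auto simp: heat_mult_def abs_square_le_1)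
      also have "\<dots> \<le> C" unfolding C_def by simp
      finally show ?thesis .
    next
      case False
      then have s: "?s > 1" by simp
      then have \<xi>0: "\<xi> \<noteq> 0" by auto
      define y where "y = t * ?s powr \<theta>"
      have y: "y > 0" unfolding y_def using t s by (intro mult_pos_pos) auto
      have "(\<lambda>n. y ^ n /\<^sub>R fact n) sums exp y" by (rule exp_converges)
      then have "(\<Sum>n\<in>{m}. y ^ n /\<^sub>R fact n) \<le> exp y"
        using y by (subst sums_unique[of _ "exp y"]) (auto intro!: sum_le_suminf simp: sums_iff simp del: sum.insert)
      then have "y ^ m / fact m \<le> exp y" by (simp add: field_simps)
      then have e1: "exp (- y) \<le> fact m / y ^ m"
        using y by (simp add: exp_minus field_simps)
      have "y ^ m = t ^ m * ?s powr (\<theta> * m)"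
        unfolding y_def power_mult_distrib using powr_realpow[of "?s powr \<theta>" m] \<xi>0 by (simp add: powr_powr)
      also have "\<dots> \<ge> t ^ m * ?s powr (2 * ?N)"
        using t s m \<theta> by (intro mult_left_mono powr_mono) (auto simp: field_simps)
      also have "?s powr (2 * ?N) = (?s\<^sup>2) ^ ?N"
        using \<xi>0 powr_realpow[of ?s "2 * ?N"] by (simp add: power_mult)
      finally have e2: "t ^ m * (?s\<^sup>2) ^ ?N \<le> y ^ m" .
      have "(1 + ?s\<^sup>2) ^ ?N \<le> (2 * ?s\<^sup>2) ^ ?N"
        using s by (intro power_mono) (auto simp: one_le_power)
      then have e3: "(1 + ?s\<^sup>2) ^ ?N \<le> 2 ^ ?N * (?s\<^sup>2) ^ ?N" by (simp add: power_mult_distrib)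
      define A where "A = (?s\<^sup>2) ^ ?N"
      have A: "A > 0" unfolding A_def using \<xi>0 by simp
      have tA: "t ^ m * A > 0" using t A by simp
      have "heat_mult \<theta> t \<xi> * (1 + ?s\<^sup>2) ^ ?N \<le> (fact m / y ^ m) * (2 ^ ?N * A)"
        unfolding heat_mult_def y_def[symmetric] using e1 e3 y by (intro mult_mono) (auto simp: A_def)
      also have "\<dots> \<le> (fact m / (t ^ m * A)) * (2 ^ ?N * A)"
        using e2 tA A y t unfolding A_def[symmetric] by (intro mult_right_mono divide_left_mono mult_pos_pos) auto
      also have "\<dots> = 2 ^ ?N * (fact m / t ^ m)" using t A by (simp add: field_simps)
      also have "\<dots> \<le> C" unfolding C_def by (intro mult_left_mono) auto
      finally show ?thesis .
    qed
    moreover have "heat_mult \<theta> t \<xi> * (\<Prod>b\<in>(Basis::'a set). 1 + (\<xi> \<bullet> b)\<^sup>2) \<le> heat_mult \<theta> t \<xi> * (1 + ?s\<^sup>2) ^ ?N"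
      by (rule mult_left_mono[OF p1]) (simp add: heat_mult_def)
    ultimately have "heat_mult \<theta> t \<xi> \<le> C / (\<Prod>b\<in>(Basis::'a set). 1 + (\<xi> \<bullet> b)\<^sup>2)"
      using pos by (simp add: pos_le_divide_eq)
    also have "\<dots> = C * (\<Prod>b\<in>Basis. inverse (1 + (\<xi> \<bullet> b)\<^sup>2))"
      unfolding divide_inverse using prod_inversef[of "\<lambda>b. 1 + (\<xi> \<bullet> b)\<^sup>2" "Basis::'a set"] by (simp add: o_def)
    finally show ?thesis by (simp add: heat_mult_def)
  qed
  ultimately show ?thesis
    by (intro Bochner_Integration.integrable_bound[where f="\<lambda>\<xi>::'a. C * (\<Prod>b\<in>Basis. inverse (1 + (\<xi> \<bullet> b)\<^sup>2))" and g="heat_mult \<theta> t" and M=lborel] AE_I2) simp_all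
qed

definition gauss_cos_transform :: "real \<Rightarrow> ('a::euclidean_space \<Rightarrow> real) \<Rightarrow> 'a \<Rightarrow> real" where
  "gauss_cos_transform \<eta> f x = (\<integral>\<xi>. cos (x \<bullet> \<xi>) * (f \<xi> * exp (- \<eta> * (norm \<xi>)\<^sup>2)) \<partial>lborel)"

text \<open>The condition is imposed on \<open>f\<close> damped by every Gaussian.  The damping makes all integrals converge
  without decay of \<open>f\<close>, and it makes multiplication by \<open>exp (- s |\<xi>|\<^sup>2)\<close> a mere shift of \<open>\<eta>\<close>, so that
  the class is closed under such multiplications.\<close>

definition unimodal_multiplier :: "('a::euclidean_space \<Rightarrow> real) \<Rightarrow> bool" where
  "unimodal_multiplier f \<longleftrightarrow> f \<in> borel_measurable borel \<and> (\<exists>B. \<forall>\<xi>. \<bar>f \<xi>\<bar> \<le> B) \<and>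
     (\<forall>\<eta>>0. \<forall>x y. norm x \<le> norm y \<longrightarrow>
        0 \<le> gauss_cos_transform \<eta> f y \<and> gauss_cos_transform \<eta> f y \<le> gauss_cos_transform \<eta> f x)"

lemma unimodal_multiplierI:
  assumes "f \<in> borel_measurable borel" "\<And>\<xi>. \<bar>f \<xi>\<bar> \<le> B"
    and "\<And>\<eta> x. 0 < \<eta> \<Longrightarrow> 0 \<le> gauss_cos_transform \<eta> f x"
    and "\<And>\<eta> x y. 0 < \<eta> \<Longrightarrow> norm x \<le> norm y \<Longrightarrow> gauss_cos_transform \<eta> f y \<le> gauss_cos_transform \<eta> f x"
  shows "unimodal_multiplier f"
  using assms unfolding unimodal_multiplier_def by blast

lemma unimodal_multiplierD:
  assumes "unimodal_multiplier f" "0 < \<eta>"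
  shows "0 \<le> gauss_cos_transform \<eta> f x"
    and "norm x \<le> norm y \<Longrightarrow> gauss_cos_transform \<eta> f y \<le> gauss_cos_transform \<eta> f x"
  using assms unfolding unimodal_multiplier_def by blast+

lemma integrable_gauss_cos:
  fixes f :: "'a::euclidean_space \<Rightarrow> real"
  assumes [measurable]: "f \<in> borel_measurable borel" and B: "AE \<xi> in lborel. \<bar>f \<xi>\<bar> \<le> B" and \<eta>: "\<eta> > 0"
  shows "integrable lborel (\<lambda>\<xi>. cos (x \<bullet> \<xi>) * (f \<xi> * exp (- \<eta> * (norm \<xi>)\<^sup>2)))"
proof (rule Bochner_Integration.integrable_bound)
  show "integrable lborel (\<lambda>\<xi>::'a. B * exp (- \<eta> * (norm \<xi>)\<^sup>2))"
    by (intro integrable_mult_right gaussian_fourier(1) \<eta>)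
  show "AE \<xi> in lborel. norm (cos (x \<bullet> \<xi>) * (f \<xi> * exp (- \<eta> * (norm \<xi>)\<^sup>2))) \<le> norm (B * exp (- \<eta> * (norm \<xi>)\<^sup>2))"
    using B
  proof eventually_elim
    case (elim \<xi>)
    have "\<bar>cos (x \<bullet> \<xi>)\<bar> * (\<bar>f \<xi>\<bar> * exp (- \<eta> * (norm \<xi>)\<^sup>2)) \<le> 1 * (\<bar>B\<bar> * exp (- \<eta> * (norm \<xi>)\<^sup>2))"
      using elim by (intro mult_mono) auto
    then show ?case by (simp add: abs_mult)
  qed
qed measurable

lemma unimodal_gauss:
  assumes s: "0 \<le> s"
  shows "unimodal_multiplier (\<lambda>\<xi>::'a::euclidean_space. exp (- s * (norm \<xi>)\<^sup>2))"
proof -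
  have "gauss_cos_transform \<eta> (\<lambda>\<xi>::'a. exp (- s * (norm \<xi>)\<^sup>2)) x
      = sqrt (pi / (s + \<eta>)) ^ DIM('a) * exp (- (norm x)\<^sup>2 / (4 * (s + \<eta>)))" if "\<eta> > 0" for \<eta> and x :: 'a
    using gaussian_fourier(2)[of "s + \<eta>" x] s that
    unfolding gauss_cos_transform_def by (simp add: exp_add[symmetric] algebra_simps)
  then show ?thesis using s
    by (intro unimodal_multiplierI[where B=1])
       (auto intro!: mult_left_mono divide_right_mono power_mono)
qed

lemma unimodal_mult_gauss:
  assumes f: "unimodal_multiplier f" and s: "0 \<le> s"
  shows "unimodal_multiplier (\<lambda>\<xi>::'a::euclidean_space. exp (- s * (norm \<xi>)\<^sup>2) * f \<xi>)"
proof -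
  have [measurable]: "f \<in> borel_measurable borel" using f by (simp add: unimodal_multiplier_def)
  obtain B where B: "\<And>\<xi>. \<bar>f \<xi>\<bar> \<le> B" using f by (auto simp: unimodal_multiplier_def)
  have "\<bar>exp (- s * (norm \<xi>)\<^sup>2) * f \<xi>\<bar> \<le> B" for \<xi>
    using mult_mono[of "exp (- s * (norm \<xi>)\<^sup>2)" 1 "\<bar>f \<xi>\<bar>" B] B[of \<xi>] s by (auto simp: abs_mult)
  moreover have "gauss_cos_transform \<eta> (\<lambda>\<xi>::'a. exp (- s * (norm \<xi>)\<^sup>2) * f \<xi>) x
      = gauss_cos_transform (s + \<eta>) f x" for \<eta> x
  proof -
    have "exp (- (s + \<eta>) * (norm \<xi>)\<^sup>2) = exp (- s * (norm \<xi>)\<^sup>2) * exp (- \<eta> * (norm \<xi>)\<^sup>2)" for \<xi> :: 'a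
      by (simp add: exp_add[symmetric] algebra_simps)
    then show ?thesis
      unfolding gauss_cos_transform_def by (simp only: mult_ac)
  qed
  ultimately show ?thesis using s
    by (intro unimodal_multiplierI[where B=B]) (simp_all add: unimodal_multiplierD[OF f] del: mult_minus_left)
qed

lemma unimodal_add:
  assumes f: "unimodal_multiplier f" and g: "unimodal_multiplier g"
  shows "unimodal_multiplier (\<lambda>\<xi>::'a::euclidean_space. f \<xi> + g \<xi>)"
proof -
  have [measurable]: "f \<in> borel_measurable borel" "g \<in> borel_measurable borel"
    using f g by (simp_all add: unimodal_multiplier_def)
  obtain B where B: "\<And>\<xi>. \<bar>f \<xi>\<bar> \<le> B" using f by (auto simp: unimodal_multiplier_def)
  obtain C where C: "\<And>\<xi>. \<bar>g \<xi>\<bar> \<le> C" using g by (auto simp: unimodal_multiplier_def)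
  have "\<bar>f \<xi> + g \<xi>\<bar> \<le> B + C" for \<xi> using B[of \<xi>] C[of \<xi>] by linarith
  moreover have "gauss_cos_transform \<eta> (\<lambda>\<xi>. f \<xi> + g \<xi>) x
      = gauss_cos_transform \<eta> f x + gauss_cos_transform \<eta> g x" if "\<eta> > 0" for \<eta> x
    unfolding gauss_cos_transform_def distrib_right distrib_left
    using B C that by (intro Bochner_Integration.integral_add integrable_gauss_cos) auto
  ultimately show ?thesis
    by (intro unimodal_multiplierI[where B="B + C"])
       (simp_all add: unimodal_multiplierD[OF f] unimodal_multiplierD[OF g] add_mono)
qed

lemma unimodal_scale:
  assumes f: "unimodal_multiplier f" and c: "0 \<le> c"
  shows "unimodal_multiplier (\<lambda>\<xi>::'a::euclidean_space. c * f \<xi>)"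
proof -
  have [measurable]: "f \<in> borel_measurable borel" using f by (simp add: unimodal_multiplier_def)
  obtain B where B: "\<And>\<xi>. \<bar>f \<xi>\<bar> \<le> B" using f by (auto simp: unimodal_multiplier_def)
  have "\<bar>c * f \<xi>\<bar> \<le> c * B" for \<xi> using B[of \<xi>] c by (simp add: abs_mult mult_left_mono)
  moreover have "gauss_cos_transform \<eta> (\<lambda>\<xi>. c * f \<xi>) x = c * gauss_cos_transform \<eta> f x" for \<eta> x
    unfolding gauss_cos_transform_def by (subst integral_mult_right_zero[symmetric]) (simp add: ac_simps)
  ultimately show ?thesis using c
    by (intro unimodal_multiplierI[where B="c * B"]) (simp_all add: unimodal_multiplierD[OF f] mult_left_mono)
qed

lemma unimodal_sum:
  assumes "finite I" "\<And>i. i \<in> I \<Longrightarrow> unimodal_multiplier (f i)"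
  shows "unimodal_multiplier (\<lambda>\<xi>::'a::euclidean_space. \<Sum>i\<in>I. f i \<xi>)"
  using assms
proof (induction rule: finite_induct)
  case empty
  show ?case using unimodal_scale[OF unimodal_gauss[of 0], of 0] by simp
qed (auto intro: unimodal_add)

lemma unimodal_limit:
  fixes f :: "nat \<Rightarrow> 'a::euclidean_space \<Rightarrow> real"
  assumes f: "\<And>n. unimodal_multiplier (f n)"
    and B: "\<And>n. AE \<xi> in lborel. \<bar>f n \<xi>\<bar> \<le> B"
    and lim: "AE \<xi> in lborel. (\<lambda>n. f n \<xi>) \<longlonglongrightarrow> g \<xi>"
    and [measurable]: "g \<in> borel_measurable borel" and C: "\<And>\<xi>. \<bar>g \<xi>\<bar> \<le> C"
  shows "unimodal_multiplier g"
proof -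
  have [measurable]: "f n \<in> borel_measurable borel" for n using f by (simp add: unimodal_multiplier_def)
  have L: "(\<lambda>n. gauss_cos_transform \<eta> (f n) x) \<longlonglongrightarrow> gauss_cos_transform \<eta> g x" if \<eta>: "\<eta> > 0" for \<eta> x
    unfolding gauss_cos_transform_def
  proof (rule integral_dominated_convergence)
    show "integrable lborel (\<lambda>\<xi>::'a. \<bar>B\<bar> * exp (- \<eta> * (norm \<xi>)\<^sup>2))"
      by (intro integrable_mult_right gaussian_fourier(1) \<eta>)
    show "AE \<xi> in lborel. (\<lambda>n. cos (x \<bullet> \<xi>) * (f n \<xi> * exp (- \<eta> * (norm \<xi>)\<^sup>2)))
        \<longlonglongrightarrow> cos (x \<bullet> \<xi>) * (g \<xi> * exp (- \<eta> * (norm \<xi>)\<^sup>2))"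
      using lim by eventually_elim (intro tendsto_intros)
    fix n
    show "AE \<xi> in lborel. norm (cos (x \<bullet> \<xi>) * (f n \<xi> * exp (- \<eta> * (norm \<xi>)\<^sup>2))) \<le> \<bar>B\<bar> * exp (- \<eta> * (norm \<xi>)\<^sup>2)"
      using B[of n]
    proof eventually_elim
      case (elim \<xi>)
      have "\<bar>cos (x \<bullet> \<xi>)\<bar> * (\<bar>f n \<xi>\<bar> * exp (- \<eta> * (norm \<xi>)\<^sup>2)) \<le> 1 * (\<bar>B\<bar> * exp (- \<eta> * (norm \<xi>)\<^sup>2))"
        using elim by (intro mult_mono) auto
      then show ?case by (simp add: abs_mult)
    qed
  qed measurable
  show ?thesis
  proof (rule unimodal_multiplierI)
    fix \<eta> :: real and x y :: 'a assume \<eta>: "0 < \<eta>"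
    show "0 \<le> gauss_cos_transform \<eta> g x"
      using LIMSEQ_le_const[OF L[OF \<eta>]] unimodal_multiplierD(1)[OF f \<eta>] by blast
    assume "norm x \<le> norm y"
    then show "gauss_cos_transform \<eta> g y \<le> gauss_cos_transform \<eta> g x"
      using LIMSEQ_le[OF L[OF \<eta>] L[OF \<eta>]] unimodal_multiplierD(2)[OF f \<eta>] by blast
  qed (use C in auto)
qed

text \<open>The powers \<open>q\<^sup>k\<close>, obtained by applying the hypothesis repeatedly to the constant \<open>1\<close>, enter the
  exponential series with positive coefficients.\<close>

lemma unimodal_exp:
  fixes q :: "'a::euclidean_space \<Rightarrow> real"
  assumes q: "\<And>f. unimodal_multiplier f \<Longrightarrow> unimodal_multiplier (\<lambda>\<xi>. q \<xi> * f \<xi>)"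
    and C: "\<And>\<xi>. \<bar>q \<xi>\<bar> \<le> C"
  shows "unimodal_multiplier (\<lambda>\<xi>. exp (q \<xi>))"
proof -
  have one: "unimodal_multiplier (\<lambda>_::'a. 1)" using unimodal_gauss[of 0] by simp
  have [measurable]: "q \<in> borel_measurable borel" using q[OF one] by (simp add: unimodal_multiplier_def)
  have pw: "unimodal_multiplier (\<lambda>\<xi>. q \<xi> ^ k)" for k
    by (induction k) (auto intro: one q)
  have "unimodal_multiplier (\<lambda>\<xi>. \<Sum>k<n. inverse (fact k) * q \<xi> ^ k)" for n
    by (intro unimodal_sum unimodal_scale pw) auto
  then show ?thesis
  proof (rule unimodal_limit)
    have sums: "(\<lambda>k. inverse (fact k) * q \<xi> ^ k) sums exp (q \<xi>)" for \<xi>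
      using exp_converges[of "q \<xi>"] by simp
    then show "AE \<xi> in lborel. (\<lambda>n. \<Sum>k<n. inverse (fact k) * q \<xi> ^ k) \<longlonglongrightarrow> exp (q \<xi>)"
      by (simp add: sums_def)
    fix n
    show "AE \<xi> in lborel. \<bar>\<Sum>k<n. inverse (fact k) * q \<xi> ^ k\<bar> \<le> exp C"
    proof (rule AE_I2)
      fix \<xi>
      have "\<bar>\<Sum>k<n. inverse (fact k) * q \<xi> ^ k\<bar> \<le> (\<Sum>k<n. inverse (fact k) * \<bar>q \<xi>\<bar> ^ k)"
        by (intro order_trans[OF sum_abs] sum_mono) (simp add: abs_mult power_abs)
      also have "\<dots> \<le> exp \<bar>q \<xi>\<bar>"
        using exp_converges[of "\<bar>q \<xi>\<bar>"] by (intro sum_le_suminf[THEN order_trans]) (auto simp: sums_iff)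
      also have "\<dots> \<le> exp C" using C by simp
      finally show "\<bar>\<Sum>k<n. inverse (fact k) * q \<xi> ^ k\<bar> \<le> exp C" .
    qed
  next
    fix \<xi> show "\<bar>exp (q \<xi>)\<bar> \<le> exp C" using C[of \<xi>] by (simp add: abs_le_iff)
  qed measurable
qed

text \<open>Each step of the recursion contributes the factor \<open>(\<alpha> - n) / (n + 1)\<close>, which is nonpositive for
  \<open>n \<ge> 1\<close>; hence the coefficients of \<open>(1 - z)\<^sup>\<alpha>\<close> after the constant one are all nonpositive.\<close>

lemma gchoose_sign:
  assumes "0 \<le> \<alpha>" "\<alpha> \<le> (1::real)"
  shows "(\<alpha> gchoose (Suc n)) * (- 1) ^ Suc n \<le> 0"
proof (induction n)
  case (Suc n)
  have step: "(\<alpha> gchoose Suc (Suc n)) = (\<alpha> gchoose Suc n) * ((\<alpha> - real (Suc n)) / real (Suc (Suc n)))"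
    by (simp add: gbinomial_prod_rev atLeast0_lessThan_Suc field_simps)
  have "(\<alpha> gchoose Suc (Suc n)) * (- 1) ^ Suc (Suc n) =
     ((\<alpha> gchoose Suc n) * (- 1) ^ Suc n) * ((real (Suc n) - \<alpha>) / real (Suc (Suc n)))"
    unfolding step power_Suc[of _ "Suc n"] minus_diff_eq[of \<alpha>, symmetric] minus_divide_left[symmetric] by simp
  also have "\<dots> \<le> 0"
    by (rule mult_nonpos_nonneg[OF Suc]) (use assms in auto)
  finally show ?case .
qed (use assms in simp)

text \<open>By the sign of the binomial coefficients, \<open>1 - (1 - z)\<^sup>\<alpha>\<close> is a power series in \<open>z = exp (- h |\<xi>|\<^sup>2)\<close>
  with nonnegative coefficients, and powers of \<open>z\<close> are again Gaussians.\<close>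

lemma unimodal_mult_binomial:
  fixes f :: "'a::euclidean_space \<Rightarrow> real"
  assumes f: "unimodal_multiplier f" and \<alpha>: "0 \<le> \<alpha>" "\<alpha> \<le> 1" and h: "0 < h"
  shows "unimodal_multiplier (\<lambda>\<xi>. (1 - (1 - exp (- h * (norm \<xi>)\<^sup>2)) powr \<alpha>) * f \<xi>)"
proof -
  define a where "a n = - ((\<alpha> gchoose (Suc n)) * (- 1) ^ Suc n)" for n
  define z where "z \<xi> = exp (- h * (norm \<xi>)\<^sup>2)" for \<xi> :: 'a
  have a0: "a n \<ge> 0" for n unfolding a_def using gchoose_sign[OF \<alpha>, of n] by simp
  have z: "0 \<le> z \<xi>" "z \<xi> \<le> 1" for \<xi> using h by (auto simp: z_def)
  have [measurable]: "z \<in> borel_measurable borel" unfolding z_def by measurable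
  have [measurable]: "f \<in> borel_measurable borel" using f by (simp add: unimodal_multiplier_def)
  obtain B where B: "\<And>\<xi>. \<bar>f \<xi>\<bar> \<le> B" using f by (auto simp: unimodal_multiplier_def)
  have B0: "B \<ge> 0" using B[of 0] by linarith
  have pz: "z \<xi> ^ k = exp (- (h * real k) * (norm \<xi>)\<^sup>2)" for k \<xi>
    unfolding z_def by (simp add: exp_of_nat_mult[symmetric] mult_ac)
  have sums: "(\<lambda>n. a n * z \<xi> ^ Suc n) sums (1 - (1 - z \<xi>) powr \<alpha>)" if "\<xi> \<noteq> 0" for \<xi>
  proof -
    have "z \<xi> < 1" using that h by (simp add: z_def)
    then have "(\<lambda>n. (\<alpha> gchoose n) * (- z \<xi>) ^ n) sums (1 - z \<xi>) powr \<alpha>"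
      using gen_binomial_real[of "- z \<xi>" \<alpha>] z[of \<xi>] by simp
    then have "(\<lambda>n. (\<alpha> gchoose Suc n) * (- z \<xi>) ^ Suc n) sums ((1 - z \<xi>) powr \<alpha> - 1)"
      by (subst sums_Suc_iff) simp
    then have "(\<lambda>n. - ((\<alpha> gchoose Suc n) * (- z \<xi>) ^ Suc n)) sums (- ((1 - z \<xi>) powr \<alpha> - 1))"
      by (rule sums_minus)
    moreover have "- ((\<alpha> gchoose Suc n) * (- z \<xi>) ^ Suc n) = a n * z \<xi> ^ Suc n" for n
      unfolding a_def by (simp add: power_minus[of "z \<xi>"])
    ultimately have "(\<lambda>n. a n * z \<xi> ^ Suc n) sums (- ((1 - z \<xi>) powr \<alpha> - 1))" by (simp only:)
    then show ?thesis by (simp only: minus_diff_eq)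
  qed
  have uni: "unimodal_multiplier (\<lambda>\<xi>. \<Sum>k<n. a k * (z \<xi> ^ Suc k * f \<xi>))" for n
    unfolding pz by (intro unimodal_sum unimodal_scale unimodal_mult_gauss f a0) (use h in auto)
  have "unimodal_multiplier (\<lambda>\<xi>. (1 - (1 - z \<xi>) powr \<alpha>) * f \<xi>)"
    using uni
  proof (rule unimodal_limit)
    \<comment> \<open>At \<open>\<xi> = 0\<close> the series is evaluated on the circle of convergence.\<close>
    have ne: "AE \<xi> in lborel. (\<xi>::'a) \<noteq> 0" by (rule AE_lborel_singleton)
    have eq: "(\<Sum>k<n. a k * (z \<xi> ^ Suc k * f \<xi>)) = (\<Sum>k<n. a k * z \<xi> ^ Suc k) * f \<xi>" for n \<xi>
      by (simp only: sum_distrib_right mult.assoc)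
    show "AE \<xi> in lborel. (\<lambda>n. \<Sum>k<n. a k * (z \<xi> ^ Suc k * f \<xi>)) \<longlonglongrightarrow> (1 - (1 - z \<xi>) powr \<alpha>) * f \<xi>"
      using ne
    proof eventually_elim
      case (elim \<xi>)
      from sums[OF elim] show ?case unfolding eq sums_def by (intro tendsto_mult tendsto_const)
    qed
    fix n
    show "AE \<xi> in lborel. \<bar>\<Sum>k<n. a k * (z \<xi> ^ Suc k * f \<xi>)\<bar> \<le> B"
      using ne
    proof eventually_elim
      case (elim \<xi>)
      have "0 \<le> (\<Sum>k<n. a k * z \<xi> ^ Suc k)" using a0 z by (intro sum_nonneg) auto
      moreover have "(\<Sum>k<n. a k * z \<xi> ^ Suc k) \<le> 1 - (1 - z \<xi>) powr \<alpha>"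
        unfolding sums_unique[OF sums[OF elim]]
        by (intro sum_le_suminf sums_summable[OF sums[OF elim]]) (auto intro!: mult_nonneg_nonneg zero_le_power a0 z)
      ultimately have "0 \<le> (\<Sum>k<n. a k * z \<xi> ^ Suc k)" "(\<Sum>k<n. a k * z \<xi> ^ Suc k) \<le> 1"
        by (auto intro: order_trans)
      then have "\<bar>\<Sum>k<n. a k * z \<xi> ^ Suc k\<bar> * \<bar>f \<xi>\<bar> \<le> 1 * B" using B by (intro mult_mono) auto
      then show ?case unfolding eq by (simp add: abs_mult)
    qed
  next
    fix \<xi>
    have "\<bar>1 - (1 - z \<xi>) powr \<alpha>\<bar> \<le> 1" using z[of \<xi>] \<alpha> powr_le1[of \<alpha> "1 - z \<xi>"] by auto
    then have "\<bar>1 - (1 - z \<xi>) powr \<alpha>\<bar> * \<bar>f \<xi>\<bar> \<le> 1 * B" using B by (intro mult_mono) auto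
    then show "\<bar>(1 - (1 - z \<xi>) powr \<alpha>) * f \<xi>\<bar> \<le> B" by (simp add: abs_mult)
  qed measurable
  then show ?thesis by (simp add: z_def)
qed

text \<open>Bochner's subordination without constructing the stable subordinator: with \<open>\<lambda> = |\<xi>|\<^sup>2\<close> and
  \<open>\<alpha> = \<theta> / 2\<close>, the difference quotient \<open>(1 - exp (- h \<lambda>)) / h\<close> tends to \<open>\<lambda>\<close> as \<open>h \<rightarrow> 0\<close>, and
  \<open>exp (- T (1 - exp (- h \<lambda>))\<^sup>\<alpha>)\<close> equals \<open>exp (- T) exp (T (1 - (1 - exp (- h \<lambda>))\<^sup>\<alpha>))\<close>, an exponential of
  a multiplier that preserves the class.\<close>

lemma unimodal_heat_mult:
  assumes t: "0 < t" and \<theta>: "0 < \<theta>" "\<theta> \<le> 2"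
  shows "unimodal_multiplier (heat_mult \<theta> t :: 'a::euclidean_space \<Rightarrow> real)"
proof -
  define \<alpha> where "\<alpha> = \<theta> / 2"
  have \<alpha>: "0 < \<alpha>" "\<alpha> \<le> 1" using \<theta> by (auto simp: \<alpha>_def)
  \<comment> \<open>Step sizes \<open>h \<rightarrow> 0\<close>; the factor \<open>T = t h\<^sup>-\<^sup>\<alpha>\<close> completes \<open>(1 - exp (- h \<lambda>))\<^sup>\<alpha>\<close> to the difference quotient.\<close>
  define h where "h n = inverse (real (Suc n))" for n
  have h: "h n > 0" for n by (simp add: h_def)
  define w where "w n \<xi> = (1 - exp (- h n * (norm \<xi>)\<^sup>2)) powr \<alpha>" for n and \<xi> :: 'a
  have w: "0 \<le> w n \<xi>" "w n \<xi> \<le> 1" for n \<xi>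
    unfolding w_def using h[of n] \<alpha> by (auto intro!: powr_le1)
  define T where "T n = t / h n powr \<alpha>" for n
  have T: "T n > 0" for n using h[of n] t by (simp add: T_def)
  have "unimodal_multiplier (\<lambda>\<xi>. exp (T n * (1 - w n \<xi>)))" for n
  proof (rule unimodal_exp)
    fix f :: "'a \<Rightarrow> real" assume "unimodal_multiplier f"
    then have "unimodal_multiplier (\<lambda>\<xi>. T n * ((1 - w n \<xi>) * f \<xi>))"
      unfolding w_def using h \<alpha> T[of n] by (intro unimodal_scale unimodal_mult_binomial) auto
    then show "unimodal_multiplier (\<lambda>\<xi>. T n * (1 - w n \<xi>) * f \<xi>)" by (simp add: mult_ac)
  next
    show "\<bar>T n * (1 - w n \<xi>)\<bar> \<le> T n" for \<xi> 
      using w[where n=n and \<xi>=\<xi>] T[of n] by (simp add: abs_mult)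
  qed
  then have "unimodal_multiplier (\<lambda>\<xi>. exp (- T n) * exp (T n * (1 - w n \<xi>)))" for n
    by (rule unimodal_scale) simp
  moreover have "exp (- T n) * exp (T n * (1 - w n \<xi>)) = exp (- (T n * w n \<xi>))" for n \<xi>
    unfolding exp_add[symmetric] by (rule arg_cong[where f=exp]) (simp add: right_diff_distrib)
  ultimately have "unimodal_multiplier (\<lambda>\<xi>. exp (- (T n * w n \<xi>)))" for n
    by (simp only:)
  then show ?thesis
  proof (rule unimodal_limit)
    fix n show "AE \<xi> in lborel. \<bar>exp (- (T n * w n \<xi>))\<bar> \<le> 1"
      using T[of n] w[of n] by (auto simp: less_imp_le)
  next
    fix \<xi> :: 'a show "\<bar>heat_mult \<theta> t \<xi>\<bar> \<le> 1" using t by (simp add: heat_mult_def)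
  next
    have "AE \<xi> in lborel. (\<xi>::'a) \<noteq> 0" by (rule AE_lborel_singleton)
    then show "AE \<xi> in lborel. (\<lambda>n. exp (- (T n * w n \<xi>))) \<longlonglongrightarrow> heat_mult \<theta> t (\<xi>::'a)"
    proof eventually_elim
      case (elim \<xi>)
      define l where "l = (norm \<xi>)\<^sup>2"
      have l: "l > 0" using elim by (simp add: l_def)
      have "((\<lambda>x. (1 - exp (- x * l)) / x) \<longlongrightarrow> l) (at_right 0)"
        using l by real_asymp
      moreover have "filterlim h (at_right 0) sequentially"
        unfolding h_def by real_asymp
      ultimately have "(\<lambda>n. (1 - exp (- h n * l)) / h n) \<longlonglongrightarrow> l" by (rule filterlim_compose)
      then have "(\<lambda>n. exp (- (t * ((1 - exp (- h n * l)) / h n) powr \<alpha>))) \<longlonglongrightarrow> exp (- (t * l powr \<alpha>))"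
        using l by (intro tendsto_intros) auto
      moreover have "t * ((1 - exp (- h n * l)) / h n) powr \<alpha> = T n * w n \<xi>" for n
        unfolding T_def w_def l_def using h[of n] by (simp add: powr_divide)
      moreover have "l powr \<alpha> = norm \<xi> powr \<theta>"
        unfolding l_def \<alpha>_def using elim by (simp add: powr_powr flip: powr_numeral)
      ultimately show ?case by (simp add: heat_mult_def)
    qed
  qed measurable
qed

section \<open>The fundamental solution\<close>

lemma heat_mult_minus[simp]: "heat_mult \<theta> t (- \<xi>) = heat_mult \<theta> t \<xi>"
  by (simp add: heat_mult_def)

lemma heat_mult_nonneg[simp]: "0 \<le> heat_mult \<theta> t \<xi>"
  by (simp add: heat_mult_def)

lemma heat_mult_le_1: "0 < t \<Longrightarrow> heat_mult \<theta> t \<xi> \<le> 1"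
  by (simp add: heat_mult_def)

lemma heat_mult_add: "heat_mult \<theta> (s + t) \<xi> = heat_mult \<theta> s \<xi> * heat_mult \<theta> t \<xi>"
  by (simp add: heat_mult_def exp_add[symmetric] algebra_simps)

text \<open>Fubini's theorem in the form in which it enters every Fourier argument below, with \<open>k\<close> built from cosines.\<close>

lemma integral_swap_bounded_kernel:
  fixes f :: "'a::euclidean_space \<Rightarrow> real" and g :: "'b::euclidean_space \<Rightarrow> real" and k :: "'a \<Rightarrow> 'b \<Rightarrow> real"
  assumes f: "integrable lborel f" and g: "integrable lborel g"
    and [measurable]: "case_prod k \<in> borel_measurable (borel \<Otimes>\<^sub>M borel)" and k: "\<And>x y. \<bar>k x y\<bar> \<le> 1"
  shows "(\<integral>x. (\<integral>y. k x y * g y \<partial>lborel) * f x \<partial>lborel) = (\<integral>y. (\<integral>x. k x y * f x \<partial>lborel) * g y \<partial>lborel)"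
proof -
  have [measurable]: "f \<in> borel_measurable borel" "g \<in> borel_measurable borel"
    using f g by (auto dest: borel_measurable_integrable)
  have *: "integrable lborel (\<lambda>y. f x * g y)" for x
    by (intro integrable_mult_right g)
  have fg: "integrable (lborel \<Otimes>\<^sub>M lborel) (\<lambda>(x, y). f x * g y)"
  proof (rule lborel_pair.Fubini_integrable)
    show "integrable lborel (\<lambda>x. \<integral>y. norm (case (x, y) of (x, y) \<Rightarrow> f x * g y) \<partial>lborel)"
      using f by (simp add: abs_mult)
  qed (use * in auto)
  have int: "integrable (lborel \<Otimes>\<^sub>M lborel) (\<lambda>(x, y). k x y * g y * f x)"
  proof (rule Bochner_Integration.integrable_bound[OF fg])
    show "AE z in lborel \<Otimes>\<^sub>M lborel. norm (case z of (x, y) \<Rightarrow> k x y * g y * f x) \<le> norm (case z of (x, y) \<Rightarrow> f x * g y)"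
    proof (rule AE_I2, clarify)
      fix x y
      have "\<bar>k x y\<bar> * (\<bar>g y\<bar> * \<bar>f x\<bar>) \<le> 1 * (\<bar>g y\<bar> * \<bar>f x\<bar>)" by (intro mult_right_mono k) auto
      then show "norm (k x y * g y * f x) \<le> norm (f x * g y)" by (simp add: abs_mult mult_ac)
    qed
  qed measurable
  show ?thesis
    using lborel_pair.Fubini_integral[OF int] 
    by (simp add: integral_mult_left_zero[symmetric] integral_mult_right_zero[symmetric] mult_ac
        del: integral_mult_left_zero integral_mult_right_zero)
qed

lemma fund_sol_eq:
  fixes x :: "'a::euclidean_space"
  assumes t: "0 < t" and \<theta>: "0 < \<theta>"
  shows "fund_sol \<theta> x t = (\<integral>\<xi>. cos (x \<bullet> \<xi>) * heat_mult \<theta> t \<xi> \<partial>lborel) / (2 * pi) ^ DIM('a)"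
proof -
  let ?f = "\<lambda>\<xi>::'a. exp (\<i> * complex_of_real (x \<bullet> \<xi>) - complex_of_real (t * norm \<xi> powr \<theta>))"
  have "integrable lborel ?f"
    using integrable_heat_mult[OF t \<theta>]
    by (rule Bochner_Integration.integrable_bound) (auto simp: heat_mult_def)
  then have "Re (integral\<^sup>L lborel ?f) = (\<integral>\<xi>. cos (x \<bullet> \<xi>) * heat_mult \<theta> t \<xi> \<partial>lborel)"
    by (subst integral_Re[symmetric]) (auto simp: Re_exp heat_mult_def mult_ac)
  then show ?thesis unfolding fund_sol_def by (metis Re_divide_of_real)
qed

lemma fund_sol_measurable_pair:
  "(\<lambda>(x::'a::euclidean_space, t). fund_sol \<theta> x t) \<in> borel_measurable (borel \<Otimes>\<^sub>M borel)"
  unfolding fund_sol_def by measurable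

lemma fund_sol_measurable[measurable (raw)]:
  assumes "f \<in> M \<rightarrow>\<^sub>M (borel :: 'a::euclidean_space measure)" "g \<in> borel_measurable M"
  shows "(\<lambda>z. fund_sol \<theta> (f z) (g z)) \<in> borel_measurable M"
  using measurable_compose[OF measurable_Pair[OF assms] fund_sol_measurable_pair] by simp

lemma fund_sol_minus:
  fixes x :: "'a::euclidean_space"
  assumes "0 < t" "0 < \<theta>"
  shows "fund_sol \<theta> (- x) t = fund_sol \<theta> x t"
  using assms by (simp add: fund_sol_eq)

text \<open>Removing the Gaussian damping: \<open>\<eta> \<rightarrow> 0\<close> in \<open>unimodal_heat_mult\<close>.\<close>

lemma fund_sol_unimodal:
  fixes x y :: "'a::euclidean_space"
  assumes t: "0 < t" and \<theta>: "0 < \<theta>" "\<theta> \<le> 2"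
  shows fund_sol_nonneg: "0 \<le> fund_sol \<theta> x t"
    and fund_sol_antimono: "norm x \<le> norm y \<Longrightarrow> fund_sol \<theta> y t \<le> fund_sol \<theta> x t"
proof -
  define e where "e n = inverse (real (Suc n))" for n
  have e: "e n > 0" for n by (simp add: e_def)
  have "e \<longlonglongrightarrow> 0" unfolding e_def by (rule LIMSEQ_inverse_real_of_nat)
  have L: "(\<lambda>n. gauss_cos_transform (e n) (heat_mult \<theta> t) x / (2 * pi) ^ DIM('a)) \<longlonglongrightarrow> fund_sol \<theta> x t" for x :: 'a
    unfolding fund_sol_eq[OF t \<theta>(1)] gauss_cos_transform_def
  proof (intro tendsto_divide tendsto_const integral_dominated_convergence)
    show "integrable lborel (heat_mult \<theta> t :: 'a \<Rightarrow> real)" by (rule integrable_heat_mult[OF t \<theta>(1)])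
    show "AE \<xi> in lborel. (\<lambda>n. cos (x \<bullet> \<xi>) * (heat_mult \<theta> t \<xi> * exp (- e n * (norm \<xi>)\<^sup>2))) \<longlonglongrightarrow> cos (x \<bullet> \<xi>) * heat_mult \<theta> t \<xi>"
    proof (rule AE_I2)
      fix \<xi> :: 'a
      have "(\<lambda>n. cos (x \<bullet> \<xi>) * (heat_mult \<theta> t \<xi> * exp (- e n * (norm \<xi>)\<^sup>2))) \<longlonglongrightarrow> cos (x \<bullet> \<xi>) * (heat_mult \<theta> t \<xi> * exp (- 0 * (norm \<xi>)\<^sup>2))"
        by (intro tendsto_intros \<open>e \<longlonglongrightarrow> 0\<close>)
      then show "(\<lambda>n. cos (x \<bullet> \<xi>) * (heat_mult \<theta> t \<xi> * exp (- e n * (norm \<xi>)\<^sup>2))) \<longlonglongrightarrow> cos (x \<bullet> \<xi>) * heat_mult \<theta> t \<xi>" by simp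
    qed
    fix n
    show "AE \<xi> in lborel. norm (cos (x \<bullet> \<xi>) * (heat_mult \<theta> t \<xi> * exp (- e n * (norm \<xi>)\<^sup>2))) \<le> heat_mult \<theta> t \<xi>"
    proof (rule AE_I2)
      fix \<xi> :: 'a
      have "\<bar>cos (x \<bullet> \<xi>)\<bar> * (heat_mult \<theta> t \<xi> * exp (- e n * (norm \<xi>)\<^sup>2)) \<le> 1 * (heat_mult \<theta> t \<xi> * 1)"
        using e[of n] by (intro mult_mono) auto
      then show "norm (cos (x \<bullet> \<xi>) * (heat_mult \<theta> t \<xi> * exp (- e n * (norm \<xi>)\<^sup>2))) \<le> heat_mult \<theta> t \<xi>"
        by (simp add: abs_mult)
    qed
  qed simp_all
  note U = unimodal_heat_mult[OF t \<theta>]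
  show "0 \<le> fund_sol \<theta> x t"
    by (rule LIMSEQ_le_const[OF L]) (auto simp: unimodal_multiplierD[OF U e])
  assume "norm x \<le> norm y"
  then show "fund_sol \<theta> y t \<le> fund_sol \<theta> x t"
    by (intro LIMSEQ_le[OF L L] exI[of _ 0]) (auto intro!: divide_right_mono unimodal_multiplierD[OF U e])
qed

lemma fund_sol_scaling:
  fixes x :: "'a::euclidean_space"
  assumes t: "0 < t" and \<theta>: "0 < \<theta>"
  shows "fund_sol \<theta> x t = t powr (- real DIM('a) / \<theta>) * fund_sol \<theta> (t powr (- 1 / \<theta>) *\<^sub>R x) 1"
proof -
  define c where "c = t powr (- 1 / \<theta>)"
  have c: "c > 0" using t by (simp add: c_def)
  have tc: "t * c powr \<theta> = 1"
  proof -
    have "c powr \<theta> = t powr (- 1)" unfolding c_def powr_powr using \<theta> by simp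
    then show ?thesis using t by (simp add: powr_minus_divide)
  qed
  have cN: "c ^ DIM('a) = t powr (- real DIM('a) / \<theta>)"
    using c t \<theta> by (simp add: c_def powr_powr flip: powr_realpow)
  have s: "heat_mult \<theta> t (c *\<^sub>R \<xi>) = heat_mult \<theta> 1 \<xi>" for \<xi> :: 'a
  proof -
    have "t * (c * norm \<xi>) powr \<theta> = norm \<xi> powr \<theta>"
      using c tc by (simp add: powr_mult mult.assoc[symmetric])
    then show ?thesis using c by (simp add: heat_mult_def)
  qed
  have "(\<integral>\<xi>. cos (x \<bullet> \<xi>) * heat_mult \<theta> t \<xi> \<partial>lborel) = c ^ DIM('a) * (\<integral>\<xi>. cos ((c *\<^sub>R x) \<bullet> \<xi>) * heat_mult \<theta> 1 \<xi> \<partial>lborel)"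
    by (subst integral_lborel_affine[of _ c 0]) (use c in \<open>auto simp: s\<close>)
  then show ?thesis using t \<theta> unfolding cN by (simp add: fund_sol_eq c_def)
qed

lemma fund_sol_le:
  fixes x :: "'a::euclidean_space"
  assumes t: "0 < t" and \<theta>: "0 < \<theta>" "\<theta> \<le> 2"
  shows "fund_sol \<theta> x t \<le> t powr (- real DIM('a) / \<theta>) * fund_sol \<theta> (0::'a) 1"
  using fund_sol_antimono[OF t \<theta>, of 0 x] fund_sol_scaling[OF t \<theta>(1), of "0::'a"] by simp

lemma gaussian_total: "(\<integral>w. exp (- (norm w)\<^sup>2) \<partial>(lborel::'a::euclidean_space measure)) = sqrt pi ^ DIM('a)"
  using gaussian_fourier(2)[of 1 "0::'a"] by simp

text \<open>The damped inverse transform of the multiplier is its average over a Gaussian of width \<open>\<surd>\<eta>\<close>.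
  The product formula for cosines produces Gaussians centred at \<open>\<xi>\<close> and \<open>- \<xi>\<close>, which have the same
  integral against the even multiplier.\<close>

lemma fund_sol_regularised_fourier:
  fixes \<xi> :: "'a::euclidean_space"
  assumes t: "0 < t" and \<theta>: "0 < \<theta>" and \<eta>: "0 < \<eta>"
  shows "(\<integral>y. cos (y \<bullet> \<xi>) * (fund_sol \<theta> y t * exp (- \<eta> * (norm y)\<^sup>2)) \<partial>lborel)
    = (\<integral>w. heat_mult \<theta> t (\<xi> + (2 * sqrt \<eta>) *\<^sub>R w) * exp (- (norm w)\<^sup>2) \<partial>lborel) / sqrt pi ^ DIM('a)"
proof -
  let ?N = "DIM('a)"
  let ?g = "\<lambda>w::'a. sqrt (pi / \<eta>) ^ ?N * exp (- (norm w)\<^sup>2 / (4 * \<eta>))"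
  let ?S = "heat_mult \<theta> t :: 'a \<Rightarrow> real"
  have Sint: "integrable lborel ?S" by (rule integrable_heat_mult[OF t \<theta>])
  have Gint: "integrable lborel (\<lambda>y::'a. exp (- \<eta> * (norm y)\<^sup>2))" by (rule gaussian_fourier(1)[OF \<eta>])
  have A: "(\<integral>y. cos (y \<bullet> \<xi>) * (fund_sol \<theta> y t * exp (- \<eta> * (norm y)\<^sup>2)) \<partial>lborel)
     = (\<integral>y. (\<integral>\<zeta>. cos (y \<bullet> \<xi>) * cos (y \<bullet> \<zeta>) * ?S \<zeta> \<partial>lborel) * exp (- \<eta> * (norm y)\<^sup>2) \<partial>lborel) / (2 * pi) ^ ?N"
    unfolding fund_sol_eq[OF t \<theta>] mult.assoc integral_mult_right_zero
    by (simp only: times_divide_eq_left times_divide_eq_right integral_divide_zero mult.assoc)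
  have B: "(\<integral>y. (\<integral>\<zeta>. cos (y \<bullet> \<xi>) * cos (y \<bullet> \<zeta>) * ?S \<zeta> \<partial>lborel) * exp (- \<eta> * (norm y)\<^sup>2) \<partial>lborel)
     = (\<integral>\<zeta>. (\<integral>y. cos (y \<bullet> \<xi>) * cos (y \<bullet> \<zeta>) * exp (- \<eta> * (norm y)\<^sup>2) \<partial>lborel) * ?S \<zeta> \<partial>lborel)"
  proof (rule integral_swap_bounded_kernel[OF Gint Sint])
    show "\<bar>cos (x \<bullet> \<xi>) * cos (x \<bullet> y)\<bar> \<le> 1" for x y
      using mult_mono[of "\<bar>cos (x \<bullet> \<xi>)\<bar>" 1 "\<bar>cos (x \<bullet> y)\<bar>" 1] by (simp add: abs_mult)
  qed measurable
  have C: "(\<integral>y. cos (y \<bullet> \<xi>) * cos (y \<bullet> \<zeta>) * exp (- \<eta> * (norm y)\<^sup>2) \<partial>lborel) = (?g (\<zeta> - \<xi>) + ?g (\<zeta> + \<xi>)) / 2" for \<zeta>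
  proof -
    have ci: "integrable lborel (\<lambda>y::'a. cos (z \<bullet> y) * exp (- \<eta> * (norm y)\<^sup>2))" for z
      using integrable_gauss_cos[of "\<lambda>_. 1" 1 \<eta> z] \<eta> by simp
    have "(\<integral>y. cos (y \<bullet> \<xi>) * cos (y \<bullet> \<zeta>) * exp (- \<eta> * (norm y)\<^sup>2) \<partial>lborel)
       = (\<integral>y. (cos ((\<zeta> - \<xi>) \<bullet> y) * exp (- \<eta> * (norm y)\<^sup>2) + cos ((\<zeta> + \<xi>) \<bullet> y) * exp (- \<eta> * (norm y)\<^sup>2)) / 2 \<partial>lborel)"
      by (intro Bochner_Integration.integral_cong refl)
         (simp add: inner_diff_left inner_add_left cos_add cos_diff inner_commute algebra_simps)
    also have "\<dots> = (?g (\<zeta> - \<xi>) + ?g (\<zeta> + \<xi>)) / 2"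
      by (simp only: integral_divide_zero Bochner_Integration.integral_add[OF ci ci] gaussian_fourier(2)[OF \<eta>])
    finally show ?thesis .
  qed
  have "(\<integral>\<zeta>. (?g (\<zeta> - \<xi>) + ?g (\<zeta> + \<xi>)) / 2 * ?S \<zeta> \<partial>lborel) = (\<integral>\<zeta>. ?g (\<zeta> - \<xi>) * ?S \<zeta> \<partial>lborel)"
  proof -
    have gi: "integrable lborel (\<lambda>\<zeta>. ?g (\<zeta> - v) * ?S \<zeta>)" for v
    proof (rule Bochner_Integration.integrable_bound[OF integrable_mult_right[OF Sint]])
      show "AE \<zeta> in lborel. norm (?g (\<zeta> - v) * ?S \<zeta>) \<le> norm (sqrt (pi / \<eta>) ^ ?N * ?S \<zeta>)"
        using \<eta> by (intro AE_I2) (auto simp: abs_mult intro!: mult_left_le_one_le)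
    qed measurable
    have r: "(\<integral>\<zeta>. ?g (\<zeta> + \<xi>) * ?S \<zeta> \<partial>lborel) = (\<integral>\<zeta>. ?g (\<zeta> - \<xi>) * ?S \<zeta> \<partial>lborel)"
    proof (subst integral_lborel_affine[of _ "-1" 0])
      have "norm (- \<zeta> + \<xi>) = norm (\<zeta> - \<xi>)" for \<zeta> using norm_minus_commute[of \<zeta> \<xi>] by simp
      then show "\<bar>- 1\<bar> ^ ?N * (\<integral>x. ?g (0 + - 1 *\<^sub>R x + \<xi>) * heat_mult \<theta> t (0 + - 1 *\<^sub>R x) \<partial>lborel) = (\<integral>\<zeta>. ?g (\<zeta> - \<xi>) * ?S \<zeta> \<partial>lborel)"
        by simp
    qed simp_all
    have "(\<integral>\<zeta>. (?g (\<zeta> - \<xi>) + ?g (\<zeta> + \<xi>)) / 2 * ?S \<zeta> \<partial>lborel)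
       = (\<integral>\<zeta>. (?g (\<zeta> - \<xi>) * ?S \<zeta> + ?g (\<zeta> - (- \<xi>)) * ?S \<zeta>) / 2 \<partial>lborel)"
      by (intro Bochner_Integration.integral_cong refl) (simp add: algebra_simps)
    also have "\<dots> = (\<integral>\<zeta>. ?g (\<zeta> - \<xi>) * ?S \<zeta> \<partial>lborel)"
      using r by (subst integral_divide_zero, subst Bochner_Integration.integral_add[OF gi gi]) simp
    finally show ?thesis .
  qed
  also have "\<dots> = (2 * sqrt \<eta>) ^ ?N * (\<integral>w. sqrt (pi / \<eta>) ^ ?N * (heat_mult \<theta> t (\<xi> + (2 * sqrt \<eta>) *\<^sub>R w) * exp (- (norm w)\<^sup>2)) \<partial>lborel)"
    by (subst integral_lborel_affine[of _ "2 * sqrt \<eta>" \<xi>]) (use \<eta> in \<open>auto simp: power_mult_distrib mult_ac\<close>)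
  also have "\<dots> = (2 * sqrt pi) ^ ?N * (\<integral>w. heat_mult \<theta> t (\<xi> + (2 * sqrt \<eta>) *\<^sub>R w) * exp (- (norm w)\<^sup>2) \<partial>lborel)"
    using \<eta> by (simp add: real_sqrt_divide power_mult_distrib power_divide)
  finally have D: "(\<integral>\<zeta>. (?g (\<zeta> - \<xi>) + ?g (\<zeta> + \<xi>)) / 2 * ?S \<zeta> \<partial>lborel)
     = (2 * sqrt pi) ^ ?N * (\<integral>w. heat_mult \<theta> t (\<xi> + (2 * sqrt \<eta>) *\<^sub>R w) * exp (- (norm w)\<^sup>2) \<partial>lborel)" .
  have "(2 * pi) ^ ?N = (2 * sqrt pi) ^ ?N * sqrt pi ^ ?N"
    unfolding power_mult_distrib[symmetric] mult.assoc by simp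
  then show ?thesis unfolding A B C D by simp
qed

text \<open>Let \<open>\<eta> \<rightarrow> 0\<close> in the damped identity.  At \<open>\<xi> = 0\<close> Fatou's lemma applies, as the kernel is
  nonnegative, and shows that it is integrable; this in turn justifies dominated convergence for
  general \<open>\<xi>\<close>.\<close>

lemma fund_sol_fourier:
  fixes \<xi> :: "'a::euclidean_space"
  assumes t: "0 < t" and \<theta>: "0 < \<theta>" "\<theta> \<le> 2"
  shows integrable_fund_sol: "integrable lborel (\<lambda>y::'a. fund_sol \<theta> y t)"
    and "(\<integral>y. cos (y \<bullet> \<xi>) * fund_sol \<theta> y t \<partial>lborel) = heat_mult \<theta> t \<xi>"
proof -
  let ?N = "DIM('a)"
  define e where "e n = inverse (real (Suc n))" for n
  have e: "e n > 0" for n by (simp add: e_def)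
  have e0: "e \<longlonglongrightarrow> 0" unfolding e_def by (rule LIMSEQ_inverse_real_of_nat)
  have pos: "0 \<le> fund_sol \<theta> y t" for y :: 'a by (rule fund_sol_nonneg[OF t \<theta>])
  have gi: "integrable lborel (\<lambda>w::'a. exp (- (norm w)\<^sup>2))" using gaussian_fourier(1)[of 1] by simp
  have L: "(\<lambda>n. \<integral>y. cos (y \<bullet> \<xi>) * (fund_sol \<theta> y t * exp (- e n * (norm y)\<^sup>2)) \<partial>lborel) \<longlonglongrightarrow> heat_mult \<theta> t \<xi>" for \<xi> :: 'a
  proof -
    have "(\<lambda>n. \<integral>w. heat_mult \<theta> t (\<xi> + (2 * sqrt (e n)) *\<^sub>R w) * exp (- (norm w)\<^sup>2) \<partial>(lborel::'a measure))
      \<longlonglongrightarrow> (\<integral>w. heat_mult \<theta> t \<xi> * exp (- (norm w)\<^sup>2) \<partial>(lborel::'a measure))"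
    proof (rule integral_dominated_convergence[OF _ _ gi])
      show "AE w in lborel. (\<lambda>n. heat_mult \<theta> t (\<xi> + (2 * sqrt (e n)) *\<^sub>R w) * exp (- (norm w)\<^sup>2)) \<longlonglongrightarrow> heat_mult \<theta> t \<xi> * exp (- (norm w)\<^sup>2)"
      proof (rule AE_I2)
        fix w :: 'a
        have "(\<lambda>n. norm (\<xi> + (2 * sqrt (e n)) *\<^sub>R w)) \<longlonglongrightarrow> norm (\<xi> + (2 * sqrt 0) *\<^sub>R w)"
          by (intro tendsto_intros e0)
        then have "(\<lambda>n. norm (\<xi> + (2 * sqrt (e n)) *\<^sub>R w)) \<longlonglongrightarrow> norm \<xi>" by simp
        then have "(\<lambda>n. norm (\<xi> + (2 * sqrt (e n)) *\<^sub>R w) powr \<theta>) \<longlonglongrightarrow> norm \<xi> powr \<theta>"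
          by (rule tendsto_powr'[OF _ tendsto_const]) (use \<theta> in auto)
        then have "(\<lambda>n. heat_mult \<theta> t (\<xi> + (2 * sqrt (e n)) *\<^sub>R w)) \<longlonglongrightarrow> heat_mult \<theta> t \<xi>"
          unfolding heat_mult_def by (intro tendsto_exp tendsto_minus tendsto_mult tendsto_const)
        then show "(\<lambda>n. heat_mult \<theta> t (\<xi> + (2 * sqrt (e n)) *\<^sub>R w) * exp (- (norm w)\<^sup>2)) \<longlonglongrightarrow> heat_mult \<theta> t \<xi> * exp (- (norm w)\<^sup>2)"
          by (intro tendsto_intros)
      qed
    next
      fix n show "AE w in lborel. norm (heat_mult \<theta> t (\<xi> + (2 * sqrt (e n)) *\<^sub>R w) * exp (- (norm w)\<^sup>2)) \<le> exp (- (norm w)\<^sup>2)"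
        using heat_mult_le_1[OF t] by (auto simp: abs_mult)
    qed measurable
    from tendsto_divide[OF this tendsto_const[of "sqrt pi ^ ?N"]]
    show ?thesis
      unfolding fund_sol_regularised_fourier[OF t \<theta>(1) e] by (simp add: gaussian_total)
  qed
  have gint: "integrable lborel (\<lambda>y::'a. fund_sol \<theta> y t * exp (- e n * (norm y)\<^sup>2))" for n
  proof (rule Bochner_Integration.integrable_bound[OF integrable_mult_right[OF gaussian_fourier(1)[OF e]]])
    show "AE y::'a in lborel. norm (fund_sol \<theta> y t * exp (- e n * (norm y)\<^sup>2))
        \<le> norm ((t powr (- real ?N / \<theta>) * fund_sol \<theta> (0::'a) 1) * exp (- e n * (norm y)\<^sup>2))"
      using fund_sol_le[OF t \<theta>, where 'a='a] pos
      by (intro AE_I2) (auto simp: abs_mult fund_sol_nonneg[OF _ \<theta>] intro!: mult_right_mono)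
  qed measurable
  have lim: "(\<lambda>n. fund_sol \<theta> y t * exp (- e n * (norm y)\<^sup>2)) \<longlonglongrightarrow> fund_sol \<theta> y t" for y :: 'a
  proof -
    have "(\<lambda>n. fund_sol \<theta> y t * exp (- e n * (norm y)\<^sup>2)) \<longlonglongrightarrow> fund_sol \<theta> y t * exp (- 0 * (norm y)\<^sup>2)"
      by (intro tendsto_intros e0)
    then show ?thesis by simp
  qed
  have "(\<integral>\<^sup>+y. ennreal (fund_sol \<theta> y t) \<partial>(lborel::'a measure)) = (\<integral>\<^sup>+y. liminf (\<lambda>n. ennreal (fund_sol \<theta> y t * exp (- e n * (norm y)\<^sup>2))) \<partial>(lborel::'a measure))"
    by (intro nn_integral_cong lim_imp_Liminf[symmetric] tendsto_ennrealI lim) simp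
  also have "\<dots> \<le> liminf (\<lambda>n. \<integral>\<^sup>+y. ennreal (fund_sol \<theta> y t * exp (- e n * (norm y)\<^sup>2)) \<partial>(lborel::'a measure))"
    by (rule nn_integral_liminf) measurable
  also have "\<dots> = liminf (\<lambda>n. ennreal (\<integral>y. fund_sol \<theta> y t * exp (- e n * (norm y)\<^sup>2) \<partial>(lborel::'a measure)))"
    by (intro arg_cong[where f=liminf] ext nn_integral_eq_integral gint) (simp add: pos)
  also have "\<dots> = ennreal 1"
    using L[of 0] t \<theta> by (intro lim_imp_Liminf tendsto_ennrealI) (auto simp: heat_mult_def)
  finally show int: "integrable lborel (\<lambda>y::'a. fund_sol \<theta> y t)"
    by (intro integrableI_bounded) (auto simp: pos order.strict_trans1)
  have "(\<lambda>n. \<integral>y. cos (y \<bullet> \<xi>) * (fund_sol \<theta> y t * exp (- e n * (norm y)\<^sup>2)) \<partial>lborel)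
     \<longlonglongrightarrow> (\<integral>y. cos (y \<bullet> \<xi>) * fund_sol \<theta> y t \<partial>lborel)"
  proof (rule integral_dominated_convergence[OF _ _ int])
    show "AE y in lborel. (\<lambda>n. cos (y \<bullet> \<xi>) * (fund_sol \<theta> y t * exp (- e n * (norm y)\<^sup>2))) \<longlonglongrightarrow> cos (y \<bullet> \<xi>) * fund_sol \<theta> y t"
      by (intro AE_I2 tendsto_mult tendsto_const lim)
    fix n
    show "AE y in lborel. norm (cos (y \<bullet> \<xi>) * (fund_sol \<theta> y t * exp (- e n * (norm y)\<^sup>2))) \<le> fund_sol \<theta> y t"
    proof (rule AE_I2)
      fix y :: 'a
      have "\<bar>cos (y \<bullet> \<xi>)\<bar> * (fund_sol \<theta> y t * exp (- e n * (norm y)\<^sup>2)) \<le> 1 * (fund_sol \<theta> y t * 1)"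
        using pos e[of n] by (intro mult_mono) auto
      then show "norm (cos (y \<bullet> \<xi>) * (fund_sol \<theta> y t * exp (- e n * (norm y)\<^sup>2))) \<le> fund_sol \<theta> y t"
        using pos by (simp add: abs_mult)
    qed
  qed measurable
  from LIMSEQ_unique[OF this L] show "(\<integral>y. cos (y \<bullet> \<xi>) * fund_sol \<theta> y t \<partial>lborel) = heat_mult \<theta> t \<xi>" .
qed

lemma fund_sol_mass:
  assumes t: "0 < t" and \<theta>: "0 < \<theta>" "\<theta> \<le> 2"
  shows "(\<integral>\<^sup>+y. ennreal (fund_sol \<theta> y t) \<partial>(lborel::'a::euclidean_space measure)) = 1"
proof -
  have "(\<integral>\<^sup>+y. ennreal (fund_sol \<theta> y t) \<partial>(lborel::'a measure)) = ennreal (\<integral>y. fund_sol \<theta> y t \<partial>(lborel::'a measure))"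
    by (intro nn_integral_eq_integral integrable_fund_sol[OF t \<theta>] AE_I2 fund_sol_nonneg[OF t \<theta>])
  also have "(\<integral>y. fund_sol \<theta> y t \<partial>(lborel::'a measure)) = 1"
    using fund_sol_fourier(2)[OF t \<theta>, of "0::'a"] \<theta> by (simp add: heat_mult_def)
  finally show ?thesis by simp
qed

text \<open>The Fourier transform of a convolution is a product and the multipliers are multiplicative in
  time.  The sine part of the transform vanishes because the kernel is even.\<close>

lemma fund_sol_convolution:
  fixes x :: "'a::euclidean_space"
  assumes s: "0 < s" and t: "0 < t" and \<theta>: "0 < \<theta>" "\<theta> \<le> 2"
  shows "(\<integral>\<^sup>+y. ennreal (fund_sol \<theta> (x - y) t) * ennreal (fund_sol \<theta> y s) \<partial>lborel) = ennreal (fund_sol \<theta> x (s + t))"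
proof -
  let ?N = "DIM('a)"
  have gi: "integrable lborel (\<lambda>y::'a. fund_sol \<theta> y s)" by (rule integrable_fund_sol[OF s \<theta>])
  have bounded: "integrable lborel (\<lambda>y::'a. fund_sol \<theta> (x - y) t * fund_sol \<theta> y s)"
  proof (rule Bochner_Integration.integrable_bound[OF integrable_mult_right[OF gi]])
    show "AE y in lborel. norm (fund_sol \<theta> (x - y) t * fund_sol \<theta> y s) \<le> norm (fund_sol \<theta> (0::'a) t * fund_sol \<theta> y s)"
      by (intro AE_I2) (simp add: abs_mult abs_of_nonneg fund_sol_nonneg[OF s \<theta>] fund_sol_nonneg[OF t \<theta>]
          fund_sol_antimono[OF t \<theta>] mult_right_mono)
  qed measurable
  have ci: "integrable lborel (\<lambda>y::'a. cos (y \<bullet> \<xi>) * fund_sol \<theta> y s)"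
           "integrable lborel (\<lambda>y::'a. sin (y \<bullet> \<xi>) * fund_sol \<theta> y s)" for \<xi> :: 'a
    by (rule Bochner_Integration.integrable_bound[OF gi];
        auto simp: abs_mult fund_sol_nonneg[OF s \<theta>] intro!: mult_left_le_one_le)+
  have A: "(\<integral>y. fund_sol \<theta> (x - y) t * fund_sol \<theta> y s \<partial>lborel)
     = (\<integral>y. (\<integral>\<xi>. cos ((x - y) \<bullet> \<xi>) * heat_mult \<theta> t \<xi> \<partial>lborel) * fund_sol \<theta> y s \<partial>lborel) / (2 * pi) ^ ?N"
    unfolding fund_sol_eq[OF t \<theta>(1)] by simp
  have B: "(\<integral>y. (\<integral>\<xi>. cos ((x - y) \<bullet> \<xi>) * heat_mult \<theta> t \<xi> \<partial>lborel) * fund_sol \<theta> y s \<partial>lborel)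
     = (\<integral>\<xi>. (\<integral>y. cos ((x - y) \<bullet> \<xi>) * fund_sol \<theta> y s \<partial>lborel) * heat_mult \<theta> t \<xi> \<partial>lborel)"
    by (rule integral_swap_bounded_kernel[OF gi integrable_heat_mult[OF t \<theta>(1)]]) auto
  have C: "(\<integral>y. cos ((x - y) \<bullet> \<xi>) * fund_sol \<theta> y s \<partial>lborel) = cos (x \<bullet> \<xi>) * heat_mult \<theta> s \<xi>" for \<xi>
  proof -
    have odd: "(\<integral>y. sin (y \<bullet> \<xi>) * fund_sol \<theta> y s \<partial>lborel) = 0"
      by (rule integral_lborel_odd) (auto simp: fund_sol_minus[OF s \<theta>(1)])
    have "(\<integral>y. cos ((x - y) \<bullet> \<xi>) * fund_sol \<theta> y s \<partial>lborel)
       = (\<integral>y. cos (x \<bullet> \<xi>) * (cos (y \<bullet> \<xi>) * fund_sol \<theta> y s) + sin (x \<bullet> \<xi>) * (sin (y \<bullet> \<xi>) * fund_sol \<theta> y s) \<partial>lborel)"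
      by (intro Bochner_Integration.integral_cong refl) (simp add: inner_diff_left cos_diff algebra_simps)
    also have "\<dots> = cos (x \<bullet> \<xi>) * (\<integral>y. cos (y \<bullet> \<xi>) * fund_sol \<theta> y s \<partial>lborel)"
      by (subst Bochner_Integration.integral_add) (auto intro!: integrable_mult_right ci simp: odd)
    also have "\<dots> = cos (x \<bullet> \<xi>) * heat_mult \<theta> s \<xi>" by (simp only: fund_sol_fourier(2)[OF s \<theta>])
    finally show ?thesis .
  qed
  have eq: "(\<integral>y. fund_sol \<theta> (x - y) t * fund_sol \<theta> y s \<partial>lborel) = fund_sol \<theta> x (s + t)"
    unfolding A B C using s t \<theta> by (simp add: fund_sol_eq heat_mult_add mult.assoc)
  have "(\<integral>\<^sup>+y. ennreal (fund_sol \<theta> (x - y) t) * ennreal (fund_sol \<theta> y s) \<partial>lborel)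
      = (\<integral>\<^sup>+y. ennreal (fund_sol \<theta> (x - y) t * fund_sol \<theta> y s) \<partial>lborel)"
    by (simp add: ennreal_mult fund_sol_nonneg[OF s \<theta>] fund_sol_nonneg[OF t \<theta>])
  also have "\<dots> = ennreal (\<integral>y. fund_sol \<theta> (x - y) t * fund_sol \<theta> y s \<partial>lborel)"
    by (intro nn_integral_eq_integral bounded AE_I2 mult_nonneg_nonneg fund_sol_nonneg s t \<theta>)
  finally show ?thesis unfolding eq .
qed

section \<open>The semigroup on nonnegative functions\<close>

lemma frac_heat_semigroup_lborel:
  "frac_heat_semigroup \<theta> t \<psi> x = (\<integral>\<^sup>+y. ennreal (fund_sol \<theta> (x - y) t) * \<psi> y \<partial>lborel)"
  unfolding frac_heat_semigroup_def by (rule nn_integral_completion)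

lemma frac_heat_semigroup_measurable[measurable (raw)]:
  fixes x :: "'b \<Rightarrow> 'a::euclidean_space"
  assumes [measurable]: "(\<lambda>(z, y). \<psi> z y) \<in> borel_measurable (M \<Otimes>\<^sub>M borel)"
    and [measurable]: "\<tau> \<in> borel_measurable M" "x \<in> M \<rightarrow>\<^sub>M borel"
  shows "(\<lambda>z. frac_heat_semigroup \<theta> (\<tau> z) (\<psi> z) (x z)) \<in> borel_measurable M"
  unfolding frac_heat_semigroup_lborel by measurable

lemma frac_heat_semigroup_mono:
  "(\<And>y. \<psi> y \<le> \<psi>' y) \<Longrightarrow> frac_heat_semigroup \<theta> t \<psi> x \<le> frac_heat_semigroup \<theta> t \<psi>' x"
  unfolding frac_heat_semigroup_lborel by (intro nn_integral_mono mult_left_mono) auto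

lemma frac_heat_semigroup_mono_AE:
  "(AE y in lborel. \<psi> y \<le> \<psi>' y) \<Longrightarrow> frac_heat_semigroup \<theta> t \<psi> x \<le> frac_heat_semigroup \<theta> t \<psi>' x"
  unfolding frac_heat_semigroup_lborel
  by (intro nn_integral_mono_AE, erule eventually_mono, rule mult_left_mono) auto

lemma frac_heat_semigroup_cong_AE:
  "(AE y in lborel. \<psi> y = \<psi>' y) \<Longrightarrow> frac_heat_semigroup \<theta> t \<psi> x = frac_heat_semigroup \<theta> t \<psi>' x"
  unfolding frac_heat_semigroup_lborel by (intro nn_integral_cong_AE) auto

lemma frac_heat_semigroup_add:
  assumes [measurable]: "\<psi> \<in> borel_measurable borel" "\<psi>' \<in> borel_measurable borel"
  shows "frac_heat_semigroup \<theta> t (\<lambda>y. \<psi> y + \<psi>' y) x = frac_heat_semigroup \<theta> t \<psi> x + frac_heat_semigroup \<theta> t \<psi>' x"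
  unfolding frac_heat_semigroup_lborel distrib_left by (rule nn_integral_add) measurable

lemma frac_heat_semigroup_cmult:
  assumes [measurable]: "\<psi> \<in> borel_measurable borel"
  shows "frac_heat_semigroup \<theta> t (\<lambda>y. c * \<psi> y) x = c * frac_heat_semigroup \<theta> t \<psi> x"
  unfolding frac_heat_semigroup_lborel by (subst nn_integral_cmult[symmetric]) (auto simp: mult_ac)

lemma frac_heat_semigroup_const:
  fixes x :: "'a::euclidean_space"
  assumes t: "0 < t" and \<theta>: "0 < \<theta>" "\<theta> \<le> 2"
  shows "frac_heat_semigroup \<theta> t (\<lambda>_. c) x = c"
proof -
  have "(\<integral>\<^sup>+y. ennreal (fund_sol \<theta> (x - y) t) \<partial>lborel) = 1"
    using nn_integral_lborel_affine[of "\<lambda>y::'a. ennreal (fund_sol \<theta> (x - y) t)" "-1" x]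
    by (simp add: fund_sol_mass[OF t \<theta>])
  then show ?thesis unfolding frac_heat_semigroup_lborel by (subst nn_integral_multc) auto
qed

lemma frac_heat_semigroup_semigroup:
  fixes x :: "'a::euclidean_space"
  assumes [measurable]: "\<psi> \<in> borel_measurable borel"
    and s: "0 < s" and t: "0 < t" and \<theta>: "0 < \<theta>" "\<theta> \<le> 2"
  shows "frac_heat_semigroup \<theta> t (frac_heat_semigroup \<theta> s \<psi>) x = frac_heat_semigroup \<theta> (s + t) \<psi> x"
proof -
  let ?G = "\<lambda>t x::'a. ennreal (fund_sol \<theta> x t)"
  have "frac_heat_semigroup \<theta> t (frac_heat_semigroup \<theta> s \<psi>) x
     = (\<integral>\<^sup>+y. \<integral>\<^sup>+z. ?G t (x - y) * (?G s (y - z) * \<psi> z) \<partial>lborel \<partial>lborel)"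
    unfolding frac_heat_semigroup_lborel by (subst nn_integral_cmult) auto
  also have "\<dots> = (\<integral>\<^sup>+z. \<integral>\<^sup>+y. ?G t (x - y) * (?G s (y - z) * \<psi> z) \<partial>lborel \<partial>lborel)"
    by (rule lborel_pair.Fubini') measurable
  also have "\<dots> = (\<integral>\<^sup>+z. ?G (s + t) (x - z) * \<psi> z \<partial>lborel)"
  proof (intro nn_integral_cong)
    fix z :: 'a
    have "(\<integral>\<^sup>+y. ?G t (x - y) * (?G s (y - z) * \<psi> z) \<partial>lborel) = (\<integral>\<^sup>+y. ?G t (x - y) * ?G s (y - z) \<partial>lborel) * \<psi> z"
      by (subst nn_integral_multc[symmetric]) (auto simp: mult_ac)
    also have "(\<integral>\<^sup>+y. ?G t (x - y) * ?G s (y - z) \<partial>lborel) = (\<integral>\<^sup>+w. ?G t ((x - z) - w) * ?G s w \<partial>lborel)"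
      by (subst nn_integral_lborel_affine[of _ 1 z]) (auto simp: diff_diff_eq)
    also have "\<dots> = ?G (s + t) (x - z)" by (rule fund_sol_convolution[OF s t \<theta>])
    finally show "(\<integral>\<^sup>+y. ?G t (x - y) * (?G s (y - z) * \<psi> z) \<partial>lborel) = ?G (s + t) (x - z) * \<psi> z" .
  qed
  finally show ?thesis unfolding frac_heat_semigroup_lborel .
qed

lemma frac_heat_semigroup_nn_integral:
  assumes [measurable]: "(\<lambda>(s, y). f s y) \<in> borel_measurable (borel \<Otimes>\<^sub>M borel)"
  shows "frac_heat_semigroup \<theta> t (\<lambda>y. \<integral>\<^sup>+s. f s y \<partial>lborel) x = (\<integral>\<^sup>+s. frac_heat_semigroup \<theta> t (f s) x \<partial>(lborel :: real measure))"
proof -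
  have "frac_heat_semigroup \<theta> t (\<lambda>y. \<integral>\<^sup>+s. f s y \<partial>lborel) x
     = (\<integral>\<^sup>+y. \<integral>\<^sup>+s. ennreal (fund_sol \<theta> (x - y) t) * f s y \<partial>lborel \<partial>lborel)"
    unfolding frac_heat_semigroup_lborel by (subst nn_integral_cmult) auto
  also have "\<dots> = (\<integral>\<^sup>+s. \<integral>\<^sup>+y. ennreal (fund_sol \<theta> (x - y) t) * f s y \<partial>lborel \<partial>lborel)"
    by (rule lborel_pair.Fubini') measurable
  finally show ?thesis unfolding frac_heat_semigroup_lborel .
qed

lemma frac_heat_semigroup_SUP:
  assumes [measurable]: "\<And>n. \<psi> n \<in> borel_measurable borel" and inc: "incseq \<psi>"
  shows "frac_heat_semigroup \<theta> t (\<lambda>y. SUP n. \<psi> n y) x = (SUP n. frac_heat_semigroup \<theta> t (\<psi> n) x)"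
proof -
  have "frac_heat_semigroup \<theta> t (\<lambda>y. SUP n. \<psi> n y) x = (\<integral>\<^sup>+y. (SUP n. ennreal (fund_sol \<theta> (x - y) t) * \<psi> n y) \<partial>lborel)"
    unfolding frac_heat_semigroup_lborel by (simp add: SUP_mult_left_ennreal)
  also have "\<dots> = (SUP n. frac_heat_semigroup \<theta> t (\<psi> n) x)"
    unfolding frac_heat_semigroup_lborel
    using inc by (intro nn_integral_monotone_convergence_SUP) (auto simp: incseq_def le_fun_def intro!: mult_left_mono)
  finally show ?thesis .
qed

text \<open>The ball of radius \<open>R\<close> centred at \<open>(1 - R / |z|) z\<close> lies in the ball of radius \<open>|z|\<close> about the origin,
  where the kernel is at least as large as at \<open>z\<close>, and inside the ball of radius \<open>2 R\<close> about \<open>z\<close>.\<close>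

lemma fund_sol_le_ball_average:
  fixes z :: "'a::euclidean_space"
  assumes t: "0 < t" and \<theta>: "0 < \<theta>" "\<theta> \<le> 2" and R: "0 < R" "R \<le> norm z"
  shows "ennreal (fund_sol \<theta> z t)
    \<le> ennreal (inverse (measure lborel (ball (0::'a) R))) * (\<integral>\<^sup>+w\<in>ball z (2 * R). ennreal (fund_sol \<theta> w t) \<partial>lborel)"
proof -
  define v where "v = unit_ball_vol (real DIM('a)) * R ^ DIM('a)"
  have v: "v > 0" unfolding v_def using R by simp
  have ev: "emeasure lborel (ball c R) = ennreal v" for c :: 'a
    unfolding v_def using R by (simp add: emeasure_ball)
  have mv: "measure lborel (ball (0::'a) R) = v" using ev[of 0] v by (simp add: measure_def)
  have z: "norm z > 0" using R by linarith
  define z' where "z' = (1 - R / norm z) *\<^sub>R z"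
  have nz': "norm z' = norm z - R" using z R by (simp add: z'_def field_simps)
  have "z' - z = - (R / norm z) *\<^sub>R z" by (simp add: z'_def algebra_simps)
  then have dz: "norm (z' - z) = R" using z R by simp
  have sub: "w \<in> ball z (2 * R)" "norm w \<le> norm z" if "w \<in> ball z' R" for w
  proof -
    have w: "norm (w - z') < R" using that by (simp add: dist_norm norm_minus_commute)
    show "w \<in> ball z (2 * R)"
      using norm_triangle_ineq[of "w - z'" "z' - z"] w dz by (simp add: dist_norm norm_minus_commute)
    show "norm w \<le> norm z" using norm_triangle_ineq[of "w - z'" z'] w nz' by simp
  qed
  have "ennreal v * ennreal (fund_sol \<theta> z t) = (\<integral>\<^sup>+w\<in>ball z' R. ennreal (fund_sol \<theta> z t) \<partial>lborel)"
    by (simp add: nn_integral_cmult_indicator ev mult.commute)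
  also have "\<dots> \<le> (\<integral>\<^sup>+w\<in>ball z (2 * R). ennreal (fund_sol \<theta> w t) \<partial>lborel)"
    using sub by (intro nn_integral_mono) (auto simp: indicator_def intro!: ennreal_leI fund_sol_antimono[OF t \<theta>])
  finally have "ennreal (inverse v) * (ennreal v * ennreal (fund_sol \<theta> z t))
     \<le> ennreal (inverse v) * (\<integral>\<^sup>+w\<in>ball z (2 * R). ennreal (fund_sol \<theta> w t) \<partial>lborel)"
    by (rule mult_left_mono) simp
  moreover have "ennreal (inverse v) * (ennreal v * ennreal (fund_sol \<theta> z t)) = ennreal (fund_sol \<theta> z t)"
    using v by (simp add: mult.assoc[symmetric] ennreal_mult[symmetric])
  ultimately show ?thesis unfolding mv by simp
qed

text \<open>Within distance \<open>\<rho>\<close> the kernel is bounded by its maximum; farther away it is bounded by its average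
  over balls of radius \<open>\<rho>\<close>, and after exchanging the integrals the average falls on \<open>\<psi>\<close>, leaving a
  kernel of mass one.\<close>

lemma frac_heat_semigroup_ul_bound:
  fixes x :: "'a::euclidean_space"
  assumes t: "0 < t" and \<theta>: "0 < \<theta>" "\<theta> \<le> 2" and \<rho>: "0 < \<rho>"
    and [measurable]: "\<psi> \<in> borel_measurable borel"
    and K: "\<And>y::'a. (\<integral>\<^sup>+z\<in>ball y \<rho>. \<psi> z \<partial>lborel) \<le> K"
  shows "frac_heat_semigroup \<theta> t \<psi> x
    \<le> ennreal (t powr (- real DIM('a) / \<theta>) * fund_sol \<theta> (0::'a) 1 + inverse (measure lborel (ball (0::'a) (\<rho> / 2)))) * K"
proof -
  define c where "c = t powr (- real DIM('a) / \<theta>) * fund_sol \<theta> (0::'a) 1"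
  define d where "d = inverse (measure lborel (ball (0::'a) (\<rho> / 2)))"
  let ?G = "\<lambda>x::'a. ennreal (fund_sol \<theta> x t)"
  have c0: "c \<ge> 0" unfolding c_def by (intro mult_nonneg_nonneg fund_sol_nonneg \<theta>) auto
  have d0: "d \<ge> 0" unfolding d_def by simp
  \<comment> \<open>The indicator of \<open>|y - (x - w)| < \<rho>\<close>, written so that it is visibly jointly measurable.\<close>
  define k where "k w y = (if dist (x - w) y < \<rho> then 1 else 0 :: ennreal)" for w y
  have k_ball: "k w y = indicator (ball (x - w) \<rho>) y" for w y by (simp add: k_def indicator_def)
  have [measurable]: "(\<lambda>z. k (fst z) (snd z)) \<in> borel_measurable (borel \<Otimes>\<^sub>M borel)" "(\<lambda>z. k (snd z) (fst z)) \<in> borel_measurable (borel \<Otimes>\<^sub>M borel)"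
    "k w \<in> borel_measurable borel" "(\<lambda>w. k w y) \<in> borel_measurable borel" for w y
    unfolding k_def by measurable
  have kK: "(\<integral>\<^sup>+y. k w y * \<psi> y \<partial>lborel) \<le> K" for w
    using K[of "x - w"] by (simp add: k_ball mult.commute)
  have pw: "?G (x - y) \<le> ennreal c * k 0 y + ennreal d * (\<integral>\<^sup>+w. ?G w * k w y \<partial>lborel)" for y
  proof (cases "y \<in> ball x \<rho>")
    case True
    then show ?thesis
      using fund_sol_le[OF t \<theta>, of "x - y"] by (simp add: c_def k_def add_increasing2 ennreal_leI)
  next
    case False
    have "?G (x - y) \<le> ennreal d * (\<integral>\<^sup>+w\<in>ball (x - y) (2 * (\<rho> / 2)). ?G w \<partial>lborel)"
      unfolding d_def using False \<rho> by (intro fund_sol_le_ball_average t \<theta>) (auto simp: dist_norm)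
    also have "(\<integral>\<^sup>+w\<in>ball (x - y) (2 * (\<rho> / 2)). ?G w \<partial>lborel) = (\<integral>\<^sup>+w. ?G w * k w y \<partial>lborel)"
      by (intro nn_integral_cong) (auto simp: k_def indicator_def dist_norm algebra_simps)
    finally show ?thesis by (simp add: add_increasing)
  qed
  have "frac_heat_semigroup \<theta> t \<psi> x
     \<le> (\<integral>\<^sup>+y. (ennreal c * k 0 y + ennreal d * (\<integral>\<^sup>+w. ?G w * k w y \<partial>lborel)) * \<psi> y \<partial>lborel)"
    unfolding frac_heat_semigroup_lborel by (intro nn_integral_mono mult_right_mono pw) auto
  also have "\<dots> = (\<integral>\<^sup>+y. ennreal c * (k 0 y * \<psi> y) + ennreal d * (\<integral>\<^sup>+w. ?G w * k w y * \<psi> y \<partial>lborel) \<partial>lborel)"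
  proof (intro nn_integral_cong)
    fix y
    have eq: "(\<integral>\<^sup>+w. ?G w * k w y * \<psi> y \<partial>lborel) = (\<integral>\<^sup>+w. ?G w * k w y \<partial>lborel) * \<psi> y"
      by (rule nn_integral_multc) measurable
    show "(ennreal c * k 0 y + ennreal d * (\<integral>\<^sup>+w. ?G w * k w y \<partial>lborel)) * \<psi> y
       = ennreal c * (k 0 y * \<psi> y) + ennreal d * (\<integral>\<^sup>+w. ?G w * k w y * \<psi> y \<partial>lborel)"
      unfolding eq distrib_right by (simp only: mult_ac)
  qed
  also have "\<dots> = (\<integral>\<^sup>+y. ennreal c * (k 0 y * \<psi> y) \<partial>lborel) + (\<integral>\<^sup>+y. ennreal d * (\<integral>\<^sup>+w. ?G w * k w y * \<psi> y \<partial>lborel) \<partial>lborel)"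
    by (rule nn_integral_add) measurable
  also have "(\<integral>\<^sup>+y. ennreal c * (k 0 y * \<psi> y) \<partial>lborel) = ennreal c * (\<integral>\<^sup>+y. k 0 y * \<psi> y \<partial>lborel)"
    by (rule nn_integral_cmult) measurable
  also have "(\<integral>\<^sup>+y. ennreal d * (\<integral>\<^sup>+w. ?G w * k w y * \<psi> y \<partial>lborel) \<partial>lborel)
     = ennreal d * (\<integral>\<^sup>+y. \<integral>\<^sup>+w. ?G w * k w y * \<psi> y \<partial>lborel \<partial>lborel)"
    by (rule nn_integral_cmult) measurable
  also have "(\<integral>\<^sup>+y. \<integral>\<^sup>+w. ?G w * k w y * \<psi> y \<partial>lborel \<partial>lborel) = (\<integral>\<^sup>+w. \<integral>\<^sup>+y. ?G w * k w y * \<psi> y \<partial>lborel \<partial>lborel)"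
    by (rule lborel_pair.Fubini') measurable
  also have "\<dots> = (\<integral>\<^sup>+w. ?G w * (\<integral>\<^sup>+y. k w y * \<psi> y \<partial>lborel) \<partial>lborel)"
    unfolding mult.assoc by (intro nn_integral_cong nn_integral_cmult) measurable
  also have "\<dots> \<le> (\<integral>\<^sup>+w. ?G w * K \<partial>lborel)"
    by (intro nn_integral_mono mult_left_mono kK) auto
  also have "\<dots> = K" by (subst nn_integral_multc) (auto simp: fund_sol_mass[OF t \<theta>])
  finally have "frac_heat_semigroup \<theta> t \<psi> x \<le> ennreal c * (\<integral>\<^sup>+y. k 0 y * \<psi> y \<partial>lborel) + ennreal d * K"
    by (simp add: add_mono mult_left_mono)
  also have "\<dots> \<le> ennreal c * K + ennreal d * K"
    by (intro add_mono mult_left_mono kK) auto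
  also have "\<dots> = ennreal (c + d) * K" using c0 d0 by (simp add: distrib_right)
  finally show ?thesis unfolding c_def d_def .
qed

section \<open>Existence below a supersolution\<close>

lemma frac_heat_semigroup_ge_1:
  fixes x :: "'a::euclidean_space"
  assumes "0 < t" "0 < \<theta>" "\<theta> \<le> 2" "\<And>y. 1 \<le> \<psi> y"
  shows "1 \<le> frac_heat_semigroup \<theta> t \<psi> x"
  using frac_heat_semigroup_mono[of "\<lambda>_. 1" \<psi> \<theta> t x] assms by (simp add: frac_heat_semigroup_const)

text \<open>Jensen's inequality for the logarithm: integrate against the kernel the tangent line of \<open>ln\<close> at the
  mean value \<open>c\<close>.  Adding \<open>1 / r\<close> on both sides keeps the inequality within the nonnegative reals.\<close>

lemma semigroup_jensen_log:
  fixes \<phi> :: "'a::euclidean_space \<Rightarrow> real"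
  assumes t: "0 < t" and \<theta>: "0 < \<theta>" "\<theta> \<le> 2"
    and [measurable]: "\<phi> \<in> borel_measurable borel" and \<phi>: "\<And>y. 0 \<le> \<phi> y" and r: "0 < r"
    and H: "frac_heat_semigroup \<theta> t (\<lambda>y. ennreal (exp (r * \<phi> y))) x = ennreal c" and c: "1 \<le> c"
  shows "frac_heat_semigroup \<theta> t (\<lambda>y. ennreal (\<phi> y)) x \<le> ennreal (ln c / r)"
proof -
  have pw: "ennreal (\<phi> y) + ennreal (1 / r) \<le> ennreal (ln c / r) + ennreal (1 / (r * c)) * ennreal (exp (r * \<phi> y))" for y
  proof -
    have "r * \<phi> y - ln c = ln (exp (r * \<phi> y) / c)" using c by (simp add: ln_div)
    also have "\<dots> \<le> exp (r * \<phi> y) / c - 1" using c by (intro ln_le_minus_one) simp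
    finally have "(r * \<phi> y - ln c) / r \<le> (exp (r * \<phi> y) / c - 1) / r" using r by (intro divide_right_mono) auto
    then have "\<phi> y + 1 / r \<le> ln c / r + 1 / (r * c) * exp (r * \<phi> y)"
      using r by (simp add: diff_divide_distrib mult.commute)
    then show ?thesis using r c \<phi>
      by (simp add: ennreal_plus[symmetric] ennreal_mult[symmetric] ennreal_leI del: ennreal_plus)
  qed
  have "frac_heat_semigroup \<theta> t (\<lambda>y. ennreal (\<phi> y)) x + ennreal (1 / r)
      = frac_heat_semigroup \<theta> t (\<lambda>y. ennreal (\<phi> y) + ennreal (1 / r)) x"
    by (subst frac_heat_semigroup_add) (auto simp: frac_heat_semigroup_const[OF t \<theta>])
  also have "\<dots> \<le> frac_heat_semigroup \<theta> t (\<lambda>y. ennreal (ln c / r) + ennreal (1 / (r * c)) * ennreal (exp (r * \<phi> y))) x"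
    by (intro frac_heat_semigroup_mono pw)
  also have "\<dots> = ennreal (ln c / r) + ennreal (1 / (r * c)) * ennreal c"
    by (subst frac_heat_semigroup_add, simp, simp, subst frac_heat_semigroup_cmult)
       (auto simp: frac_heat_semigroup_const[OF t \<theta>] H)
  also have "ennreal (1 / (r * c)) * ennreal c = ennreal (1 / r)"
    using r c by (subst ennreal_mult[symmetric]) auto
  finally show ?thesis by (simp add: add.commute[of _ "ennreal (1 / r)"] ennreal_add_left_cancel_le)
qed

text \<open>Jensen's inequality for a concave power, again by the tangent at the mean value.\<close>

lemma semigroup_jensen_power:
  fixes g :: "'a::euclidean_space \<Rightarrow> real"
  assumes t: "0 < t" and \<theta>: "0 < \<theta>" "\<theta> \<le> 2"
    and [measurable]: "g \<in> borel_measurable borel" and g: "\<And>y. 0 < g y" and p: "0 \<le> p" "p \<le> 1"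
    and H: "frac_heat_semigroup \<theta> t (\<lambda>y. ennreal (g y)) x = ennreal c" and c: "0 < c"
  shows "frac_heat_semigroup \<theta> t (\<lambda>y. ennreal (g y powr p)) x \<le> ennreal (c powr p)"
proof -
  have pw: "ennreal (g y powr p) \<le> ennreal ((1 - p) * c powr p) + ennreal (p * c powr p / c) * ennreal (g y)" for y
  proof -
    have "(g y / c) powr p * 1 powr (1 - p) \<le> p * (g y / c) + (1 - p) * 1"
      using g[of y] c p by (intro Youngs_inequality_0) auto
    then have "(g y / c) powr p * c powr p \<le> (p * (g y / c) + (1 - p)) * c powr p"
      by (intro mult_right_mono) auto
    then have "g y powr p \<le> (1 - p) * c powr p + p * c powr p / c * g y"
      using g[of y] c by (simp add: powr_divide algebra_simps)
    then show ?thesis using p c g[of y]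
      by (simp add: ennreal_plus[symmetric] ennreal_mult[symmetric] ennreal_leI del: ennreal_plus)
  qed
  have "frac_heat_semigroup \<theta> t (\<lambda>y. ennreal (g y powr p)) x
     \<le> frac_heat_semigroup \<theta> t (\<lambda>y. ennreal ((1 - p) * c powr p) + ennreal (p * c powr p / c) * ennreal (g y)) x"
    by (intro frac_heat_semigroup_mono pw)
  also have "\<dots> = ennreal ((1 - p) * c powr p) + ennreal (p * c powr p / c) * ennreal c"
    by (subst frac_heat_semigroup_add, simp, simp, subst frac_heat_semigroup_cmult)
       (auto simp: frac_heat_semigroup_const[OF t \<theta>] H)
  also have "\<dots> = ennreal (c powr p)"
    using p c by (simp add: ennreal_plus[symmetric] ennreal_mult[symmetric] algebra_simps del: ennreal_plus)
  finally show ?thesis .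
qed

text \<open>The iterates \<open>u\<^sub>0 = 0\<close>, \<open>u\<^sub>n\<^sub>+\<^sub>1 = F u\<^sub>n\<close> increase and stay below \<open>V\<close>, hence are finite, and monotone
  convergence passes to the limit in \<open>F\<close>.\<close>

lemma solution_from_supersolution:
  fixes \<phi> :: "'a::euclidean_space \<Rightarrow> real" and V :: "'a \<Rightarrow> real \<Rightarrow> real"
  assumes \<phi>_meas[measurable]: "\<phi> \<in> borel_measurable borel"
    and V: "\<And>x t. t \<in> {0<..<T} \<Longrightarrow>
        frac_heat_semigroup \<theta> t (\<lambda>y. ennreal (\<phi> y)) x
        + (\<integral>\<^sup>+s\<in>{0<..<t}. frac_heat_semigroup \<theta> (t - s) (\<lambda>y. ennreal (exp (V y s))) x \<partial>lborel) \<le> ennreal (V x t)"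
    and V0: "\<And>x t. t \<in> {0<..<T} \<Longrightarrow> 0 \<le> V x t"
  shows "\<exists>u. integral_solution \<theta> \<phi> T u"
proof -
  define F where "F v x t = frac_heat_semigroup \<theta> t (\<lambda>y. ennreal (\<phi> y)) x
        + (\<integral>\<^sup>+s\<in>{0<..<t}. frac_heat_semigroup \<theta> (t - s) (\<lambda>y. ennreal (exp (v y s))) x \<partial>lborel)" for v :: "'a \<Rightarrow> real \<Rightarrow> real" and x t
  have F_mono: "F v x t \<le> F w x t" if "t \<in> {0<..<T}" "\<And>y s. s \<in> {0<..<T} \<Longrightarrow> v y s \<le> w y s" for v w x t
    unfolding F_def using that
    by (intro add_left_mono nn_integral_mono)
       (auto simp: indicator_def intro!: frac_heat_semigroup_mono ennreal_leI)
  have F_meas: "(\<lambda>(x, t). F v x t) \<in> borel_measurable (borel \<Otimes>\<^sub>M borel)"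
    if [measurable]: "(\<lambda>(x, t). v x t) \<in> borel_measurable (borel \<Otimes>\<^sub>M borel)" for v
  proof -
    have eq: "F v x t = frac_heat_semigroup \<theta> t (\<lambda>y. ennreal (\<phi> y)) x
        + (\<integral>\<^sup>+s. frac_heat_semigroup \<theta> (t - s) (\<lambda>y. ennreal (exp (v y s))) x * (if 0 < s \<and> s < t then 1 else 0) \<partial>lborel)" for x t
      unfolding F_def by (intro arg_cong2[where f="(+)"] refl nn_integral_cong) (auto simp: indicator_def)
    show ?thesis unfolding eq by measurable
  qed
  define u where "u = rec_nat (\<lambda>_ _. 0) (\<lambda>_ v x t. enn2real (F v x t))"
  have u0: "u 0 = (\<lambda>_ _. 0)" and uS: "u (Suc n) = (\<lambda>x t. enn2real (F (u n) x t))" for n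
    by (auto simp: u_def)
  have u_meas[measurable]: "(\<lambda>(x, t). u n x t) \<in> borel_measurable (borel \<Otimes>\<^sub>M borel)" for n
  proof (induction n)
    case (Suc n)
    from F_meas[OF Suc] show ?case unfolding uS by measurable
  qed (simp add: u0)
  have uV: "u n x t \<le> V x t" if "t \<in> {0<..<T}" for n x t
    using that
  proof (induction n arbitrary: x t)
    case (Suc n)
    have "F (u n) x t \<le> ennreal (V x t)"
      using F_mono[OF Suc.prems, of "u n" V x] Suc.IH V[OF Suc.prems, of x]
      unfolding F_def[symmetric] by (metis order_trans)
    then show ?case unfolding uS using V0[OF Suc.prems, of x] by (simp add: enn2real_leI)
  qed (simp add: u0 V0)
  have F_fin: "F (u n) x t \<le> ennreal (V x t)" if t: "t \<in> {0<..<T}" for n x t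
    using F_mono[OF t, of "u n" V x] uV V[OF t, of x] unfolding F_def[symmetric] by (metis order_trans)
  have F_u: "F (u n) x t = ennreal (u (Suc n) x t)" if t: "t \<in> {0<..<T}" for n x t
    unfolding uS using F_fin[OF t, of n x] by (simp add: ennreal_enn2real_if) (metis ennreal_neq_top neq_top_trans)
  have u_nonneg: "0 \<le> u n x t" for n x t by (cases n) (auto simp: u0 uS)
  have u_step: "u n x t \<le> u (Suc n) x t" if "t \<in> {0<..<T}" for n x t
    using that
  proof (induction n arbitrary: x t)
    case 0
    then show ?case using u_nonneg[of "Suc 0" x t] by (simp add: u0)
  next
    case (Suc n)
    have "ennreal (u (Suc n) x t) \<le> ennreal (u (Suc (Suc n)) x t)"
      unfolding F_u[OF Suc.prems, symmetric] by (intro F_mono Suc)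
    then show ?case using u_nonneg[of "Suc (Suc n)" x t] by (simp add: ennreal_le_iff)
  qed
  have u_inc: "incseq (\<lambda>n. u n x t)" if "t \<in> {0<..<T}" for x t
    using u_step[OF that] by (intro incseq_SucI)
  define U where "U x t = (SUP n. ennreal (u n x t))" for x t
  define w where "w x t = enn2real (U x t)" for x t
  have U_meas[measurable]: "(\<lambda>(x, t). U x t) \<in> borel_measurable (borel \<Otimes>\<^sub>M borel)" unfolding U_def by measurable
  have w_meas[measurable]: "(\<lambda>(x, t). w x t) \<in> borel_measurable (borel \<Otimes>\<^sub>M borel)" unfolding w_def by measurable
  have U_fin: "U x t = ennreal (w x t)" if t: "t \<in> {0<..<T}" for x t
  proof -
    have "U x t \<le> ennreal (V x t)" unfolding U_def by (intro SUP_least ennreal_leI uV[OF t])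
    then show ?thesis unfolding w_def by (simp add: ennreal_enn2real_if) (metis ennreal_neq_top neq_top_trans)
  qed
  have exp_w: "ennreal (exp (w x t)) = (SUP n. ennreal (exp (u n x t)))" if t: "t \<in> {0<..<T}" for x t
  proof -
    have "(\<lambda>n. ennreal (u n x t)) \<longlonglongrightarrow> ennreal (w x t)"
      unfolding U_fin[OF t, symmetric] U_def using u_inc[OF t, of x]
      by (intro LIMSEQ_SUP) (auto simp: incseq_def intro!: ennreal_leI)
    then have "(\<lambda>n. u n x t) \<longlonglongrightarrow> w x t"
      by (subst (asm) tendsto_ennreal_iff) (auto simp: u_nonneg w_def)
    then have "(\<lambda>n. ennreal (exp (u n x t))) \<longlonglongrightarrow> ennreal (exp (w x t))"
      by (intro tendsto_ennrealI tendsto_exp)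
    moreover have "(\<lambda>n. ennreal (exp (u n x t))) \<longlonglongrightarrow> (SUP n. ennreal (exp (u n x t)))"
      using u_inc[OF t, of x] by (intro LIMSEQ_SUP) (auto simp: incseq_def intro!: ennreal_leI)
    ultimately show ?thesis by (rule LIMSEQ_unique)
  qed
  have sol: "ennreal (w x t) = F w x t" if t: "t \<in> {0<..<T}" for x t
  proof -
    let ?I = "\<lambda>n s. frac_heat_semigroup \<theta> (t - s) (\<lambda>y. ennreal (exp (u n y s))) x * indicator {0<..<t} s"
    have inn: "frac_heat_semigroup \<theta> (t - s) (\<lambda>y. ennreal (exp (w y s))) x * indicator {0<..<t} s = (SUP n. ?I n s)" for s
    proof (cases "s \<in> {0<..<t}")
      case True
      then have s: "s \<in> {0<..<T}" using t by auto
      have "frac_heat_semigroup \<theta> (t - s) (\<lambda>y. ennreal (exp (w y s))) x = (SUP n. frac_heat_semigroup \<theta> (t - s) (\<lambda>y. ennreal (exp (u n y s))) x)"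
        unfolding exp_w[OF s] using u_inc[OF s]
        by (intro frac_heat_semigroup_SUP) (auto simp: incseq_def le_fun_def intro!: ennreal_leI)
      then show ?thesis using True by simp
    qed simp
    have "F w x t = frac_heat_semigroup \<theta> t (\<lambda>y. ennreal (\<phi> y)) x + (\<integral>\<^sup>+s. (SUP n. ?I n s) \<partial>lborel)"
      unfolding F_def inn ..
    also have "(\<integral>\<^sup>+s. (SUP n. ?I n s) \<partial>lborel) = (SUP n. \<integral>\<^sup>+s. ?I n s \<partial>lborel)"
    proof (rule nn_integral_monotone_convergence_SUP)
      show "incseq ?I"
        unfolding incseq_def le_fun_def using t u_inc
        by (auto simp: indicator_def incseq_def intro!: frac_heat_semigroup_mono ennreal_leI)
    qed measurable
    also have "frac_heat_semigroup \<theta> t (\<lambda>y. ennreal (\<phi> y)) x + (SUP n. \<integral>\<^sup>+s. ?I n s \<partial>lborel) = (SUP n. F (u n) x t)"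
      unfolding F_def by (rule ennreal_SUP_add_right) simp
    also have "\<dots> = (SUP n. ennreal (u (Suc n) x t))" unfolding F_u[OF t] ..
    also have "\<dots> = U x t"
    proof (rule antisym)
      show "U x t \<le> (SUP n. ennreal (u (Suc n) x t))"
        unfolding U_def by (intro SUP_mono) (auto intro!: ennreal_leI u_step[OF t])
    qed (auto simp: U_def intro!: SUP_mono)
    finally show ?thesis unfolding U_fin[OF t] ..
  qed
  have "integral_solution \<theta> \<phi> T w"
    unfolding integral_solution_def
  proof (intro conjI allI ballI)
    have "(\<lambda>(x, t). w x t) \<in> borel_measurable borel" using w_meas unfolding borel_prod .
    then show "(\<lambda>(x, t). w x t) \<in> borel_measurable (lebesgue_on (UNIV \<times> {0<..<T}))"
      by (intro measurable_restrict_space1 measurable_completion) simp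
    show "0 \<le> w x t" for x t by (simp add: w_def)
    fix t assume t: "t \<in> {0<..<T}"
    show "AE x in lebesgue. ennreal (w x t) = frac_heat_semigroup \<theta> t (\<lambda>y. ennreal (\<phi> y)) x +
        (\<integral>\<^sup>+s\<in>{0<..<t}. frac_heat_semigroup \<theta> (t - s) (\<lambda>y. ennreal (exp (w y s))) x \<partial>lebesgue)"
      using sol[OF t] unfolding F_def nn_integral_completion by simp
  qed
  then show ?thesis by blast
qed

lemma nn_integral_powr_0:
  fixes a t :: real
  assumes "-1 < a" "0 < t"
  shows "(\<integral>\<^sup>+s\<in>{0<..<t}. ennreal (s powr a) \<partial>lborel) = ennreal (t powr (a + 1) / (a + 1))"
proof -
  have "((\<lambda>s. s powr a) has_integral (t powr (a + 1) / (a + 1))) {0..t}"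
    using assms by (intro has_integral_powr_from_0) auto
  then have "(\<integral>\<^sup>+s\<in>{0..t}. ennreal (s powr a) \<partial>lborel) = ennreal (t powr (a + 1) / (a + 1))"
    using nn_integral_has_integral_lebesgue[of "{0..t}" "\<lambda>s. s powr a"]
    by (simp add: ennreal_mult' ennreal_indicator mult.commute)
  moreover have "(\<integral>\<^sup>+s\<in>{0<..<t}. ennreal (s powr a) \<partial>lborel) = (\<integral>\<^sup>+s\<in>{0..t}. ennreal (s powr a) \<partial>lborel)"
    using AE_lborel_singleton[of "0::real"] AE_lborel_singleton[of t]
    by (intro nn_integral_cong_AE, eventually_elim) (auto simp: indicator_def)
  ultimately show ?thesis by simp
qed

text \<open>With \<open>p = 1 / r\<close>, the Duhamel term integrates \<open>e S(t - s) h(s)\<^sup>p\<close>.  The pointwise bound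
  \<open>h(s)\<^sup>p \<le> \<epsilon>\<^sup>p / s\<close> alone would make the time integral diverge logarithmically, so the semigroup law
  \<open>S(t - s) h(s) = h(t)\<close> is used first.  For \<open>p \<le> 1\<close>, Jensen's inequality gives \<open>S(t - s) h(s)\<^sup>p \<le> h(t)\<^sup>p\<close>,
  which does not depend on \<open>s\<close>.  For \<open>p > 1\<close>, one factor \<open>h(s)\<close> is kept for the semigroup law and the
  remaining power \<open>h(s)\<^sup>p\<^sup>-\<^sup>1\<close> is bounded by \<open>\<epsilon>\<^sup>p\<^sup>-\<^sup>1 s\<^sup>r\<^sup>-\<^sup>1\<close>, which is integrable at \<open>0\<close>.\<close>

lemma nonlinear_term_le_1:
  fixes \<phi> :: "'a::euclidean_space \<Rightarrow> real"
  assumes \<theta>: "0 < \<theta>" "\<theta> \<le> 2" and \<phi>_meas[measurable]: "\<phi> \<in> borel_measurable borel"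
    and r: "0 < r" and \<epsilon>: "0 < \<epsilon>" "\<epsilon> powr (1 / r) * exp 1 \<le> min 1 r"
    and h: "\<And>x t. t \<in> {0<..<T} \<Longrightarrow> frac_heat_semigroup \<theta> t (\<lambda>y. ennreal (exp (r * \<phi> y))) x = ennreal (h x t)"
    and h1: "\<And>x t. t \<in> {0<..<T} \<Longrightarrow> 1 \<le> h x t"
    and h\<epsilon>: "\<And>x t. t \<in> {0<..<T} \<Longrightarrow> h x t \<le> \<epsilon> * t powr (- r)"
    and t: "t \<in> {0<..<T}"
  shows "(\<integral>\<^sup>+s\<in>{0<..<t}. frac_heat_semigroup \<theta> (t - s) (\<lambda>y. ennreal (exp (ln (h y s) / r + 1))) x \<partial>lborel) \<le> 1"
proof -
  define p where "p = 1 / r"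
  have p: "p > 0" and rp: "r * p = 1" using r by (auto simp: p_def)
  have t0: "t > 0" using t by simp
  have ev: "exp (ln (h y s) / r + 1) = exp 1 * h y s powr p" if "s \<in> {0<..<T}" for y s
    using h1[OF that, of y] by (simp add: exp_add powr_def p_def)
  have h_meas: "(\<lambda>y. h y s) \<in> borel_measurable borel" if s: "s \<in> {0<..<T}" for s
  proof -
    have "(\<lambda>y. h y s) = (\<lambda>y. enn2real (frac_heat_semigroup \<theta> s (\<lambda>y. ennreal (exp (r * \<phi> y))) y))"
      unfolding h[OF s] using h1[OF s] by (auto simp: order_trans[OF zero_le_one])
    then show ?thesis by simp
  qed
  have Sh: "frac_heat_semigroup \<theta> (t - s) (\<lambda>y. ennreal (h y s)) x = ennreal (h x t)" if s: "s \<in> {0<..<t}" for s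
  proof -
    have sT: "s \<in> {0<..<T}" using s t by auto
    have "frac_heat_semigroup \<theta> (t - s) (frac_heat_semigroup \<theta> s (\<lambda>y. ennreal (exp (r * \<phi> y)))) x
       = frac_heat_semigroup \<theta> (s + (t - s)) (\<lambda>y. ennreal (exp (r * \<phi> y))) x"
      using s by (intro frac_heat_semigroup_semigroup \<theta>) auto
    then show ?thesis using h[OF t] by (simp add: h[OF sT, abs_def] )
  qed
  have powr_\<epsilon>: "(\<epsilon> * s powr (- r)) powr q = \<epsilon> powr q * s powr (- r * q)" if "s > 0" for s q
    using \<epsilon> that by (simp add: powr_mult powr_powr)
  show ?thesis
  proof (cases "1 \<le> r")
    case True
    then have p1: "p \<le> 1" by (simp add: p_def)
    have "(\<integral>\<^sup>+s\<in>{0<..<t}. frac_heat_semigroup \<theta> (t - s) (\<lambda>y. ennreal (exp (ln (h y s) / r + 1))) x \<partial>lborel)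
       \<le> (\<integral>\<^sup>+s. ennreal (1 / t) * indicator {0<..<t} s \<partial>lborel)"
    proof (intro nn_integral_mono)
      fix s
      have "frac_heat_semigroup \<theta> (t - s) (\<lambda>y. ennreal (exp (ln (h y s) / r + 1))) x \<le> ennreal (1 / t)" if s: "s \<in> {0<..<t}"
      proof -
        have sT: "s \<in> {0<..<T}" using s t by auto
        note [measurable] = h_meas[OF sT]
        have "frac_heat_semigroup \<theta> (t - s) (\<lambda>y. ennreal (exp (ln (h y s) / r + 1))) x
          = ennreal (exp 1) * frac_heat_semigroup \<theta> (t - s) (\<lambda>y. ennreal (h y s powr p)) x"
          unfolding ev[OF sT] by (subst frac_heat_semigroup_cmult[symmetric]) (auto simp: ennreal_mult)
        also have "\<dots> \<le> ennreal (exp 1) * ennreal (h x t powr p)"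
          using s p p1 h1[OF sT] h1[OF t, of x]
          by (intro mult_left_mono semigroup_jensen_power \<theta> Sh) (auto intro: order.strict_trans2[OF zero_less_one])
        also have "\<dots> = ennreal (exp 1 * h x t powr p)" by (simp add: ennreal_mult)
        also have "\<dots> \<le> ennreal (1 / t)"
        proof (rule ennreal_leI)
          have "h x t powr p \<le> (\<epsilon> * t powr (- r)) powr p"
            using h\<epsilon>[OF t, of x] h1[OF t, of x] p by (intro powr_mono2) auto
          also have "\<dots> = \<epsilon> powr p * t powr (- 1)" using powr_\<epsilon>[OF t0, of p] rp by simp
          also have "\<dots> = \<epsilon> powr p / t" using t0 by (simp add: powr_minus_divide)
          finally have "exp 1 * h x t powr p \<le> exp 1 * (\<epsilon> powr p / t)" by (rule mult_left_mono) simp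
          also have "\<dots> \<le> 1 / t" using \<epsilon> t0 by (simp add: p_def divide_right_mono mult.commute)
          finally show "exp 1 * h x t powr p \<le> 1 / t" .
        qed
        finally show ?thesis .
      qed
      then show "frac_heat_semigroup \<theta> (t - s) (\<lambda>y. ennreal (exp (ln (h y s) / r + 1))) x * indicator {0<..<t} s
         \<le> ennreal (1 / t) * indicator {0<..<t} s"
        by (auto simp: indicator_def)
    qed
    also have "\<dots> = 1" using t0 by (simp add: nn_integral_cmult_indicator ennreal_mult[symmetric])
    finally show ?thesis .
  next
    case False
    then have p1: "p \<ge> 1" using r by (simp add: p_def)
    define C where "C = exp 1 * \<epsilon> powr p * t powr (- r)"
    have C0: "C \<ge> 0" unfolding C_def by simp
    have "(\<integral>\<^sup>+s\<in>{0<..<t}. frac_heat_semigroup \<theta> (t - s) (\<lambda>y. ennreal (exp (ln (h y s) / r + 1))) x \<partial>lborel)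
       \<le> (\<integral>\<^sup>+s. ennreal C * (ennreal (s powr (r - 1)) * indicator {0<..<t} s) \<partial>lborel)"
    proof (intro nn_integral_mono)
      fix s
      have "frac_heat_semigroup \<theta> (t - s) (\<lambda>y. ennreal (exp (ln (h y s) / r + 1))) x \<le> ennreal C * ennreal (s powr (r - 1))" if s: "s \<in> {0<..<t}"
      proof -
        have sT: "s \<in> {0<..<T}" and s0: "s > 0" using s t by auto
        note [measurable] = h_meas[OF sT]
        define D where "D = exp 1 * (\<epsilon> powr (p - 1) * s powr (r - 1))"
        have e: "- r * (p - 1) = r - 1" using rp by (simp add: algebra_simps)
        have pw: "exp 1 * h y s powr p \<le> D * h y s" for y
        proof -
          have h0: "h y s > 0" using h1[OF sT, of y] by simp
          have "h y s powr (p - 1) \<le> (\<epsilon> * s powr (- r)) powr (p - 1)"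
            using h\<epsilon>[OF sT, of y] h0 p1 by (intro powr_mono2) auto
          also have "\<dots> = \<epsilon> powr (p - 1) * s powr (r - 1)" using powr_\<epsilon>[OF s0, of "p - 1"] e by simp
          finally have "exp 1 * h y s powr (p - 1) * h y s \<le> D * h y s"
            unfolding D_def using h0 by (intro mult_right_mono mult_left_mono) auto
          moreover have "h y s powr p = h y s powr (p - 1) * h y s" using h0 powr_add[of "h y s" "p - 1" 1] by simp
          ultimately show ?thesis by (simp add: mult_ac)
        qed
        have D0: "D \<ge> 0" by (simp add: D_def)
        have "frac_heat_semigroup \<theta> (t - s) (\<lambda>y. ennreal (exp (ln (h y s) / r + 1))) x
           \<le> frac_heat_semigroup \<theta> (t - s) (\<lambda>y. ennreal D * ennreal (h y s)) x"
          unfolding ev[OF sT] using pw D0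
          by (intro frac_heat_semigroup_mono) (auto simp: ennreal_mult'[symmetric] intro!: ennreal_leI)
        also have "\<dots> = ennreal D * ennreal (h x t)" by (simp add: frac_heat_semigroup_cmult Sh[OF s])
        also have "\<dots> = ennreal (D * h x t)" using D0 by (simp add: ennreal_mult')
        also have "\<dots> \<le> ennreal (C * s powr (r - 1))"
        proof (rule ennreal_leI)
          have "D * h x t \<le> D * (\<epsilon> * t powr (- r))" using h\<epsilon>[OF t, of x] D0 by (intro mult_left_mono) auto
          also have "\<dots> = C * s powr (r - 1)"
            unfolding D_def C_def using \<epsilon> powr_add[of \<epsilon> "p - 1" 1] by simp
          finally show "D * h x t \<le> C * s powr (r - 1)" .
        qed
        finally show ?thesis using C0 by (simp add: ennreal_mult')
      qed
      then show "frac_heat_semigroup \<theta> (t - s) (\<lambda>y. ennreal (exp (ln (h y s) / r + 1))) x * indicator {0<..<t} s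
         \<le> ennreal C * (ennreal (s powr (r - 1)) * indicator {0<..<t} s)"
        by (auto simp: indicator_def)
    qed
    also have "\<dots> = ennreal C * (\<integral>\<^sup>+s\<in>{0<..<t}. ennreal (s powr (r - 1)) \<partial>lborel)"
      by (rule nn_integral_cmult) measurable
    also have "\<dots> = ennreal (C * (t powr r / r))"
      using r t0 C0 by (subst nn_integral_powr_0) (auto simp: ennreal_mult'[symmetric])
    also have "C * (t powr r / r) = exp 1 * \<epsilon> powr p / r"
      unfolding C_def using t0 by (simp add: powr_minus_divide)
    also have "ennreal (exp 1 * \<epsilon> powr p / r) \<le> 1" using \<epsilon> r False by (simp add: p_def mult.commute)
    finally show ?thesis .
  qed
qed

lemma local_existence:
  fixes \<phi> :: "'a::euclidean_space \<Rightarrow> real"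
  assumes \<theta>: "0 < \<theta>" "\<theta> \<le> 2" and \<phi>_meas[measurable]: "\<phi> \<in> borel_measurable borel" and \<phi>: "\<And>y. 0 \<le> \<phi> y"
    and r: "0 < r"
    and small: "\<And>\<epsilon>. 0 < \<epsilon> \<Longrightarrow> \<exists>T>0. \<forall>t\<in>{0<..<T}. \<forall>x. frac_heat_semigroup \<theta> t (\<lambda>y. ennreal (exp (r * \<phi> y))) x \<le> ennreal (\<epsilon> * t powr (- r))"
  shows "has_local_solution \<theta> \<phi>"
proof -
  \<comment> \<open>The largest \<open>\<epsilon>\<close> with \<open>e \<epsilon>\<^sup>1\<^sup>/\<^sup>r \<le> min 1 r\<close>; the factor \<open>e\<close> stems from the summand \<open>1\<close> in \<open>V\<close>, the bound \<open>r\<close> from \<open>\<integral>\<^sub>0\<^sup>t s\<^sup>r\<^sup>-\<^sup>1 ds = t\<^sup>r / r\<close>.\<close>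
  define \<epsilon> where "\<epsilon> = (min 1 r / exp 1) powr r"
  have \<epsilon>: "\<epsilon> > 0" "\<epsilon> powr (1 / r) * exp 1 \<le> min 1 r"
    using r by (auto simp: \<epsilon>_def powr_powr)
  obtain T where T: "T > 0" and bound: "\<And>t x. t \<in> {0<..<T} \<Longrightarrow> frac_heat_semigroup \<theta> t (\<lambda>y. ennreal (exp (r * \<phi> y))) x \<le> ennreal (\<epsilon> * t powr (- r))"
    using small[OF \<epsilon>(1)] by blast
  define h where "h x t = enn2real (frac_heat_semigroup \<theta> t (\<lambda>y. ennreal (exp (r * \<phi> y))) x)" for x t
  have h: "frac_heat_semigroup \<theta> t (\<lambda>y. ennreal (exp (r * \<phi> y))) x = ennreal (h x t)" if "t \<in> {0<..<T}" for x t
    unfolding h_def using bound[OF that, of x] by (simp add: ennreal_enn2real_if) (metis ennreal_neq_top neq_top_trans)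
  have h1: "1 \<le> h x t" if t: "t \<in> {0<..<T}" for x t
  proof -
    have "1 \<le> ennreal (h x t)"
      unfolding h[OF t, symmetric] using t r \<phi> by (intro frac_heat_semigroup_ge_1 \<theta>) (auto simp: one_le_exp_iff)
    then show ?thesis by simp
  qed
  have h\<epsilon>: "h x t \<le> \<epsilon> * t powr (- r)" if t: "t \<in> {0<..<T}" for x t
    using bound[OF t, of x] \<epsilon> unfolding h[OF t] by (simp add: ennreal_le_iff)
  define V where "V x t = ln (h x t) / r + 1" for x t
  have V0: "0 \<le> ln (h x t) / r" if "t \<in> {0<..<T}" for x t using h1[OF that, of x] r by simp
  have "\<exists>u. integral_solution \<theta> \<phi> T u"
  proof (rule solution_from_supersolution[OF \<phi>_meas, where V=V])
    fix x t assume t: "t \<in> {0<..<T}"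
    show "0 \<le> V x t" using V0[OF t, of x] by (simp add: V_def)
    have "frac_heat_semigroup \<theta> t (\<lambda>y. ennreal (\<phi> y)) x \<le> ennreal (ln (h x t) / r)"
      using t r \<phi> h1[OF t, of x] by (intro semigroup_jensen_log \<theta> h) auto
    moreover have "(\<integral>\<^sup>+s\<in>{0<..<t}. frac_heat_semigroup \<theta> (t - s) (\<lambda>y. ennreal (exp (V y s))) x \<partial>lborel) \<le> 1"
      unfolding V_def using h h1 h\<epsilon> t by (intro nonlinear_term_le_1[OF \<theta> \<phi>_meas r \<epsilon>]) auto
    ultimately show "frac_heat_semigroup \<theta> t (\<lambda>y. ennreal (\<phi> y)) x
        + (\<integral>\<^sup>+s\<in>{0<..<t}. frac_heat_semigroup \<theta> (t - s) (\<lambda>y. ennreal (exp (V y s))) x \<partial>lborel) \<le> ennreal (V x t)"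
      unfolding V_def using V0[OF t, of x] by (simp add: add_mono)
  qed
  then show ?thesis unfolding has_local_solution_def using T by blast
qed

section \<open>Smallness from uniformly local integrability\<close>

lemma has_local_solution_cong_AE:
  fixes \<phi> \<phi>' :: "'a::euclidean_space \<Rightarrow> real"
  assumes ae: "AE x in lborel. \<phi> x = \<phi>' x" and sol: "has_local_solution \<theta> \<phi>"
  shows "has_local_solution \<theta> \<phi>'"
proof -
  have "frac_heat_semigroup \<theta> t (\<lambda>y. ennreal (\<phi> y)) = frac_heat_semigroup \<theta> t (\<lambda>y. ennreal (\<phi>' y))" for t
    using ae by (intro ext frac_heat_semigroup_cong_AE) auto
  then show ?thesis using sol unfolding has_local_solution_def integral_solution_def by simp
qed

lemma ball_integral_le_ul_norm:
  fixes g :: "'a::euclidean_space \<Rightarrow> real"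
  assumes "AE x in lborel. g x = g' x"
  shows "(\<integral>\<^sup>+z\<in>ball y \<rho>. ennreal \<bar>g' z\<bar> \<partial>lborel) \<le> ul_norm \<rho> g"
proof -
  have "(\<integral>\<^sup>+z\<in>ball y \<rho>. ennreal \<bar>g' z\<bar> \<partial>lborel) = (\<integral>\<^sup>+z\<in>ball y \<rho>. ennreal \<bar>g z\<bar> \<partial>lborel)"
    using assms by (intro nn_integral_cong_AE) auto
  also have "\<dots> \<le> ul_norm \<rho> g"
    unfolding ul_norm_def nn_integral_completion by (rule SUP_upper) simp
  finally show ?thesis .
qed

text \<open>The bounded part of \<open>e\<^sup>r\<^sup>\<phi>\<close> contributes a constant to \<open>S(t) e\<^sup>r\<^sup>\<phi>\<close> and the small part at most
  \<open>C \<epsilon> t\<^sup>-\<^sup>r\<close>; the constant is negligible against \<open>t\<^sup>-\<^sup>r\<close> for small \<open>t\<close>.\<close>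

lemma local_existence_ul:
  fixes \<phi> :: "'a::euclidean_space \<Rightarrow> real"
  assumes \<theta>: "0 < \<theta>" "\<theta> \<le> 2" and \<rho>: "0 < \<rho>"
    and \<phi>: "\<phi> \<in> borel_measurable lebesgue" "\<And>x. 0 \<le> \<phi> x" and r: "r = real DIM('a) / \<theta>"
    and split: "\<And>\<epsilon>. 0 < \<epsilon> \<Longrightarrow> \<exists>M g. g \<in> borel_measurable lebesgue \<and> (\<forall>x. exp (r * \<phi> x) \<le> M + \<bar>g x\<bar>) \<and> ul_norm \<rho> g \<le> ennreal \<epsilon>"
  shows "has_local_solution \<theta> \<phi>"
proof -
  have r0: "r > 0" using \<theta> by (simp add: r)
  obtain \<phi>0 where \<phi>0[measurable]: "\<phi>0 \<in> borel_measurable lborel" and ae0: "AE x in lborel. \<phi> x = \<phi>0 x"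
    using completion_ex_borel_measurable_real[OF \<phi>(1)] by blast
  define \<phi>' where "\<phi>' x = max 0 (\<phi>0 x)" for x
  have [measurable]: "\<phi>' \<in> borel_measurable borel" using \<phi>0 unfolding \<phi>'_def by simp
  have ae: "AE x in lborel. \<phi>' x = \<phi> x"
    using ae0
  proof eventually_elim
    case (elim x)
    then show ?case using \<phi>(2)[of x] by (simp add: \<phi>'_def)
  qed
  have "has_local_solution \<theta> \<phi>'"
  proof (rule local_existence[OF \<theta> _ _ r0])
    fix \<epsilon> :: real assume \<epsilon>: "0 < \<epsilon>"
    define G0 where "G0 = fund_sol \<theta> (0::'a) 1"
    have G0: "G0 \<ge> 0" unfolding G0_def by (intro fund_sol_nonneg \<theta>) simp
    define d where "d = inverse (measure lborel (ball (0::'a) (\<rho> / 2)))"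
    have d: "d \<ge> 0" by (simp add: d_def)
    \<comment> \<open>Half of \<open>\<epsilon> t\<^sup>-\<^sup>r\<close> is reserved for the small part, the other half for the constant \<open>m\<close>.\<close>
    define \<delta> where "\<delta> = \<epsilon> / (2 * (G0 + 1))"
    have \<delta>: "\<delta> > 0" "G0 * \<delta> \<le> \<epsilon> / 2" using \<epsilon> G0 by (auto simp: \<delta>_def field_simps)
    obtain M g where g: "g \<in> borel_measurable lebesgue" and Mg: "\<And>x. exp (r * \<phi> x) \<le> M + \<bar>g x\<bar>" and ul: "ul_norm \<rho> g \<le> ennreal \<delta>"
      using split[OF \<delta>(1)] by blast
    obtain g' where g'[measurable]: "g' \<in> borel_measurable lborel" and aeg: "AE x in lborel. g x = g' x"
      using completion_ex_borel_measurable_real[OF g] by blast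
    have [measurable]: "g' \<in> borel_measurable borel" using g' by simp
    define m where "m = max M 0 + d * \<delta>"
    have m: "m \<ge> 0" using d \<delta> by (simp add: m_def)
    define T where "T = (\<epsilon> / (2 * (m + 1))) powr (1 / r)"
    have T: "T > 0" using \<epsilon> m by (simp add: T_def)
    have Tr: "T powr r = \<epsilon> / (2 * (m + 1))" unfolding T_def powr_powr using r0 \<epsilon> m by simp
    have "frac_heat_semigroup \<theta> t (\<lambda>y. ennreal (exp (r * \<phi>' y))) x \<le> ennreal (\<epsilon> * t powr (- r))" if t: "t \<in> {0<..<T}" for t x
    proof -
      have t0: "t > 0" using t by simp
      have mt: "m \<le> \<epsilon> / 2 * t powr (- r)"
      proof -
        have "t powr r \<le> \<epsilon> / (2 * (m + 1))" unfolding Tr[symmetric] using t r0 by (intro powr_mono2) auto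
        then have "(m + 1) * t powr r \<le> \<epsilon> / 2" using m by (simp add: field_simps)
        then have "m * t powr r \<le> \<epsilon> / 2" by (simp add: algebra_simps) (smt (verit) powr_ge_zero)
        then show ?thesis using t0 by (simp add: powr_minus field_simps)
      qed
      have "frac_heat_semigroup \<theta> t (\<lambda>y. ennreal (exp (r * \<phi>' y))) x
         \<le> frac_heat_semigroup \<theta> t (\<lambda>y. ennreal (max M 0) + ennreal \<bar>g' y\<bar>) x"
      proof (rule frac_heat_semigroup_mono_AE)
        show "AE y in lborel. ennreal (exp (r * \<phi>' y)) \<le> ennreal (max M 0) + ennreal \<bar>g' y\<bar>"
          using ae aeg
        proof eventually_elim
          case (elim y)
          then have "exp (r * \<phi>' y) \<le> max M 0 + \<bar>g' y\<bar>" using Mg[of y] by simp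
          then show ?case by (simp add: ennreal_leI del: ennreal_plus flip: ennreal_plus)
        qed
      qed
      also have "\<dots> = ennreal (max M 0) + frac_heat_semigroup \<theta> t (\<lambda>y. ennreal \<bar>g' y\<bar>) x"
        by (subst frac_heat_semigroup_add) (auto simp: frac_heat_semigroup_const[OF t0 \<theta>])
      also have "\<dots> \<le> ennreal (max M 0) + ennreal (t powr (- r) * G0 + d) * ennreal \<delta>"
      proof (intro add_left_mono)
        have "t powr (- real DIM('a) / \<theta>) = t powr (- r)" by (simp add: r)
        then show "frac_heat_semigroup \<theta> t (\<lambda>y. ennreal \<bar>g' y\<bar>) x \<le> ennreal (t powr (- r) * G0 + d) * ennreal \<delta>"
          using frac_heat_semigroup_ul_bound[OF t0 \<theta> \<rho>, of "\<lambda>y. ennreal \<bar>g' y\<bar>" "ennreal \<delta>" x]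
            order_trans[OF ball_integral_le_ul_norm[OF aeg] ul]
          unfolding G0_def d_def by simp
      qed
      also have "\<dots> = ennreal (max M 0 + (t powr (- r) * G0 + d) * \<delta>)"
        using G0 d \<delta> by (simp add: ennreal_mult[symmetric] ennreal_plus[symmetric] del: ennreal_plus)
      also have "\<dots> \<le> ennreal (\<epsilon> * t powr (- r))"
      proof (rule ennreal_leI)
        have "max M 0 + (t powr (- r) * G0 + d) * \<delta> = m + t powr (- r) * (G0 * \<delta>)"
          by (simp add: m_def algebra_simps)
        also have "\<dots> \<le> \<epsilon> / 2 * t powr (- r) + t powr (- r) * (\<epsilon> / 2)"
          using \<delta> by (intro add_mono mt mult_left_mono) auto
        finally show "max M 0 + (t powr (- r) * G0 + d) * \<delta> \<le> \<epsilon> * t powr (- r)" by (simp add: field_simps)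
      qed
      finally show ?thesis .
    qed
    then show "\<exists>T>0. \<forall>t\<in>{0<..<T}. \<forall>x. frac_heat_semigroup \<theta> t (\<lambda>y. ennreal (exp (r * \<phi>' y))) x \<le> ennreal (\<epsilon> * t powr (- r))"
      using T by blast
  qed (auto simp: \<phi>'_def)
  then show ?thesis using has_local_solution_cong_AE[OF ae] by blast
qed

text \<open>For \<open>q = N / \<theta> < r\<close> the part of \<open>e\<^sup>q\<^sup>\<phi>\<close> where \<open>\<phi> > L\<close> is at most \<open>exp (- (r - q) L) e\<^sup>r\<^sup>\<phi>\<close>, which is small in
  norm for large \<open>L\<close>.\<close>

lemma local_existence_supercritical:
  fixes \<phi> :: "'a::euclidean_space \<Rightarrow> real"
  assumes \<theta>: "0 < \<theta>" "\<theta> \<le> 2" and \<rho>: "0 < \<rho>"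
    and \<phi>: "\<phi> \<in> borel_measurable lebesgue" "\<And>x. 0 \<le> \<phi> x" and r: "r > real DIM('a) / \<theta>"
    and ul: "(\<lambda>x. exp (r * \<phi> x)) \<in> L1_ul \<rho>"
  shows "has_local_solution \<theta> \<phi>"
proof (rule local_existence_ul[OF \<theta> \<rho> \<phi> refl])
  fix \<epsilon> :: real assume \<epsilon>: "0 < \<epsilon>"
  define q where "q = real DIM('a) / \<theta>"
  have q: "q < r" using r by (simp add: q_def)
  have "ul_norm \<rho> (\<lambda>x. exp (r * \<phi> x)) < \<infinity>" using ul by (simp add: L1_ul_def)
  then obtain K where K: "ul_norm \<rho> (\<lambda>x. exp (r * \<phi> x)) = ennreal K" "K \<ge> 0"
    by (cases "ul_norm \<rho> (\<lambda>x. exp (r * \<phi> x))") auto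
  define c where "c = \<epsilon> / (K + 1)"
  have c: "c > 0" "c * K \<le> \<epsilon>" using \<epsilon> K(2) by (auto simp: c_def field_simps)
  define L where "L = - ln c / (r - q)"
  have "- (r - q) * L = ln c" using q by (simp add: L_def field_simps)
  then have cL: "c = exp (- (r - q) * L)" using c by simp
  have "exp (q * \<phi> x) \<le> exp (q * L) + \<bar>c * exp (r * \<phi> x)\<bar>" for x
  proof (cases "\<phi> x \<le> L")
    case True
    then have "exp (q * \<phi> x) \<le> exp (q * L)" using \<theta> by (simp add: q_def mult_left_mono divide_right_mono)
    then show ?thesis by (simp add: add_increasing2)
  next
    case False
    have "(r - q) * L \<le> (r - q) * \<phi> x" using False q by (intro mult_left_mono) auto
    then have "exp (q * \<phi> x) \<le> exp (- (r - q) * L + r * \<phi> x)" by (simp add: algebra_simps)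
    then show ?thesis unfolding exp_add cL[symmetric] using c by (simp add: add_increasing)
  qed
  moreover have "ul_norm \<rho> (\<lambda>x. c * exp (r * \<phi> x)) \<le> ennreal \<epsilon>"
    unfolding ul_norm_def
  proof (rule SUP_least)
    fix y :: 'a
    have "(\<integral>\<^sup>+x\<in>ball y \<rho>. ennreal \<bar>c * exp (r * \<phi> x)\<bar> \<partial>lebesgue) = (\<integral>\<^sup>+x. ennreal c * (ennreal \<bar>exp (r * \<phi> x)\<bar> * indicator (ball y \<rho>) x) \<partial>lebesgue)"
      using c by (intro nn_integral_cong) (simp add: ennreal_mult abs_mult mult_ac)
    also have "\<dots> = ennreal c * (\<integral>\<^sup>+x\<in>ball y \<rho>. ennreal \<bar>exp (r * \<phi> x)\<bar> \<partial>lebesgue)"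
      using \<phi>(1) by (intro nn_integral_cmult borel_measurable_times_ennreal measurable_compose[OF _ measurable_ennreal] borel_measurable_abs
          borel_measurable_exp borel_measurable_indicator) auto
    also have "\<dots> \<le> ennreal c * ennreal K"
      unfolding K(1)[symmetric] ul_norm_def by (intro mult_left_mono SUP_upper) auto
    also have "\<dots> \<le> ennreal \<epsilon>" using c K(2) by (simp add: ennreal_mult[symmetric] ennreal_leI)
    finally show "(\<integral>\<^sup>+x\<in>ball y \<rho>. ennreal \<bar>c * exp (r * \<phi> x)\<bar> \<partial>lebesgue) \<le> ennreal \<epsilon>" .
  qed
  moreover have "(\<lambda>x. c * exp (r * \<phi> x)) \<in> borel_measurable lebesgue" using \<phi>(1) by measurable
  ultimately show "\<exists>M g. g \<in> borel_measurable lebesgue \<and> (\<forall>x. exp (real DIM('a) / \<theta> * \<phi> x) \<le> M + \<bar>g x\<bar>) \<and> ul_norm \<rho> g \<le> ennreal \<epsilon>"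
    unfolding q_def[symmetric] by blast
qed

text \<open>An approximant in \<open>BUC\<close> is bounded, so it serves as the bounded part of the splitting.\<close>

lemma local_existence_critical:
  fixes \<phi> :: "'a::euclidean_space \<Rightarrow> real"
  assumes \<theta>: "0 < \<theta>" "\<theta> \<le> 2" and \<rho>: "0 < \<rho>"
    and \<phi>: "\<phi> \<in> borel_measurable lebesgue" "\<And>x. 0 \<le> \<phi> x" and r: "r = real DIM('a) / \<theta>"
    and ul: "(\<lambda>x. exp (r * \<phi> x)) \<in> L1_ul_closure_BUC \<rho>"
  shows "has_local_solution \<theta> \<phi>"
proof (rule local_existence_ul[OF \<theta> \<rho> \<phi> r])
  fix \<epsilon> :: real assume \<epsilon>: "0 < \<epsilon>"
  obtain v where v: "v \<in> BUC" and n: "ul_norm \<rho> (\<lambda>x. exp (r * \<phi> x) - v x) < ennreal \<epsilon>"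
    using ul \<epsilon> unfolding L1_ul_closure_BUC_def by blast
  obtain M where M: "\<And>x. \<bar>v x\<bar> \<le> M" using v unfolding BUC_def bounded_iff by auto
  have "v \<in> borel_measurable borel"
    using v unfolding BUC_def by (intro borel_measurable_continuous_onI uniformly_continuous_imp_continuous) auto
  then have "v \<in> borel_measurable lebesgue" by (intro measurable_completion) simp
  then have "(\<lambda>x. exp (r * \<phi> x) - v x) \<in> borel_measurable lebesgue" using \<phi>(1) by measurable
  moreover have "exp (r * \<phi> x) \<le> M + \<bar>exp (r * \<phi> x) - v x\<bar>" for x using M[of x] by linarith
  ultimately show "\<exists>M g. g \<in> borel_measurable lebesgue \<and> (\<forall>x. exp (r * \<phi> x) \<le> M + \<bar>g x\<bar>) \<and> ul_norm \<rho> g \<le> ennreal \<epsilon>"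
    using n by (intro exI[of _ M] exI[of _ "\<lambda>x. exp (r * \<phi> x) - v x"]) (auto intro: less_imp_le)
qed

section \<open>A necessary condition for solvability\<close>

text \<open>Jensen's inequality for the exponential, by the tangent at \<open>c\<close>, whose negative part is moved to the
  other side.\<close>

lemma semigroup_jensen_exp:
  fixes g :: "'a::euclidean_space \<Rightarrow> real"
  assumes t: "0 < t" and \<theta>: "0 < \<theta>" "\<theta> \<le> 2"
    and [measurable]: "g \<in> borel_measurable borel" and g: "\<And>y. 0 \<le> g y"
    and H: "frac_heat_semigroup \<theta> t (\<lambda>y. ennreal (g y)) x = ennreal c" and c: "0 \<le> c"
  shows "ennreal (exp c) \<le> frac_heat_semigroup \<theta> t (\<lambda>y. ennreal (exp (g y))) x"
proof -
  have pw: "ennreal (exp c) + ennreal (exp c) * ennreal (g y) \<le> ennreal (exp (g y)) + ennreal (c * exp c)" for y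
  proof -
    have "exp c * (1 + (g y - c)) \<le> exp c * exp (g y - c)" by (intro mult_left_mono exp_ge_add_one_self) simp
    also have "\<dots> = exp (g y)" by (simp add: exp_diff)
    finally have "exp c + exp c * g y \<le> exp (g y) + c * exp c" by (simp add: algebra_simps)
    then show ?thesis using c g[of y]
      by (simp add: ennreal_plus[symmetric] ennreal_mult[symmetric] ennreal_leI del: ennreal_plus)
  qed
  have "ennreal (exp c) + ennreal (exp c) * ennreal c
      = frac_heat_semigroup \<theta> t (\<lambda>y. ennreal (exp c) + ennreal (exp c) * ennreal (g y)) x"
    by (subst frac_heat_semigroup_add, simp, simp, subst frac_heat_semigroup_cmult)
       (auto simp: frac_heat_semigroup_const[OF t \<theta>] H)
  also have "\<dots> \<le> frac_heat_semigroup \<theta> t (\<lambda>y. ennreal (exp (g y)) + ennreal (c * exp c)) x"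
    by (intro frac_heat_semigroup_mono pw)
  also have "\<dots> = frac_heat_semigroup \<theta> t (\<lambda>y. ennreal (exp (g y))) x + ennreal (c * exp c)"
    by (subst frac_heat_semigroup_add) (auto simp: frac_heat_semigroup_const[OF t \<theta>])
  also have "ennreal (exp c) * ennreal c = ennreal (c * exp c)"
    using c by (simp add: ennreal_mult[symmetric] mult.commute)
  finally show ?thesis
    by (simp add: add.commute[of _ "ennreal (c * exp c)"] ennreal_add_left_cancel_le)
qed

text \<open>A discrete form of the blow-up of \<open>W' = e\<^sup>W\<close> for inequalities that hold almost everywhere: once
  the integral has reached \<open>k\<close>, it gains another unit within time \<open>exp (- A - k) \<le> exp (- A) 2\<^sup>-\<^sup>k\<close>.  These times
  add up to at most \<open>2 exp (- A)\<close>, which is the origin of the constant \<open>2\<close>.\<close>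

lemma exp_integral_inequality_blowup:
  fixes g :: "real \<Rightarrow> ennreal" and A t :: real
  assumes [measurable]: "g \<in> borel_measurable borel"
    and fin: "(\<integral>\<^sup>+\<tau>\<in>{0<..<t}. g \<tau> \<partial>lborel) < \<infinity>"
    and g: "AE \<sigma> in lborel. \<sigma> \<in> {0<..<t} \<longrightarrow>
        ennreal (exp (A + enn2real (\<integral>\<^sup>+\<tau>\<in>{0<..<\<sigma>}. g \<tau> \<partial>lborel))) \<le> g \<sigma>"
  shows "t * exp A < 2"
proof (rule ccontr)
  assume "\<not> t * exp A < 2"
  then have tA: "2 * exp (- A) \<le> t" by (simp add: exp_minus field_simps)
  define W where "W \<sigma> = (\<integral>\<^sup>+\<tau>\<in>{0<..<\<sigma>}. g \<tau> \<partial>lborel)" for \<sigma> :: real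
  have W_mono: "W a \<le> W b" if "a \<le> b" for a b
    unfolding W_def using that by (intro nn_integral_mono) (auto simp: indicator_def)
  have W_fin: "W \<sigma> < \<infinity>" if "\<sigma> \<le> t" for \<sigma> using W_mono[OF that] fin unfolding W_def[of t] by (rule order.strict_trans1)
  \<comment> \<open>The time by which the integral has reached the value \<open>k\<close>.\<close>
  define \<tau> where "\<tau> k = exp (- A) * (\<Sum>j<k. (1 / 2) ^ j)" for k :: nat
  have \<tau>0: "0 \<le> \<tau> k" for k unfolding \<tau>_def by (intro mult_nonneg_nonneg sum_nonneg) auto
  have \<tau>S: "\<tau> (Suc k) = \<tau> k + exp (- A) * (1 / 2) ^ k" for k by (simp add: \<tau>_def algebra_simps)
  have \<tau>t: "\<tau> k \<le> t" for k
  proof -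
    have "(\<Sum>j<k. (1 / 2 :: real) ^ j) \<le> 2" by (simp add: geometric_sum)
    then have "\<tau> k \<le> exp (- A) * 2" unfolding \<tau>_def by (intro mult_left_mono) auto
    then show ?thesis using tA by simp
  qed
  have "ennreal (real k) \<le> W (\<tau> k)" for k
  proof (induction k)
    case (Suc k)
    have k_le: "real k \<le> enn2real (W \<sigma>)" if "\<tau> k < \<sigma>" "\<sigma> < t" for \<sigma>
    proof -
      have "ennreal (real k) \<le> W \<sigma>" using Suc W_mono[of "\<tau> k" \<sigma>] that by (auto intro: order_trans)
      then show ?thesis using W_fin[of \<sigma>] that by (cases "W \<sigma>") auto
    qed
    have h2: "(2::real) ^ k \<le> exp (real k)"
    proof -
      have "(2::real) ^ k \<le> exp 1 ^ k" using exp_ge_add_one_self[of 1] by (intro power_mono) auto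
      then show ?thesis by (simp add: exp_of_nat_mult[symmetric])
    qed
    have "1 \<le> exp (A + real k) * (\<tau> (Suc k) - \<tau> k)"
      using h2 by (simp add: \<tau>S exp_add exp_minus power_one_over field_simps)
    then have "1 \<le> ennreal (exp (A + real k)) * ennreal (\<tau> (Suc k) - \<tau> k)"
      by (simp add: \<tau>S ennreal_mult[symmetric])
    also have "\<dots> = (\<integral>\<^sup>+\<sigma>. ennreal (exp (A + real k)) * indicator {\<tau> k<..<\<tau> (Suc k)} \<sigma> \<partial>lborel)"
      by (subst nn_integral_cmult_indicator) (auto simp: \<tau>S)
    also have "\<dots> \<le> (\<integral>\<^sup>+\<sigma>. g \<sigma> * indicator {\<tau> k<..<\<tau> (Suc k)} \<sigma> \<partial>lborel)"
    proof (rule nn_integral_mono_AE)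
      show "AE \<sigma> in lborel. ennreal (exp (A + real k)) * indicator {\<tau> k<..<\<tau> (Suc k)} \<sigma> \<le> g \<sigma> * indicator {\<tau> k<..<\<tau> (Suc k)} \<sigma>"
        using g
      proof eventually_elim
        case (elim \<sigma>)
        show ?case
        proof (cases "\<sigma> \<in> {\<tau> k<..<\<tau> (Suc k)}")
          case True
          then have \<sigma>: "0 < \<sigma>" "\<sigma> < t" using \<tau>0[of k] \<tau>t[of "Suc k"] by auto
          have "ennreal (exp (A + real k)) \<le> ennreal (exp (A + enn2real (W \<sigma>)))"
            using k_le[of \<sigma>] True \<sigma> by (intro ennreal_leI) auto
          also have "\<dots> \<le> g \<sigma>" using elim \<sigma> unfolding W_def by simp
          finally show ?thesis using True by simp
        qed simp
      qed
    qed
    finally have step: "1 \<le> (\<integral>\<^sup>+\<sigma>. g \<sigma> * indicator {\<tau> k<..<\<tau> (Suc k)} \<sigma> \<partial>lborel)" .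
    have "ennreal (real (Suc k)) = ennreal (real k) + 1"
      using ennreal_plus[of "real k" 1] by (simp add: add.commute)
    also have "\<dots> \<le> W (\<tau> k) + (\<integral>\<^sup>+\<sigma>. g \<sigma> * indicator {\<tau> k<..<\<tau> (Suc k)} \<sigma> \<partial>lborel)"
      by (intro add_mono Suc step)
    also have "\<dots> = (\<integral>\<^sup>+\<sigma>. g \<sigma> * indicator {0<..<\<tau> k} \<sigma> + g \<sigma> * indicator {\<tau> k<..<\<tau> (Suc k)} \<sigma> \<partial>lborel)"
      unfolding W_def by (rule nn_integral_add[symmetric]) measurable
    also have "\<dots> \<le> W (\<tau> (Suc k))"
    proof -
      have "\<tau> k < \<tau> (Suc k)" by (simp add: \<tau>S)
      then show ?thesis
        unfolding W_def using \<tau>0[of k] by (intro nn_integral_mono) (auto simp: indicator_def)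
    qed
    finally show ?case .
  qed simp
  then have all: "ennreal (real k) \<le> W t" for k using W_mono[OF \<tau>t[of k]] by (rule order_trans)
  obtain B where "W t = ennreal B" "B \<ge> 0" using W_fin[of t] by (cases "W t") auto
  then have "real k \<le> B" for k using all[of k] by simp
  then show False using reals_Archimedean2[of B] by (meson not_le)
qed

text \<open>A solution is only Lebesgue measurable jointly in space and time, and its time slices need not all be
  measurable.  Tonelli's theorem is applied to a Borel modification, which agrees with the solution on almost
  every slice.\<close>

lemma solution_modification:
  fixes \<phi> :: "'a::euclidean_space \<Rightarrow> real"
  assumes sol: "integral_solution \<theta> \<phi> T u"
  obtains v :: "'a \<Rightarrow> real \<Rightarrow> real" where "(\<lambda>(x, s). v x s) \<in> borel_measurable (borel \<Otimes>\<^sub>M borel)"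
    and "\<And>x s. 0 \<le> v x s"
    and "AE s in lborel. s \<in> {0<..<T} \<longrightarrow> (AE x in lborel. u x s = v x s)"
proof -
  let ?\<Omega> = "UNIV \<times> {0<..<T} :: ('a \<times> real) set"
  have "open ?\<Omega>" by (intro open_Times) auto
  then have "?\<Omega> \<in> sets borel" by simp
  then have \<Omega>: "?\<Omega> \<in> sets lebesgue" by (intro sets_completionI_sets) simp
  define f where "f z = (if z \<in> ?\<Omega> then (case z of (x, t) \<Rightarrow> u x t) else 0)" for z
  have "(\<lambda>(x, t). u x t) \<in> borel_measurable (lebesgue_on ?\<Omega>)"
    using sol by (simp add: integral_solution_def)
  then have "f \<in> borel_measurable lebesgue"
    unfolding f_def using borel_measurable_if[OF \<Omega>] by blast
  then obtain g where g: "g \<in> borel_measurable lborel" and ae: "AE z in lborel. f z = g z"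
    using completion_ex_borel_measurable_real by blast
  obtain N where N: "{z \<in> space lborel. f z \<noteq> g z} \<subseteq> N" "emeasure lborel N = 0" "N \<in> sets lborel"
    using AE_E[OF ae] by blast
  then have "AE z in lborel. z \<notin> N" by (intro AE_not_in) (auto simp: null_sets_def)
  then have "AE z in (lborel :: 'a measure) \<Otimes>\<^sub>M (lborel :: real measure). z \<notin> N" unfolding lborel_prod .
  from lborel_pair.AE_pair[OF this] have xs: "AE x in lborel. AE s in lborel. (x, s) \<notin> N" .
  have "{z \<in> space (lborel \<Otimes>\<^sub>M lborel). (fst z, snd z) \<notin> N} = space (lborel :: ('a \<times> real) measure) - N"
    by (auto simp: space_pair_measure)
  then have "{z \<in> space ((lborel :: 'a measure) \<Otimes>\<^sub>M (lborel :: real measure)). (fst z, snd z) \<notin> N} \<in> sets (lborel \<Otimes>\<^sub>M lborel)"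
    unfolding lborel_prod using N(3) by (metis sets.compl_sets)
  from lborel_pair.AE_commute[OF this] xs have sx: "AE s in lborel. AE x in lborel. (x, s) \<notin> N" by simp
  define v where "v x s = max 0 (g (x, s))" for x s
  show ?thesis
  proof
    have "(\<lambda>(x, s). v x s) = (\<lambda>z. max 0 (g z))" by (auto simp: v_def)
    then show "(\<lambda>(x, s). v x s) \<in> borel_measurable (borel \<Otimes>\<^sub>M borel)"
      using g unfolding borel_prod by simp
    show "0 \<le> v x s" for x s by (simp add: v_def)
    show "AE s in lborel. s \<in> {0<..<T} \<longrightarrow> (AE x in lborel. u x s = v x s)"
      using sx
    proof eventually_elim
      case (elim s)
      show ?case
      proof
        assume s: "s \<in> {0<..<T}"
        show "AE x in lborel. u x s = v x s"
          using elim
        proof eventually_elim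
          case (elim x)
          then have "f (x, s) = g (x, s)" using N(1) by auto
          moreover have "f (x, s) = u x s" using s by (simp add: f_def)
          moreover have "0 \<le> u x s" using sol s by (simp add: integral_solution_def)
          ultimately show ?case by (simp add: v_def)
        qed
      qed
    qed
  qed
qed

text \<open>The right-hand side \<open>U\<close> of the integral equation, formed with the Borel modification \<open>v\<close>, is defined
  everywhere and agrees with the solution almost everywhere at every time.  Applying \<open>S(t - s)\<close> to \<open>U(s)\<close>
  replaces both occurrences of \<open>s\<close> in the kernels by \<open>t\<close>, so only the upper limit of the time integral still
  depends on \<open>s\<close>; Jensen's inequality then closes an integral inequality for a function of time.\<close>

lemma solution_necessary_condition:
  fixes \<phi> :: "'a::euclidean_space \<Rightarrow> real"
  assumes \<theta>: "0 < \<theta>" "\<theta> \<le> 2" and [measurable]: "\<phi> \<in> borel_measurable borel"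
    and sol: "integral_solution \<theta> \<phi> T u" and t: "t \<in> {0<..<T}"
  shows "AE x in lborel. frac_heat_semigroup \<theta> t (\<lambda>y. ennreal (\<phi> y)) x < \<infinity> \<and>
      t * exp (enn2real (frac_heat_semigroup \<theta> t (\<lambda>y. ennreal (\<phi> y)) x)) < 2"
proof -
  obtain v where [measurable]: "(\<lambda>(x, s). v x s) \<in> borel_measurable (borel \<Otimes>\<^sub>M borel)" and v0: "\<And>x s. 0 \<le> v x s"
    and uv: "AE s in lborel. s \<in> {0<..<T} \<longrightarrow> (AE x in lborel. u x s = v x s)"
    using solution_modification[OF sol] by blast
  define S where "S t \<psi> x = frac_heat_semigroup \<theta> t \<psi> x" for t and \<psi> :: "'a \<Rightarrow> ennreal" and x
  define E where "E s y = ennreal (exp (v y s))" for s y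
  have [measurable]: "(\<lambda>(s, y). E s y) \<in> borel_measurable (borel \<Otimes>\<^sub>M borel)" unfolding E_def by measurable
  have [measurable]: "E s \<in> borel_measurable borel" for s unfolding E_def by measurable
  define U where "U s x = S s (\<lambda>y. ennreal (\<phi> y)) x + (\<integral>\<^sup>+\<tau>. S (s - \<tau>) (E \<tau>) x * (if 0 < \<tau> \<and> \<tau> < s then 1 else 0) \<partial>lborel)" for s x
  have U_meas[measurable]: "(\<lambda>(s, x). U s x) \<in> borel_measurable (borel \<Otimes>\<^sub>M borel)"
    unfolding U_def S_def E_def by measurable
  have [measurable]: "U s \<in> borel_measurable borel" for s
    unfolding U_def S_def E_def by measurable
  have uU: "AE x in lborel. ennreal (u x s) = U s x" if s: "s \<in> {0<..<T}" for s
  proof -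
    have "(\<integral>\<^sup>+\<tau>\<in>{0<..<s}. frac_heat_semigroup \<theta> (s - \<tau>) (\<lambda>y. ennreal (exp (u y \<tau>))) x \<partial>lebesgue)
       = (\<integral>\<^sup>+\<tau>. S (s - \<tau>) (E \<tau>) x * (if 0 < \<tau> \<and> \<tau> < s then 1 else 0) \<partial>lborel)" for x
      unfolding nn_integral_completion
    proof (rule nn_integral_cong_AE)
      show "AE \<tau> in lborel. frac_heat_semigroup \<theta> (s - \<tau>) (\<lambda>y. ennreal (exp (u y \<tau>))) x * indicator {0<..<s} \<tau>
          = S (s - \<tau>) (E \<tau>) x * (if 0 < \<tau> \<and> \<tau> < s then 1 else 0)"
        using uv
      proof eventually_elim
        case (elim \<tau>)
        show ?case
        proof (cases "\<tau> \<in> {0<..<s}")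
          case True
          then have "AE y in lborel. u y \<tau> = v y \<tau>" using elim s by auto
          then have "frac_heat_semigroup \<theta> (s - \<tau>) (\<lambda>y. ennreal (exp (u y \<tau>))) x = S (s - \<tau>) (E \<tau>) x"
            unfolding S_def E_def by (intro frac_heat_semigroup_cong_AE) auto
          then show ?thesis using True by simp
        qed auto
      qed
    qed
    moreover have "AE x in lebesgue. ennreal (u x s) =
          frac_heat_semigroup \<theta> s (\<lambda>y. ennreal (\<phi> y)) x +
          (\<integral>\<^sup>+\<tau>\<in>{0<..<s}. frac_heat_semigroup \<theta> (s - \<tau>) (\<lambda>y. ennreal (exp (u y \<tau>))) x \<partial>lebesgue)"
      using sol s by (simp add: integral_solution_def)
    ultimately have "AE x in lebesgue. ennreal (u x s) = U s x" by (simp add: U_def S_def)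
    then show ?thesis by (simp add: AE_completion_iff)
  qed
  have EU: "AE s in lborel. s \<in> {0<..<T} \<longrightarrow> (AE y in lborel. ennreal (v y s) = U s y)"
    using uv
  proof eventually_elim
    case (elim s)
    show ?case
    proof
      assume s: "s \<in> {0<..<T}"
      from elim s have "AE y in lborel. u y s = v y s" by simp
      with uU[OF s] show "AE y in lborel. ennreal (v y s) = U s y" by eventually_elim simp
    qed
  qed
  have SU: "S (t - s) (U s) x = S t (\<lambda>y. ennreal (\<phi> y)) x + (\<integral>\<^sup>+\<tau>\<in>{0<..<s}. S (t - \<tau>) (E \<tau>) x \<partial>lborel)"
    if s: "s \<in> {0<..<t}" for s x
  proof -
    have "S (t - s) (U s) x = S (t - s) (S s (\<lambda>y. ennreal (\<phi> y))) x
        + S (t - s) (\<lambda>y. \<integral>\<^sup>+\<tau>. S (s - \<tau>) (E \<tau>) y * (if 0 < \<tau> \<and> \<tau> < s then 1 else 0) \<partial>lborel) x"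
      unfolding U_def S_def E_def by (subst frac_heat_semigroup_add) auto
    also have "S (t - s) (S s (\<lambda>y. ennreal (\<phi> y))) x = S t (\<lambda>y. ennreal (\<phi> y)) x"
      using frac_heat_semigroup_semigroup[of "\<lambda>y. ennreal (\<phi> y)" s "t - s" \<theta> x] s \<theta> by (simp add: S_def[abs_def])
    also have "S (t - s) (\<lambda>y. \<integral>\<^sup>+\<tau>. S (s - \<tau>) (E \<tau>) y * (if 0 < \<tau> \<and> \<tau> < s then 1 else 0) \<partial>lborel) x
       = (\<integral>\<^sup>+\<tau>. S (t - s) (\<lambda>y. S (s - \<tau>) (E \<tau>) y * (if 0 < \<tau> \<and> \<tau> < s then 1 else 0)) x \<partial>lborel)"
      unfolding S_def E_def by (rule frac_heat_semigroup_nn_integral) measurable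
    also have "\<dots> = (\<integral>\<^sup>+\<tau>\<in>{0<..<s}. S (t - \<tau>) (E \<tau>) x \<partial>lborel)"
    proof (rule nn_integral_cong)
      fix \<tau>
      show "S (t - s) (\<lambda>y. S (s - \<tau>) (E \<tau>) y * (if 0 < \<tau> \<and> \<tau> < s then 1 else 0)) x = S (t - \<tau>) (E \<tau>) x * indicator {0<..<s} \<tau>"
      proof (cases "\<tau> \<in> {0<..<s}")
        case True
        then show ?thesis
          using frac_heat_semigroup_semigroup[of "E \<tau>" "s - \<tau>" "t - s" \<theta> x] s \<theta> by (simp add: S_def[abs_def])
      next
        case False
        then have "(\<lambda>y. S (s - \<tau>) (E \<tau>) y * (if 0 < \<tau> \<and> \<tau> < s then 1 else 0)) = (\<lambda>_. 0)" by auto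
        then show ?thesis using False by (simp add: S_def frac_heat_semigroup_lborel)
      qed
    qed
    finally show ?thesis .
  qed
  have main: "S t (\<lambda>y. ennreal (\<phi> y)) x < \<infinity> \<and> t * exp (enn2real (S t (\<lambda>y. ennreal (\<phi> y)) x)) < 2" if fin: "U t x < \<infinity>" for x
  proof -
    define A where "A = enn2real (S t (\<lambda>y. ennreal (\<phi> y)) x)"
    define g where "g \<tau> = S (t - \<tau>) (E \<tau>) x" for \<tau>
    have [measurable]: "g \<in> borel_measurable borel" unfolding g_def S_def E_def by measurable
    have Ut: "U t x = S t (\<lambda>y. ennreal (\<phi> y)) x + (\<integral>\<^sup>+\<tau>\<in>{0<..<t}. g \<tau> \<partial>lborel)"
      unfolding U_def g_def by (intro arg_cong2[where f="(+)"] refl nn_integral_cong) (auto simp: indicator_def)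
    have f1: "S t (\<lambda>y. ennreal (\<phi> y)) x < \<infinity>" and f2: "(\<integral>\<^sup>+\<tau>\<in>{0<..<t}. g \<tau> \<partial>lborel) < \<infinity>"
      using fin unfolding Ut by (auto simp: less_top)
    have A: "S t (\<lambda>y. ennreal (\<phi> y)) x = ennreal A" unfolding A_def using f1 by simp
    have "t * exp A < 2"
    proof (rule exp_integral_inequality_blowup[OF _ f2])
      show "AE \<sigma> in lborel. \<sigma> \<in> {0<..<t} \<longrightarrow> ennreal (exp (A + enn2real (\<integral>\<^sup>+\<tau>\<in>{0<..<\<sigma>}. g \<tau> \<partial>lborel))) \<le> g \<sigma>"
        using EU
      proof eventually_elim
        case (elim \<sigma>)
        show ?case
        proof
          assume \<sigma>: "\<sigma> \<in> {0<..<t}"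
          then have ae: "AE y in lborel. ennreal (v y \<sigma>) = U \<sigma> y" using elim t by auto
          have "(\<integral>\<^sup>+\<tau>\<in>{0<..<\<sigma>}. g \<tau> \<partial>lborel) \<le> (\<integral>\<^sup>+\<tau>\<in>{0<..<t}. g \<tau> \<partial>lborel)"
            using \<sigma> by (intro nn_integral_mono) (auto simp: indicator_def)
          then have f3: "(\<integral>\<^sup>+\<tau>\<in>{0<..<\<sigma>}. g \<tau> \<partial>lborel) < \<infinity>" using f2 by (rule order.strict_trans1)
          have "S (t - \<sigma>) (\<lambda>y. ennreal (v y \<sigma>)) x = S (t - \<sigma>) (U \<sigma>) x"
            unfolding S_def by (rule frac_heat_semigroup_cong_AE[OF ae])
          also have "\<dots> = ennreal A + (\<integral>\<^sup>+\<tau>\<in>{0<..<\<sigma>}. g \<tau> \<partial>lborel)"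
            unfolding SU[OF \<sigma>] A g_def ..
          also have "\<dots> = ennreal (A + enn2real (\<integral>\<^sup>+\<tau>\<in>{0<..<\<sigma>}. g \<tau> \<partial>lborel))"
            using f3 by (simp add: A_def)
          finally show "ennreal (exp (A + enn2real (\<integral>\<^sup>+\<tau>\<in>{0<..<\<sigma>}. g \<tau> \<partial>lborel))) \<le> g \<sigma>"
            unfolding g_def E_def S_def using \<sigma> v0
            by (intro semigroup_jensen_exp \<theta>) (auto simp: A_def)
        qed
      qed
    qed measurable
    then show ?thesis using f1 unfolding A_def by simp
  qed
  have "AE x in lborel. U t x < \<infinity>" using uU[OF t] by eventually_elim (metis ennreal_less_top infinity_ennreal_def)
  then show ?thesis by eventually_elim (use main in \<open>simp add: S_def\<close>)
qed

section \<open>A logarithmic singularity without solution\<close>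

lemma pred_in_ball[measurable (raw)]:
  "f \<in> M \<rightarrow>\<^sub>M borel \<Longrightarrow> Measurable.pred M (\<lambda>z. f z \<in> ball (c :: 'a::euclidean_space) r)"
  unfolding mem_ball by measurable

text \<open>Up to a constant, \<open>|x|\<^sup>-\<^sup>b\<close> is at most \<open>\<integral> s\<^sup>-\<^sup>b\<^sup>-\<^sup>1 ds\<close> over \<open>|x| < s < 2 |x|\<close>.  Exchanging the integrals leaves the
  volumes of balls, of order \<open>s\<^sup>N\<close>, and the integrable power \<open>s\<^sup>N\<^sup>-\<^sup>b\<^sup>-\<^sup>1\<close>.\<close>

lemma norm_powr_integrable_near_0:
  assumes b: "0 \<le> b" "b < real DIM('a::euclidean_space)"
  shows "(\<integral>\<^sup>+x\<in>ball 0 1. ennreal (norm x powr (- b)) \<partial>(lborel :: 'a measure)) < \<infinity>"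
proof -
  let ?N = "DIM('a)"
  define v where "v = unit_ball_vol (real ?N)"
  have v: "v \<ge> 0" by (simp add: v_def)
  define J where "J s = (if 0 < s \<and> s < 2 then s powr (- b - 1) else 0)" for s :: real
  have [measurable]: "J \<in> borel_measurable borel" unfolding J_def by measurable
  have J0: "J s \<ge> 0" for s by (simp add: J_def)
  have pw: "ennreal (norm x powr (- b)) * indicator (ball 0 1) x
      \<le> ennreal (2 powr (b + 1)) * (\<integral>\<^sup>+s. ennreal (J s) * (if norm x < s then 1 else 0) \<partial>lborel)" (is "_ \<le> ?R") for x :: 'a
  proof (cases "x \<noteq> 0 \<and> norm x < 1")
    case True
    define n where "n = norm x"
    have n: "0 < n" "n < 1" using True by (auto simp: n_def)
    have "ennreal ((2 * n) powr (- b - 1)) * ennreal n = (\<integral>\<^sup>+s. ennreal ((2 * n) powr (- b - 1)) * indicator {n<..<2 * n} s \<partial>lborel)"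
      using n by (subst nn_integral_cmult_indicator) auto
    also have "\<dots> \<le> (\<integral>\<^sup>+s. ennreal (J s) * (if norm x < s then 1 else 0) \<partial>lborel)"
    proof (intro nn_integral_mono)
      fix s
      show "ennreal ((2 * n) powr (- b - 1)) * indicator {n<..<2 * n} s \<le> ennreal (J s) * (if norm x < s then 1 else 0)"
      proof (cases "s \<in> {n<..<2 * n}")
        case True
        then have "(2 * n) powr (- b - 1) \<le> s powr (- b - 1)" using n b by (intro powr_mono2') auto
        then show ?thesis using True n by (auto simp: J_def n_def[symmetric] intro!: ennreal_leI)
      qed simp
    qed
    finally have "ennreal (2 powr (b + 1)) * (ennreal ((2 * n) powr (- b - 1)) * ennreal n) \<le> ?R"
      by (rule mult_left_mono) simp
    moreover have "2 powr (b + 1) * ((2 * n) powr (- b - 1) * n) = n powr (- b)"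
    proof -
      have "2 powr (b + 1) * ((2 * n) powr (- b - 1) * n) = (2 powr (b + 1) * 2 powr (- b - 1)) * (n powr (- b - 1) * n powr 1)"
        using n by (simp add: powr_mult)
      also have "\<dots> = n powr (- b)" unfolding powr_add[symmetric] by simp
      finally show ?thesis .
    qed
    ultimately show ?thesis using True n by (simp add: n_def ennreal_mult[symmetric])
  next
    case False
    then show ?thesis by (auto simp: indicator_def)
  qed
  have "(\<integral>\<^sup>+x\<in>ball 0 1. ennreal (norm x powr (- b)) \<partial>(lborel :: 'a measure))
     \<le> (\<integral>\<^sup>+x. ennreal (2 powr (b + 1)) * (\<integral>\<^sup>+s. ennreal (J s) * (if norm x < s then 1 else 0) \<partial>lborel) \<partial>(lborel :: 'a measure))"
    by (intro nn_integral_mono pw)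
  also have "\<dots> = ennreal (2 powr (b + 1)) * (\<integral>\<^sup>+x. \<integral>\<^sup>+s. ennreal (J s) * (if norm x < s then 1 else 0) \<partial>lborel \<partial>(lborel :: 'a measure))"
    by (rule nn_integral_cmult) measurable
  also have "(\<integral>\<^sup>+x. \<integral>\<^sup>+s. ennreal (J s) * (if norm x < s then 1 else 0) \<partial>lborel \<partial>(lborel :: 'a measure))
     = (\<integral>\<^sup>+s. \<integral>\<^sup>+x. ennreal (J s) * (if norm x < s then 1 else 0) \<partial>(lborel :: 'a measure) \<partial>lborel)"
    by (rule lborel_pair.Fubini') measurable
  also have "\<dots> = (\<integral>\<^sup>+s. ennreal v * (ennreal (s powr (real ?N - b - 1)) * indicator {0<..<2} s) \<partial>lborel)"
  proof (rule nn_integral_cong)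
    fix s :: real
    show "(\<integral>\<^sup>+x. ennreal (J s) * (if norm x < s then 1 else 0) \<partial>(lborel :: 'a measure)) = ennreal v * (ennreal (s powr (real ?N - b - 1)) * indicator {0<..<2} s)"
    proof (cases "0 < s \<and> s < 2")
      case True
      have "(\<integral>\<^sup>+x. ennreal (J s) * (if norm x < s then 1 else 0) \<partial>(lborel :: 'a measure)) = (\<integral>\<^sup>+x. ennreal (J s) * indicator (ball 0 s) x \<partial>(lborel :: 'a measure))"
        by (intro nn_integral_cong) (auto simp: indicator_def)
      also have "\<dots> = ennreal (J s) * emeasure lborel (ball (0::'a) s)"
        by (rule nn_integral_cmult_indicator) simp
      also have "\<dots> = ennreal (s powr (- b - 1) * (v * s ^ ?N))"
        using True v by (simp add: emeasure_ball J_def v_def ennreal_mult)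
      also have "s powr (- b - 1) * (v * s ^ ?N) = v * s powr (real ?N - b - 1)"
        using True by (simp add: powr_realpow[symmetric] mult.left_commute powr_add[symmetric] algebra_simps)
      finally show ?thesis using True v by (simp add: ennreal_mult)
    next
      case False
      then show ?thesis by (auto simp: J_def indicator_def)
    qed
  qed
  also have "\<dots> = ennreal v * (\<integral>\<^sup>+s\<in>{0<..<2}. ennreal (s powr (real ?N - b - 1)) \<partial>lborel)"
    by (rule nn_integral_cmult) measurable
  also have "\<dots> = ennreal v * ennreal (2 powr (real ?N - b - 1 + 1) / (real ?N - b - 1 + 1))"
    using b by (subst nn_integral_powr_0) auto
  also have "ennreal (2 powr (b + 1)) * \<dots> < \<infinity>"
    by (simp add: ennreal_mult_less_top less_top[symmetric] ennreal_mult_eq_top_iff)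
  finally show ?thesis .
qed

text \<open>The function \<open>a log\<^sup>+ (1 / |x|)\<close>; at the origin it has the value \<open>0\<close>, since \<open>ln 0 = 0\<close>.\<close>

definition log_spike :: "real \<Rightarrow> 'a::euclidean_space \<Rightarrow> real" where
  "log_spike a x = a * max 0 (- ln (norm x))"

lemma log_spike_measurable[measurable]: "log_spike a \<in> borel_measurable borel"
  unfolding log_spike_def by measurable

lemma exp_log_spike_in_L1_ul:
  assumes a: "0 \<le> a" and r: "0 < r" and ar: "a * r < real DIM('a::euclidean_space)"
  shows "(\<lambda>x::'a. exp (r * log_spike a x)) \<in> L1_ul \<rho>"
proof -
  define b where "b = a * r"
  have b: "0 \<le> b" "b < real DIM('a)" using a r ar by (auto simp: b_def)
  define I where "I = (\<integral>\<^sup>+x\<in>ball 0 1. ennreal (norm x powr (- b)) \<partial>(lborel :: 'a measure))"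
  have I: "I < \<infinity>" unfolding I_def by (rule norm_powr_integrable_near_0[OF b])
  have meas: "(\<lambda>x::'a. exp (r * log_spike a x)) \<in> borel_measurable borel" by measurable
  have pw: "ennreal (exp (r * log_spike a x)) \<le> 1 + ennreal (norm x powr (- b)) * indicator (ball 0 1) x" for x :: 'a
  proof (cases "x \<noteq> 0 \<and> norm x < 1")
    case True
    then have "ln (norm x) < 0" by simp
    then have "exp (r * log_spike a x) = norm x powr (- b)"
      using True by (simp add: log_spike_def b_def powr_def)
    then show ?thesis using True by (simp add: add_increasing)
  next
    case False
    then have "0 \<le> ln (norm x)" by (cases "x = 0") auto
    then have "log_spike a x = 0" by (simp add: log_spike_def)
    then show ?thesis by simp
  qed
  have bound: "(\<integral>\<^sup>+x\<in>A. ennreal \<bar>exp (r * log_spike a x)\<bar> \<partial>lebesgue) \<le> emeasure lborel A + I" if A: "A \<in> sets borel" for A :: "'a set"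
  proof -
    have "(\<integral>\<^sup>+x\<in>A. ennreal \<bar>exp (r * log_spike a x)\<bar> \<partial>lebesgue)
       \<le> (\<integral>\<^sup>+x. indicator A x + ennreal (norm x powr (- b)) * indicator (ball 0 1) x \<partial>lborel)"
      unfolding nn_integral_completion using pw by (intro nn_integral_mono) (auto simp: indicator_def split: if_splits)
    also have "\<dots> = emeasure lborel A + I"
      using A unfolding I_def by (subst nn_integral_add) auto
    finally show ?thesis .
  qed
  have "ul_norm \<rho> (\<lambda>x::'a. exp (r * log_spike a x)) \<le> emeasure lborel (ball (0::'a) \<rho>) + I"
    unfolding ul_norm_def
  proof (rule SUP_least)
    fix y :: 'a
    have "emeasure lborel (ball y \<rho>) = emeasure lborel (ball (0::'a) \<rho>)"
      by (cases "\<rho> \<ge> 0") (auto simp: emeasure_ball ball_empty)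
    then show "(\<integral>\<^sup>+x\<in>ball y \<rho>. ennreal \<bar>exp (r * log_spike a x)\<bar> \<partial>lebesgue) \<le> emeasure lborel (ball (0::'a) \<rho>) + I"
      using bound[of "ball y \<rho>"] by simp
  qed
  also have "\<dots> < \<infinity>" using I emeasure_lborel_ball_finite[of "0::'a" \<rho>] by simp
  finally have ul: "ul_norm \<rho> (\<lambda>x::'a. exp (r * log_spike a x)) < \<infinity>" .
  have "(\<lambda>x::'a. exp (r * log_spike a x)) absolutely_integrable_on K" if K: "compact K" for K
    unfolding set_integrable_def
  proof (rule integrableI_bounded)
    have Kb: "K \<in> sets borel" using K by (simp add: compact_imp_closed)
    then show "(\<lambda>x. indicat_real K x *\<^sub>R exp (r * log_spike a x)) \<in> borel_measurable lebesgue"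
      using meas by (intro measurable_completion) simp
    have "(\<integral>\<^sup>+x. ennreal (norm (indicat_real K x *\<^sub>R exp (r * log_spike a x))) \<partial>lebesgue) = (\<integral>\<^sup>+x\<in>K. ennreal \<bar>exp (r * log_spike a x)\<bar> \<partial>lebesgue)"
      by (intro nn_integral_cong) (auto simp: indicator_def)
    also have "\<dots> \<le> emeasure lborel K + I" by (rule bound[OF Kb])
    also have "\<dots> < \<infinity>" using I emeasure_compact_finite[OF K] by simp
    finally show "(\<integral>\<^sup>+x. ennreal (norm (indicat_real K x *\<^sub>R exp (r * log_spike a x))) \<partial>lebesgue) < \<infinity>" .
  qed
  then show ?thesis using ul by (simp add: L1_ul_def L1_loc_def)
qed

lemma fund_sol_ball_mass:
  fixes R :: real
  assumes t: "0 < t" and \<theta>: "0 < \<theta>"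
  shows "(\<integral>\<^sup>+z\<in>ball 0 (R * t powr (1 / \<theta>)). ennreal (fund_sol \<theta> z t) \<partial>(lborel :: 'a::euclidean_space measure))
     = (\<integral>\<^sup>+z\<in>ball 0 R. ennreal (fund_sol \<theta> z 1) \<partial>(lborel :: 'a measure))"
proof -
  let ?N = "DIM('a)"
  define c where "c = t powr (1 / \<theta>)"
  have c: "c > 0" using t by (simp add: c_def)
  have cN: "c ^ ?N * t powr (- real ?N / \<theta>) = 1"
    using t by (simp add: c_def powr_realpow[symmetric] powr_powr powr_add[symmetric])
  have tc: "t powr (- 1 / \<theta>) * c = 1" using t by (simp add: c_def powr_add[symmetric])
  have "(\<integral>\<^sup>+z\<in>ball 0 (R * c). ennreal (fund_sol \<theta> z t) \<partial>(lborel :: 'a measure))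
     = ennreal (\<bar>c\<bar> ^ ?N) * (\<integral>\<^sup>+z. ennreal (fund_sol \<theta> (0 + c *\<^sub>R z) t) * indicator (ball 0 (R * c)) (0 + c *\<^sub>R z) \<partial>(lborel :: 'a measure))"
    using c by (intro nn_integral_lborel_affine borel_measurable_times_ennreal borel_measurable_indicator) auto
  also have "\<dots> = (\<integral>\<^sup>+z. ennreal (c ^ ?N) * (ennreal (fund_sol \<theta> (0 + c *\<^sub>R z) t) * indicator (ball 0 (R * c)) (0 + c *\<^sub>R z)) \<partial>(lborel :: 'a measure))"
    using c by (subst nn_integral_cmult) auto
  also have "\<dots> = (\<integral>\<^sup>+z\<in>ball 0 R. ennreal (fund_sol \<theta> z 1) \<partial>(lborel :: 'a measure))"
  proof (rule nn_integral_cong)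
    fix z :: 'a
    have "fund_sol \<theta> (c *\<^sub>R z) t = t powr (- real ?N / \<theta>) * fund_sol \<theta> z 1"
      using fund_sol_scaling[OF t \<theta>, of "c *\<^sub>R z"] tc by simp
    then have "ennreal (c ^ ?N) * ennreal (fund_sol \<theta> (c *\<^sub>R z) t) = ennreal (fund_sol \<theta> z 1)"
      using c cN by (simp add: ennreal_mult'[symmetric] mult.assoc[symmetric])
    moreover have "indicator (ball 0 (R * c)) (c *\<^sub>R z) = (indicator (ball 0 R) z :: ennreal)"
      using c by (simp add: indicator_def mult.commute)
    ultimately show "ennreal (c ^ ?N) * (ennreal (fund_sol \<theta> (0 + c *\<^sub>R z) t) * indicator (ball 0 (R * c)) (0 + c *\<^sub>R z)) = ennreal (fund_sol \<theta> z 1) * indicator (ball 0 R) z"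
      by (simp add: mult.assoc[symmetric])
  qed
  finally show ?thesis unfolding c_def .
qed

lemma fund_sol_mass_concentrates:
  assumes \<theta>: "0 < \<theta>" "\<theta> \<le> 2" and \<kappa>: "\<kappa> < 1"
  obtains n :: nat where "ennreal \<kappa> \<le> (\<integral>\<^sup>+z\<in>ball 0 (real n). ennreal (fund_sol \<theta> z 1) \<partial>(lborel :: 'a::euclidean_space measure))"
proof -
  let ?f = "\<lambda>n z::'a. ennreal (fund_sol \<theta> z 1) * indicator (ball 0 (real n)) z"
  have "(\<integral>\<^sup>+z. (SUP n. ?f n z) \<partial>lborel) = (SUP n. \<integral>\<^sup>+z. ?f n z \<partial>lborel)"
    by (rule nn_integral_monotone_convergence_SUP) (auto simp: incseq_def le_fun_def indicator_def)
  moreover have "(SUP n. ?f n z) = ennreal (fund_sol \<theta> z 1)" for z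
  proof (rule antisym)
    obtain n :: nat where "norm z < real n" using reals_Archimedean2 by blast
    then have "ennreal (fund_sol \<theta> z 1) = ?f n z" by simp
    also have "\<dots> \<le> (SUP n. ?f n z)" by (rule SUP_upper) simp
    finally show "ennreal (fund_sol \<theta> z 1) \<le> (SUP n. ?f n z)" .
  qed (auto intro!: SUP_least simp: indicator_def)
  ultimately have "(SUP n. \<integral>\<^sup>+z. ?f n z \<partial>lborel) = 1" using fund_sol_mass[OF _ \<theta>, of 1, where 'a='a] by simp
  then have "ennreal \<kappa> < (SUP n. \<integral>\<^sup>+z. ?f n z \<partial>lborel)" using \<kappa> by (simp add: ennreal_less_one_iff)
  then show ?thesis unfolding less_SUP_iff by (auto intro: that less_imp_le)
qed

text \<open>A fixed fraction of the kernel's mass at time \<open>t\<close> lies within distance \<open>n t\<^sup>1\<^sup>/\<^sup>\<theta>\<close> of \<open>x\<close>, where the spike exceeds its value on the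
  sphere of radius \<open>(n + 1) t\<^sup>1\<^sup>/\<^sup>\<theta>\<close>.\<close>

lemma log_spike_semigroup_lower_bound:
  fixes x :: "'a::euclidean_space"
  assumes t: "0 < t" and \<theta>: "0 < \<theta>" and a: "0 \<le> a" and \<kappa>: "0 \<le> \<kappa>"
    and n: "ennreal \<kappa> \<le> (\<integral>\<^sup>+z\<in>ball 0 (real n). ennreal (fund_sol \<theta> z 1) \<partial>(lborel :: 'a measure))"
    and small: "(real n + 1) * t powr (1 / \<theta>) \<le> 1" and x: "norm x < t powr (1 / \<theta>)"
  shows "ennreal (a * \<kappa> * (- ln ((real n + 1) * t powr (1 / \<theta>)))) \<le> frac_heat_semigroup \<theta> t (\<lambda>y. ennreal (log_spike a y)) x"
proof -
  define c where "c = t powr (1 / \<theta>)"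
  have c: "c > 0" using t by (simp add: c_def)
  define l where "l = - ln ((real n + 1) * c)"
  have l: "l \<ge> 0" unfolding l_def using small c by (simp add: c_def[symmetric] ln_le_zero_iff)
  have spike: "a * l \<le> log_spike a y" if y: "y \<noteq> 0" "norm (x - y) < real n * c" for y
  proof -
    have "norm y \<le> norm x + norm (x - y)" using norm_triangle_ineq4[of x "x - y"] by simp
    also have "\<dots> \<le> (real n + 1) * c" using y x by (simp add: c_def[symmetric] algebra_simps)
    finally have "ln (norm y) \<le> ln ((real n + 1) * c)" using y c by (intro iffD2[OF ln_le_cancel_iff]) auto
    then show ?thesis unfolding log_spike_def l_def using a by (intro mult_left_mono) auto
  qed
  have "ennreal (a * \<kappa> * l) = ennreal (a * l) * ennreal \<kappa>"
    using a l \<kappa> by (simp add: ennreal_mult[symmetric] mult_ac)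
  also have "\<dots> \<le> ennreal (a * l) * (\<integral>\<^sup>+z\<in>ball 0 (real n * c). ennreal (fund_sol \<theta> z t) \<partial>(lborel :: 'a measure))"
    unfolding c_def fund_sol_ball_mass[OF t \<theta>] by (intro mult_left_mono n) simp
  also have "(\<integral>\<^sup>+z\<in>ball 0 (real n * c). ennreal (fund_sol \<theta> z t) \<partial>(lborel :: 'a measure))
     = (\<integral>\<^sup>+y. ennreal (fund_sol \<theta> (x - y) t) * indicator (ball 0 (real n * c)) (x - y) \<partial>lborel)"
    using nn_integral_lborel_affine[of "\<lambda>z::'a. ennreal (fund_sol \<theta> z t) * indicator (ball 0 (real n * c)) z" "-1" x] by simp
  also have "ennreal (a * l) * \<dots> = (\<integral>\<^sup>+y. ennreal (a * l) * (ennreal (fund_sol \<theta> (x - y) t) * indicator (ball 0 (real n * c)) (x - y)) \<partial>lborel)"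
    by (rule nn_integral_cmult[symmetric]) measurable
  also have "\<dots> \<le> frac_heat_semigroup \<theta> t (\<lambda>y. ennreal (log_spike a y)) x"
    unfolding frac_heat_semigroup_lborel
  proof (rule nn_integral_mono_AE)
    show "AE y in lborel. ennreal (a * l) * (ennreal (fund_sol \<theta> (x - y) t) * indicator (ball 0 (real n * c)) (x - y))
       \<le> ennreal (fund_sol \<theta> (x - y) t) * ennreal (log_spike a y)"
      using AE_lborel_singleton[of "0::'a"]
    proof eventually_elim
      case (elim y)
      show ?case
        using spike[OF elim] by (auto simp: indicator_def mult.commute intro!: mult_right_mono ennreal_leI)
    qed
  qed
  finally show ?thesis unfolding l_def c_def .
qed

text \<open>With a fraction \<open>\<kappa>\<close> of the mass such that \<open>q = a \<kappa> / \<theta> > 1\<close>, the lower bound makes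
  \<open>t exp (S(t) \<phi>)\<close> at least a constant times \<open>t\<^sup>1\<^sup>-\<^sup>q\<close> on a ball around the origin.  This exceeds \<open>2\<close> for small
  \<open>t\<close>, and a ball is not a null set.\<close>

lemma log_spike_no_local_solution:
  assumes \<theta>: "0 < \<theta>" "\<theta> \<le> 2" and a: "\<theta> < a"
  shows "\<not> has_local_solution \<theta> (log_spike a :: 'a::euclidean_space \<Rightarrow> real)"
proof
  assume "has_local_solution \<theta> (log_spike a :: 'a \<Rightarrow> real)"
  then obtain T u where T: "T > 0" and sol: "integral_solution \<theta> (log_spike a :: 'a \<Rightarrow> real) T u"
    unfolding has_local_solution_def by blast
  \<comment> \<open>Any \<open>\<kappa>\<close> strictly between \<open>\<theta> / a\<close> and \<open>1\<close> would do.\<close>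
  define \<kappa> where "\<kappa> = (1 + \<theta> / a) / 2"
  have \<kappa>: "0 < \<kappa>" "\<kappa> < 1" using \<theta> a by (auto simp: \<kappa>_def field_simps)
  define q where "q = a * \<kappa> / \<theta>"
  have q: "1 < q" using \<theta> a by (simp add: q_def \<kappa>_def field_simps)
  obtain n :: nat where n: "ennreal \<kappa> \<le> (\<integral>\<^sup>+z\<in>ball 0 (real n). ennreal (fund_sol \<theta> z 1) \<partial>(lborel :: 'a measure))"
    using fund_sol_mass_concentrates[OF \<theta> \<kappa>(2)] by blast
  define m where "m = real n + 1"
  have m: "m > 0" by (simp add: m_def)
  have "\<forall>\<^sub>F t in at_right 0. t < T" using T by (intro eventually_at_rightI[of 0 T]) auto
  moreover have "\<forall>\<^sub>F t in at_right 0. m * t powr (1 / \<theta>) \<le> 1" using \<theta> m by real_asymp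
  moreover have "\<forall>\<^sub>F t in at_right 0. 2 * m powr (a * \<kappa>) \<le> t powr (1 - q)" using q by real_asymp
  moreover have "\<forall>\<^sub>F t in at_right (0::real). 0 < t" by (rule eventually_at_right_less)
  ultimately have "\<forall>\<^sub>F t in at_right 0. 0 < t \<and> t < T \<and> m * t powr (1 / \<theta>) \<le> 1 \<and> 2 * m powr (a * \<kappa>) \<le> t powr (1 - q)"
    by eventually_elim auto
  then obtain t where t: "0 < t" "t < T" and small: "m * t powr (1 / \<theta>) \<le> 1" and big: "2 * m powr (a * \<kappa>) \<le> t powr (1 - q)"
    using eventually_happens'[of "at_right (0::real)"] by auto
  define l where "l = - ln (m * t powr (1 / \<theta>))"
  have l: "l = - ln m - ln t / \<theta>" unfolding l_def using t m by (simp add: ln_mult ln_powr)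
  have large: "2 \<le> t * exp (a * \<kappa> * l)"
  proof -
    have "t * exp (a * \<kappa> * l) = exp (ln t + a * \<kappa> * l)" using t by (simp add: exp_add)
    also have "ln t + a * \<kappa> * l = (1 - q) * ln t - a * \<kappa> * ln m"
      unfolding l q_def using \<theta> by (simp add: field_simps)
    also have "exp \<dots> = t powr (1 - q) / m powr (a * \<kappa>)" using t m by (simp add: exp_diff powr_def)
    finally have "t * exp (a * \<kappa> * l) = t powr (1 - q) / m powr (a * \<kappa>)" .
    moreover have "2 \<le> t powr (1 - q) / m powr (a * \<kappa>)" using big m by (simp add: pos_le_divide_eq)
    ultimately show ?thesis by simp
  qed
  have "AE x::'a in lborel. frac_heat_semigroup \<theta> t (\<lambda>y. ennreal (log_spike a y)) x < \<infinity> \<and>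
      t * exp (enn2real (frac_heat_semigroup \<theta> t (\<lambda>y. ennreal (log_spike a y)) x)) < 2"
    using t by (intro solution_necessary_condition[OF \<theta> _ sol]) auto
  then have "AE x::'a in lborel. x \<notin> ball 0 (t powr (1 / \<theta>))"
  proof eventually_elim
    case (elim x)
    show ?case
    proof
      assume "x \<in> ball 0 (t powr (1 / \<theta>))"
      then have "ennreal (a * \<kappa> * l) \<le> frac_heat_semigroup \<theta> t (\<lambda>y. ennreal (log_spike a y)) x"
        unfolding l_def m_def using t \<theta> a \<kappa> n small
        by (intro log_spike_semigroup_lower_bound) (auto simp: m_def)
      then have "a * \<kappa> * l \<le> enn2real (frac_heat_semigroup \<theta> t (\<lambda>y. ennreal (log_spike a y)) x)"
        using elim by (cases "frac_heat_semigroup \<theta> t (\<lambda>y. ennreal (log_spike a y)) x") (auto simp: ennreal_le_iff2)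
      then have "t * exp (a * \<kappa> * l) \<le> t * exp (enn2real (frac_heat_semigroup \<theta> t (\<lambda>y. ennreal (log_spike a y)) x))"
        using t by simp
      then show False using large elim by linarith
    qed
  qed
  then have "ball (0::'a) (t powr (1 / \<theta>)) \<in> null_sets lborel"
    by (subst (asm) AE_iff_null_sets[symmetric]) auto
  moreover have "emeasure lborel (ball (0::'a) (t powr (1 / \<theta>))) = ennreal (unit_ball_vol (real DIM('a)) * (t powr (1 / \<theta>)) ^ DIM('a))"
    by (rule emeasure_ball) simp
  moreover have "0 < unit_ball_vol (real DIM('a)) * (t powr (1 / \<theta>)) ^ DIM('a)" using t by simp
  ultimately show False by (metis null_setsD1 ennreal_eq_0_iff not_le)
qed

text \<open>The interval \<open>(\<theta>, N / r)\<close> of admissible \<open>a\<close> is nonempty exactly because \<open>r < N / \<theta>\<close>.\<close>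

lemma nonexistence_subcritical:
  assumes \<theta>: "0 < \<theta>" "\<theta> \<le> 2" and r: "0 < r" "r < real DIM('a::euclidean_space) / \<theta>"
  shows "\<exists>\<phi> :: 'a \<Rightarrow> real. \<phi> \<in> borel_measurable lebesgue \<and> (\<forall>x. 0 \<le> \<phi> x) \<and>
     (\<lambda>x. exp (r * \<phi> x)) \<in> L1_ul \<rho> \<and> \<not> has_local_solution \<theta> \<phi>"
proof -
  define d where "d = real DIM('a) / r"
  define a where "a = (\<theta> + d) / 2"
  have "\<theta> < d" using r \<theta> by (simp add: d_def field_simps)
  then have a: "\<theta> < a" "a < d" by (auto simp: a_def)
  have "(log_spike a :: 'a \<Rightarrow> real) \<in> borel_measurable lebesgue" by (intro measurable_completion) simp
  moreover have "0 \<le> log_spike a x" for x :: 'a using a \<theta> by (simp add: log_spike_def)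
  moreover have "(\<lambda>x::'a. exp (r * log_spike a x)) \<in> L1_ul \<rho>"
    using a \<theta> r by (intro exp_log_spike_in_L1_ul) (auto simp: d_def field_simps)
  ultimately show ?thesis using log_spike_no_local_solution[OF \<theta> a(1)] by blast
qed

section \<open>The critical exponent\<close>

theorem theorem5p3:
  fixes \<theta> \<rho> :: real
  assumes "0 < \<theta>" and "\<theta> \<le> 2" and "0 < \<rho>"
  shows "(\<forall>(r::real) (\<phi> :: real ^ 'n \<Rightarrow> real).
            r > real CARD('n) / \<theta> \<longrightarrow> \<phi> \<in> borel_measurable lebesgue \<longrightarrow> (\<forall>x. 0 \<le> \<phi> x) \<longrightarrow>
            (\<lambda>x. exp (r * \<phi> x)) \<in> L1_ul \<rho> \<longrightarrow> has_local_solution \<theta> \<phi>)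
       \<and> (\<forall>(r::real) (\<phi> :: real ^ 'n \<Rightarrow> real).
            r = real CARD('n) / \<theta> \<longrightarrow> \<phi> \<in> borel_measurable lebesgue \<longrightarrow> (\<forall>x. 0 \<le> \<phi> x) \<longrightarrow>
            (\<lambda>x. exp (r * \<phi> x)) \<in> L1_ul_closure_BUC \<rho> \<longrightarrow> has_local_solution \<theta> \<phi>)
       \<and> (\<forall>r::real. 0 < r \<longrightarrow> r < real CARD('n) / \<theta> \<longrightarrow>
            (\<exists>\<phi> :: real ^ 'n \<Rightarrow> real. \<phi> \<in> borel_measurable lebesgue \<and> (\<forall>x. 0 \<le> \<phi> x) \<and>
               (\<lambda>x. exp (r * \<phi> x)) \<in> L1_ul \<rho> \<and> \<not> has_local_solution \<theta> \<phi>))"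
proof (intro conjI allI impI)
  fix r :: real and \<phi> :: "real ^ 'n \<Rightarrow> real"
  assume "r > real CARD('n) / \<theta>" "\<phi> \<in> borel_measurable lebesgue" "\<forall>x. 0 \<le> \<phi> x" "(\<lambda>x. exp (r * \<phi> x)) \<in> L1_ul \<rho>"
  with assms show "has_local_solution \<theta> \<phi>"
    by (intro local_existence_supercritical[of \<theta> \<rho> \<phi> r]) auto
next
  fix r :: real and \<phi> :: "real ^ 'n \<Rightarrow> real"
  assume "r = real CARD('n) / \<theta>" "\<phi> \<in> borel_measurable lebesgue" "\<forall>x. 0 \<le> \<phi> x" "(\<lambda>x. exp (r * \<phi> x)) \<in> L1_ul_closure_BUC \<rho>"
  with assms show "has_local_solution \<theta> \<phi>"
    by (intro local_existence_critical[of \<theta> \<rho> \<phi> r]) auto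
next
  fix r :: real assume "0 < r" "r < real CARD('n) / \<theta>"
  with assms show "\<exists>\<phi> :: real ^ 'n \<Rightarrow> real. \<phi> \<in> borel_measurable lebesgue \<and> (\<forall>x. 0 \<le> \<phi> x) \<and>
       (\<lambda>x. exp (r * \<phi> x)) \<in> L1_ul \<rho> \<and> \<not> has_local_solution \<theta> \<phi>"
    by (intro nonexistence_subcritical) auto
qed

end
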